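(* Let $\beta\in(0,1)$. For any $T>0$, the censored decreasing $\beta$-stable process $S^c$ induces a Feller semigroup on $C_\infty(0,T]$ (via $P^c_tf(x)=\mathbb E_x[f(S^c_t)]$), whose generator is $$\big(-\partial_0^\beta,\ I_0^\beta C_\infty(0,T]\big),$$ i.e. the domain of the generator is the image of $C_\infty(0,T]$ under $I_0^\beta$, and on it the generator acts as $-\partial_0^\beta$.
   Context: Fix $\beta\in(0,1)$. $C_\infty(0,T]=\{u\in C[0,T]:u(0)=0\}$, a Banach space with the sup norm. Functions on $[0,T]$ are extended to a cemetery state $\partial$ by $f(\partial)=0$. Operators: for $\gamma\in(0,1)$ and $u$ continuous and integrable on $(0,T]$, $J_0^\gamma u(x)=\int_0^x\frac{(x-r)^{\gamma-1}}{\Gamma(\gamma)}u(r)\,dr$ (extended by $0$ at $x=0$ for $u\in C[0,T]$). The censored fractional derivative of a continuous integrable $u$ on $(0,T]$ with $J_0^{1-\beta}u\in C^1(0,T]$ is $\partial_0^\beta u(x)=\frac{d}{dx}J_0^{1-\beta}u(x)-\frac{x^{-\beta}}{\Gamma(1-\beta)}u(x)$. For $\psi\in C[0,T]$, $\mathcal K\psi(x)=\int_0^x\frac{(x-r)^{\beta-1}r^{-\beta}}{\Gamma(\beta)\Gamma(1-\beta)}\psi(r)\,dr$ for $x>0$, $\mathcal K\psi(0)=\psi(0)$; and $I_0^\beta g=\sum_{j=0}^\infty\mathcal K^jJ_0^\beta g$ ($\mathcal K^0$ the identity). Process: a $\beta$-stable subordinator is a (càdlàg) Lévy process $-S=\{-S_s\}_{s\ge0}$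 started at $0$ with $\mathbb E[\exp\{kS_s\}]=\exp\{-sk^\beta\}$, $k,s>0$. Let $\{-S^j\}_{j\in\mathbb N}$ be i.i.d. $\beta$-stable subordinators. For $x>0$ define recursively $\tau_0=0$; $\widetilde S^1_t=x+S^1_t$; for $j\ge2$, $\widetilde S^j_t=\widetilde S^{j-1}_{\tau_{j-1}-}+S^j_{t-\tau_{j-1}}$; $\tau_j=\inf\{s>\tau_{j-1}:\widetilde S^j_s\le0\}$; $\tau_\infty=\lim_{j\to\infty}\tau_j$ (where $Y_{t-}$ denotes the left limit). The censored decreasing $\beta$-stable process started at $S^c_0=x$ is $S^c_t=\widetilde S^j_t$ for $\tau_{j-1}\le t<\tau_j$, $j\in\mathbb N$, and $S^c_t=\partial$ for $t\ge\tau_\infty$; if $S^c_0=0$, then $S^c_t=\partial$ for all $t>0$. $\mathbb E_x$ is expectation given $S^c_0=x$. Semigroups: a semigroup on a Banach space $X$ is a family $P=\{P_s\}_{s\ge0}$ of bounded linear operators on $X$ with $P_sP_t=P_{s+t}$ and $P_0$ the identity. A semigroup $P$ on $X=C_\infty(0,T]$ is a Feller semigroup if it is strongly continuous ($P_sf\to f$ in $X$ as $s\to0$ for all $f\in X$) and a positivity preserving contraction ($0\le P_sf\le1$ whenever $s>0$, $f\in X$, $0\le f\le1$). Its generator is $(\mathcal G,\mathcal D)$ with $\mathcal Gf=\lim_{s\to0}(P_sf-f)/s$ and $\mathcal D$ the set of $f\in X$ for which this limit exists in $X$. *)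

theory Defs
  imports "HOL-Probability.Probability"
begin

section \<open>The space of continuous functions vanishing at the origin\<close>

text \<open>A function on $[0,T]$ is represented by the function on the reals that agrees with it on
  $[0,T]$ and is $0$ elsewhere, so that equality of functions on $[0,T]$ is plain equality.\<close>

definition C_inf :: "real \<Rightarrow> (real \<Rightarrow> real) set" where
  "C_inf T = {u. continuous_on {0..T} u \<and> u 0 = 0 \<and> (\<forall>x. x \<notin> {0..T} \<longrightarrow> u x = 0)}"

definition sup_norm :: "real \<Rightarrow> (real \<Rightarrow> real) \<Rightarrow> real" where
  "sup_norm T u = (SUP x\<in>{0..T}. \<bar>u x\<bar>)"


section \<open>Fractional operators\<close>

definition frac_int :: "real \<Rightarrow> real \<Rightarrow> (real \<Rightarrow> real) \<Rightarrow> real \<Rightarrow> real" where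
  "frac_int T \<gamma> u x =
     (if 0 < x \<and> x \<le> T
      then LBINT r:{0<..<x}. (x - r) powr (\<gamma> - 1) / Gamma \<gamma> * u r
      else 0)"

text \<open>The derivatives at $x = T$ are one-sided, since $u$ lives on $(0,T]$ only.\<close>

definition C1_on :: "real set \<Rightarrow> (real \<Rightarrow> real) \<Rightarrow> bool" where
  "C1_on A F \<longleftrightarrow>
     (\<exists>F'. (\<forall>x\<in>A. (F has_real_derivative F' x) (at x within A)) \<and> continuous_on A F')"

definition censored_differentiable :: "real \<Rightarrow> real \<Rightarrow> (real \<Rightarrow> real) \<Rightarrow> bool" where
  "censored_differentiable T \<beta> u \<longleftrightarrow>
     continuous_on {0<..T} u \<and> set_integrable lborel {0<..T} u \<and>
     C1_on {0<..T} (frac_int T (1 - \<beta>) u)"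

definition censored_deriv :: "real \<Rightarrow> real \<Rightarrow> (real \<Rightarrow> real) \<Rightarrow> real \<Rightarrow> real" where
  "censored_deriv T \<beta> u x =
     (if 0 < x \<and> x \<le> T
      then vector_derivative (frac_int T (1 - \<beta>) u) (at x within {0<..T})
           - x powr (- \<beta>) / Gamma (1 - \<beta>) * u x
      else 0)"

definition K_op :: "real \<Rightarrow> real \<Rightarrow> (real \<Rightarrow> real) \<Rightarrow> real \<Rightarrow> real" where
  "K_op T \<beta> \<psi> x =
     (if x = 0 then \<psi> 0
      else if 0 < x \<and> x \<le> T
      then LBINT r:{0<..<x}.
             (x - r) powr (\<beta> - 1) * r powr (- \<beta>) / (Gamma \<beta> * Gamma (1 - \<beta>)) * \<psi> r
      else 0)"

text \<open>For continuous $g$ on $[0,T]$ the series converges uniformly on $[0,T]$, so its pointwise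
  sum is its sum in $C[0,T]$.\<close>

definition I_op :: "real \<Rightarrow> real \<Rightarrow> (real \<Rightarrow> real) \<Rightarrow> real \<Rightarrow> real" where
  "I_op T \<beta> g x = (\<Sum>j. (K_op T \<beta> ^^ j) (frac_int T \<beta> g) x)"


section \<open>Stable subordinators\<close>

text \<open>Stochastic continuity is not listed, as it follows from right-continuity and stationarity
  of the increments.\<close>

definition levy_process :: "'a measure \<Rightarrow> (real \<Rightarrow> 'a \<Rightarrow> real) \<Rightarrow> bool" where
  "levy_process M X \<longleftrightarrow>
     prob_space M \<and>
     (\<forall>t\<ge>0. X t \<in> borel_measurable M) \<and>
     (AE \<omega> in M. X 0 \<omega> = 0) \<and>
     (\<forall>(n::nat) t. 0 \<le> t 0 \<longrightarrow> (\<forall>i<n. t i < t (Suc i)) \<longrightarrow>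
        prob_space.indep_vars M (\<lambda>_. borel) (\<lambda>i \<omega>. X (t (Suc i)) \<omega> - X (t i) \<omega>) {..<n}) \<and>
     (\<forall>s\<ge>0. \<forall>t\<ge>0. distr M borel (\<lambda>\<omega>. X (s + t) \<omega> - X s \<omega>) = distr M borel (X t)) \<and>
     (AE \<omega> in M. (\<forall>t\<ge>0. continuous (at_right t) (\<lambda>s. X s \<omega>)) \<and>
                 (\<forall>t>0. \<exists>l. ((\<lambda>s. X s \<omega>) \<longlongrightarrow> l) (at_left t)))"

definition stable_subordinator :: "'a measure \<Rightarrow> real \<Rightarrow> (real \<Rightarrow> 'a \<Rightarrow> real) \<Rightarrow> bool" where
  "stable_subordinator M \<beta> Y \<longleftrightarrow>
     levy_process M Y \<and>
     (\<forall>k>0. \<forall>s>0. prob_space.expectation M (\<lambda>\<omega>. exp (- k * Y s \<omega>)) = exp (- s * k powr \<beta>))"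

definition process_path :: "(real \<Rightarrow> 'a \<Rightarrow> real) \<Rightarrow> 'a \<Rightarrow> real \<Rightarrow> real" where
  "process_path X \<omega> = (\<lambda>t\<in>{0..}. X t \<omega>)"

text \<open>The processes are numbered $1, 2, \ldots$; \<open>S 0\<close> plays no role. It is \<open>- S j\<close> that is the
  subordinator, so \<open>S j\<close> has almost surely decreasing paths.\<close>

definition iid_neg_stable_subordinators ::
    "'a measure \<Rightarrow> real \<Rightarrow> (nat \<Rightarrow> real \<Rightarrow> 'a \<Rightarrow> real) \<Rightarrow> bool" where
  "iid_neg_stable_subordinators M \<beta> S \<longleftrightarrow>
     (\<forall>j\<ge>1. stable_subordinator M \<beta> (\<lambda>t \<omega>. - S j t \<omega>)) \<and>
     prob_space.indep_vars M (\<lambda>_. PiM {0..} (\<lambda>_. borel)) (\<lambda>j. process_path (S j)) {1..} \<and>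
     (\<forall>j\<ge>1. distr M (PiM {0..} (\<lambda>_. borel)) (process_path (S j)) =
             distr M (PiM {0..} (\<lambda>_. borel)) (process_path (S 1)))"


section \<open>The censored process\<close>

text \<open>Here \<open>p j t\<close> is the value at time \<open>t\<close> of the \<open>j\<close>-th path \<open>S j\<close>, for a fixed outcome. The
  times \<open>tau\<close> are extended reals so that an infimum over the empty set is $\infty$; the value
  \<open>S_tilde p x (Suc j)\<close> is meaningful only if \<open>tau p x j\<close> is finite and is not used otherwise.\<close>

function S_tilde :: "(nat \<Rightarrow> real \<Rightarrow> real) \<Rightarrow> real \<Rightarrow> nat \<Rightarrow> real \<Rightarrow> real"
  and tau :: "(nat \<Rightarrow> real \<Rightarrow> real) \<Rightarrow> real \<Rightarrow> nat \<Rightarrow> ereal"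
where
  "S_tilde p x 0 t = x"
| "S_tilde p x (Suc 0) t = x + p 1 t"
| "S_tilde p x (Suc (Suc j)) t =
     Lim (at_left (real_of_ereal (tau p x (Suc j)))) (S_tilde p x (Suc j))
     + p (Suc (Suc j)) (t - real_of_ereal (tau p x (Suc j)))"
| "tau p x 0 = 0"
| "tau p x (Suc j) = Inf {ereal s |s. tau p x j < ereal s \<and> S_tilde p x (Suc j) s \<le> 0}"
  by pat_completeness auto
termination
  by (relation "Wellfounded.measure (\<lambda>a. case a of Inl (p, x, j, t) \<Rightarrow> 2 * j | Inr (p, x, j) \<Rightarrow> 2 * j + 1)") auto

definition tau_inf :: "(nat \<Rightarrow> real \<Rightarrow> real) \<Rightarrow> real \<Rightarrow> ereal" where
  "tau_inf p x = lim (\<lambda>j. tau p x j)"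

text \<open>The cemetery state is \<open>None\<close>.\<close>

definition censored_path :: "(nat \<Rightarrow> real \<Rightarrow> real) \<Rightarrow> real \<Rightarrow> real \<Rightarrow> real option" where
  "censored_path p x t =
     (if x = 0 then (if t = 0 then Some 0 else None)
      else if ereal t < tau_inf p x
      then Some (S_tilde p x (LEAST j. 1 \<le> j \<and> tau p x (j - 1) \<le> ereal t \<and> ereal t < tau p x j) t)
      else None)"

definition censored_process ::
    "(nat \<Rightarrow> real \<Rightarrow> 'a \<Rightarrow> real) \<Rightarrow> real \<Rightarrow> real \<Rightarrow> 'a \<Rightarrow> real option" where
  "censored_process S x t \<omega> = censored_path (\<lambda>j s. S j s \<omega>) x t"

definition extend_cemetery :: "(real \<Rightarrow> real) \<Rightarrow> real option \<Rightarrow> real" where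
  "extend_cemetery f y = (case y of None \<Rightarrow> 0 | Some z \<Rightarrow> f z)"

text \<open>The paths are regular only almost surely, and so the censored process is measurable only up
  to null sets. Expectations are therefore taken with respect to the completed measure.\<close>

definition censored_semigroup ::
    "'a measure \<Rightarrow> (nat \<Rightarrow> real \<Rightarrow> 'a \<Rightarrow> real) \<Rightarrow> real \<Rightarrow> real \<Rightarrow> (real \<Rightarrow> real) \<Rightarrow> real \<Rightarrow> real" where
  "censored_semigroup M S T t f x =
     (if x \<in> {0..T}
      then prob_space.expectation (completion M) (\<lambda>\<omega>. extend_cemetery f (censored_process S x t \<omega>))
      else 0)"


section \<open>Feller semigroups and their generators\<close>

definition bounded_linear_op :: "real \<Rightarrow> ((real \<Rightarrow> real) \<Rightarrow> real \<Rightarrow> real) \<Rightarrow> bool" where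
  "bounded_linear_op T L \<longleftrightarrow>
     (\<forall>f\<in>C_inf T. L f \<in> C_inf T) \<and>
     (\<forall>f\<in>C_inf T. \<forall>g\<in>C_inf T. L (\<lambda>x. f x + g x) = (\<lambda>x. L f x + L g x)) \<and>
     (\<forall>c. \<forall>f\<in>C_inf T. L (\<lambda>x. c * f x) = (\<lambda>x. c * L f x)) \<and>
     (\<exists>B. \<forall>f\<in>C_inf T. sup_norm T (L f) \<le> B * sup_norm T f)"

definition semigroup_on :: "real \<Rightarrow> (real \<Rightarrow> (real \<Rightarrow> real) \<Rightarrow> real \<Rightarrow> real) \<Rightarrow> bool" where
  "semigroup_on T P \<longleftrightarrow>
     (\<forall>s\<ge>0. bounded_linear_op T (P s)) \<and>
     (\<forall>s\<ge>0. \<forall>t\<ge>0. \<forall>f\<in>C_inf T. P s (P t f) = P (s + t) f) \<and>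
     (\<forall>f\<in>C_inf T. P 0 f = f)"

text \<open>Convergence in the sup norm is uniform convergence on $[0,T]$.\<close>

definition feller_semigroup :: "real \<Rightarrow> (real \<Rightarrow> (real \<Rightarrow> real) \<Rightarrow> real \<Rightarrow> real) \<Rightarrow> bool" where
  "feller_semigroup T P \<longleftrightarrow>
     semigroup_on T P \<and>
     (\<forall>f\<in>C_inf T. uniform_limit {0..T} (\<lambda>s. P s f) f (at_right 0)) \<and>
     (\<forall>s>0. \<forall>f\<in>C_inf T. (\<forall>x\<in>{0..T}. 0 \<le> f x \<and> f x \<le> 1) \<longrightarrow>
        (\<forall>x\<in>{0..T}. 0 \<le> P s f x \<and> P s f x \<le> 1))"

definition has_gen_value ::
    "real \<Rightarrow> (real \<Rightarrow> (real \<Rightarrow> real) \<Rightarrow> real \<Rightarrow> real) \<Rightarrow> (real \<Rightarrow> real) \<Rightarrow> (real \<Rightarrow> real) \<Rightarrow> bool" where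
  "has_gen_value T P f g \<longleftrightarrow>
     g \<in> C_inf T \<and> uniform_limit {0..T} (\<lambda>s x. (P s f x - f x) / s) g (at_right 0)"

definition gen_domain :: "real \<Rightarrow> (real \<Rightarrow> (real \<Rightarrow> real) \<Rightarrow> real \<Rightarrow> real) \<Rightarrow> (real \<Rightarrow> real) set" where
  "gen_domain T P = {f \<in> C_inf T. \<exists>g. has_gen_value T P f g}"

definition gen_op ::
    "real \<Rightarrow> (real \<Rightarrow> (real \<Rightarrow> real) \<Rightarrow> real \<Rightarrow> real) \<Rightarrow> (real \<Rightarrow> real) \<Rightarrow> real \<Rightarrow> real" where
  "gen_op T P f = (THE g. has_gen_value T P f g)"

end

theory Submission
  imports Defs
begin

text \<open>Up to null sets, $-S^j$ has increasing right-continuous paths, and the position of the subordinator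
  just before its first passage over $x$ has the density
  $\frac{(x-r)^{-\beta}}{\Gamma(1-\beta)} \frac{r^{\beta-1}}{\Gamma(\beta)}$, so it never creeps; the
  restarted process therefore jumps out of $y$ with intensity $y^{-\beta}/\Gamma(1-\beta)$, and
  $P_t f$ is the sum over $n$ of the contributions with exactly $n$ restarts. As the potential of the
  subordinator has the density $r^{\beta-1}/\Gamma(\beta)$, integrating the $n$-th contribution over
  all times gives $\mathcal{K}^n J_0^\beta f$, hence $\int_0^\infty P_t f\,dt = I_0^\beta f$.

  The operator $I_0^\beta$ is bounded since $\mathcal{K}$ contracts functions bounded by a multiple
  of $x^\beta$. The Markov property gives $P_h I_0^\beta f = I_0^\beta P_h f$ and
  $I_0^\beta f - P_h I_0^\beta f = \int_0^h P_t f\,dt$, so the generator maps $I_0^\beta f$ to $-f$. Conversely, if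
  $(P_h f - f)/h \to g$, then applying $I_0^\beta$ gives $-f = I_0^\beta g$. Finally $u = I_0^\beta f$
  solves $u = J_0^\beta (f + x^{-\beta} u / \Gamma(1-\beta))$, and applying $J_0^{1-\beta}$ shows that
  $\partial_0^\beta u = f$. For nonnegative $f$ all identities hold between integrals in $[0,\infty]$, and
  the general case follows by linearity.\<close>

section \<open>Power kernels\<close>

text \<open>The obstacle is that the kernel of \<open>K_op\<close> has total mass 1: constants are
  fixed points, so neither the restart expansion nor the series of \<open>I_op\<close> decays on
  functions that are merely bounded. Vanishing at 0 repairs this. Such a function lies below e + C x
  for every e > 0, and the function x is an eigenfunction of the kernel with eigenvalue 1 - \<beta>;
  hence what remains after n restarts is at most e + C (1 - \<beta>)^n x, uniformly in time. This
  gives continuity of the semigroup in the starting point. For \<open>I_op\<close> the eigenfunction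
  x^\<beta> is used instead, because \<open>frac_int\<close> maps bounded functions below a multiple
  of it; its eigenvalue 1 / (Gamma (1 - \<beta>) Gamma (1 + \<beta>)) is less than 1 by a Jensen
  argument. The second obstacle is that a subordinator is given only by its Laplace transform. Its
  jump intensity is recovered as the limit of P(Y_e \<ge> z) / e for small e, and the law at first
  passage comes from averaging over short time windows, in place of a compensation formula for
  jumps.\<close>

definition pw :: "real \<Rightarrow> real \<Rightarrow> ennreal" where
  "pw \<gamma> r = (if 0 < r then ennreal (r powr (\<gamma> - 1) / Gamma \<gamma>) else 0)"

lemma measurable_pw [measurable]: "pw \<gamma> \<in> borel_measurable borel"
  unfolding pw_def by measurable

lemma pw_nonpos [simp]: "r \<le> 0 \<Longrightarrow> pw \<gamma> r = 0"
  by (simp add: pw_def)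

lemma pw_mult_self:
  assumes "0 < a" "0 < b" "0 < a + b - 1"
  shows "pw a r * pw b r = ennreal (Gamma (a + b - 1) / (Gamma a * Gamma b)) * pw (a + b - 1) r"
proof (cases "0 < r")
  case True
  have G: "Gamma (a + b - 1) > 0" "Gamma a > 0" "Gamma b > 0"
    using assms by (auto intro!: Gamma_real_pos)
  have "r powr (a - 1) * r powr (b - 1) = r powr (a + b - 1 - 1)"
    by (simp add: powr_add[symmetric])
  then show ?thesis using True G
    by (simp add: pw_def ennreal_mult[symmetric] less_imp_le field_simps)
qed simp

text \<open>Replacing r by r / k reduces this to the Gamma integral. With \<gamma> = \<beta> it
  identifies the potential density, with \<gamma> = 1 - \<beta> the tail of the jump
  measure.\<close>

lemma nn_integral_pw_exp:
  assumes "0 < \<gamma>" "0 < k"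
  shows "(\<integral>\<^sup>+r. pw \<gamma> r * ennreal (exp (- k * r)) \<partial>lborel) = ennreal (k powr (- \<gamma>))"
proof -
  have "(\<integral>\<^sup>+r. pw \<gamma> r * ennreal (exp (- k * r)) \<partial>lborel)
      = ennreal (1 / k) * (\<integral>\<^sup>+r. pw \<gamma> (0 + (1 / k) * r) * ennreal (exp (- k * (0 + (1 / k) * r))) \<partial>lborel)"
    using assms by (subst nn_integral_real_affine[where t = 0 and c = "1 / k"]) auto
  also have "(\<integral>\<^sup>+r. pw \<gamma> (0 + (1 / k) * r) * ennreal (exp (- k * (0 + (1 / k) * r))) \<partial>lborel)
      = (\<integral>\<^sup>+r. ennreal ((1 / k) powr (\<gamma> - 1) / Gamma \<gamma>) * ennreal (indicator {0..} r * r powr (\<gamma> - 1) / exp r) \<partial>lborel)"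
    using assms
    by (intro nn_integral_cong)
      (auto simp: pw_def ennreal_mult[symmetric] Gamma_real_pos less_imp_le indicator_def
         powr_mult powr_divide exp_minus field_simps zero_less_divide_iff intro!: arg_cong[where f=ennreal])
  also have "\<dots> = ennreal ((1 / k) powr (\<gamma> - 1) / Gamma \<gamma>) * ennreal (Gamma \<gamma>)"
    using assms by (subst nn_integral_cmult) (auto simp: Gamma_conv_nn_integral_real)
  also have "ennreal (1 / k) * \<dots> = ennreal (k powr (- \<gamma>))"
    using assms Gamma_real_pos[of \<gamma>] less_imp_neq[OF Gamma_real_pos[of \<gamma>]]
    by (auto simp: ennreal_mult[symmetric] less_imp_le powr_divide powr_diff powr_minus field_simps
        intro!: arg_cong[where f=ennreal])
  finally show ?thesis .
qed

text \<open>The semigroup law of the Riemann-Liouville kernels: r = x s turns the convolution into a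
  Beta integral. All explicit evaluations below, such as the mass and the mean of the kernel of
  \<open>K_op\<close>, are instances of it.\<close>

lemma nn_integral_pw_conv:
  assumes "0 < a" "0 < b"
  shows "(\<integral>\<^sup>+r. pw a (x - r) * pw b r \<partial>lborel) = pw (a + b) x"
proof (cases "0 < x")
  case False
  have "pw a (x - r) * pw b r = 0" for r
    using False by (cases "0 < r") auto
  then show ?thesis using False by (simp del: mult_eq_0_iff)
next
  case True
  have G: "Gamma a > 0" "Gamma b > 0" "Gamma (a + b) > 0"
    using assms by (auto intro!: Gamma_real_pos)
  have "(\<integral>\<^sup>+r. pw a (x - r) * pw b r \<partial>lborel) = ennreal x * (\<integral>\<^sup>+r. pw a (x - (0 + x * r)) * pw b (0 + x * r) \<partial>lborel)"
    using True by (subst nn_integral_real_affine[where t = 0 and c = x]) auto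
  also have "(\<integral>\<^sup>+r. pw a (x - (0 + x * r)) * pw b (0 + x * r) \<partial>lborel)
     = (\<integral>\<^sup>+r. ennreal (x powr (a + b - 2) / (Gamma a * Gamma b)) *
          ennreal (indicator {0..1} r * (r powr (b - 1) * (1 - r) powr (a - 1))) \<partial>lborel)"
  proof (intro nn_integral_cong_AE AE_I2)
    fix r :: real
    show "pw a (x - (0 + x * r)) * pw b (0 + x * r) = ennreal (x powr (a + b - 2) / (Gamma a * Gamma b)) *
          ennreal (indicator {0..1} r * (r powr (b - 1) * (1 - r) powr (a - 1)))"
    proof (cases "0 < r \<and> r < 1")
      case r: True
      have "x * (1 - r) > 0" "x * r > 0" using r True by auto
      then have "pw a (x - (0 + x * r)) * pw b (0 + x * r)
        = ennreal ((x * (1 - r)) powr (a - 1) / Gamma a * ((x * r) powr (b - 1) / Gamma b))"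
        using G by (subst ennreal_mult) (auto simp: pw_def right_diff_distrib)
      also have "(x * (1 - r)) powr (a - 1) / Gamma a * ((x * r) powr (b - 1) / Gamma b)
         = (x powr (a + b - 2) / (Gamma a * Gamma b)) * (r powr (b - 1) * (1 - r) powr (a - 1))"
      proof -
        have "x powr (a + b - 2) = x powr (a - 1) * x powr (b - 1)"
          by (simp add: powr_add[symmetric])
        then show ?thesis using r True by (simp add: powr_mult)
      qed
      finally show ?thesis using r G by (simp add: ennreal_mult[symmetric] indicator_def)
    next
      case False
      then consider "r \<le> 0" | "r \<ge> 1" by linarith
      then show ?thesis
      proof cases
        case 1
        then have "x * r \<le> 0" using True by (simp add: mult_nonneg_nonpos)
        then show ?thesis using 1 by (auto simp: indicator_def)
      next
        case 2
        then have "x - (0 + x * r) \<le> 0" using True by simp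
        then show ?thesis using 2 by (auto simp: indicator_def)
      qed
    qed
  qed
  also have "\<dots> = ennreal (x powr (a + b - 2) / (Gamma a * Gamma b)) * ennreal (Beta b a)"
    using nn_integral_has_integral_lebesgue[OF _ has_integral_Beta_real[of b a]] assms
    by (subst nn_integral_cmult) auto
  also have "ennreal x * \<dots> = pw (a + b) x"
  proof -
    have "x * (x powr (a + b - 2) / (Gamma a * Gamma b) * Beta b a) = x powr (a + b - 1) / Gamma (a + b)"
    proof -
      have "x powr (a + b - 1) = x * x powr (a + b - 2)"
        using True powr_add[of x 1 "a + b - 2"] by (simp add: algebra_simps)
      then show ?thesis using G by (simp add: Beta_def add.commute)
    qed
    moreover have "Beta b a \<ge> 0" using G by (simp add: Beta_def add.commute)
    ultimately show ?thesis
      using True G by (simp add: pw_def ennreal_mult[symmetric])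
  qed
  finally show ?thesis .
qed

section \<open>Measures on the half-line and their Laplace transforms\<close>

lemma Weierstrass_polynomial:
  fixes f :: "real \<Rightarrow> real"
  assumes "continuous_on {0..1} f" "0 < e"
  obtains n a where "\<And>x. x \<in> {0..1} \<Longrightarrow> \<bar>f x - (\<Sum>i\<le>n. a i * x ^ i)\<bar> < e"
proof -
  obtain g where g: "real_polynomial_function g" "\<And>x. x \<in> {0..1} \<Longrightarrow> \<bar>f x - g x\<bar> < e"
    using Stone_Weierstrass_real_polynomial_function[of "{0..1::real}" f e] assms by auto
  obtain a n where "g = (\<lambda>x. \<Sum>i\<le>n. a i * x ^ i)"
    using g(1) by (auto simp: real_polynomial_function_iff_sum)
  with g(2) that show ?thesis by blast
qed

text \<open>A finite measure on $[0,\infty)$ is weighted by $e^{-z}$ so that its Laplace transform at the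
  positive integers becomes its moment sequence in the variable $e^{-z} \in [0,1]$.\<close>

lemma Laplace_continuity:
  fixes m :: "nat \<Rightarrow> real measure" and m' :: "real measure" and c :: "real \<Rightarrow> real"
  assumes sets: "\<And>i. sets (m i) = sets borel" "sets m' = sets borel"
    and nonneg: "\<And>i. AE z in m i. 0 \<le> z" "AE z in m'. 0 \<le> z"
    and lap: "\<And>k i. 1 \<le> k \<Longrightarrow> (\<integral>\<^sup>+z. ennreal (exp (- (real k * z))) \<partial>m i) = ennreal (l k i)"
    and lap': "\<And>k. 1 \<le> k \<Longrightarrow> (\<integral>\<^sup>+z. ennreal (exp (- (real k * z))) \<partial>m') = ennreal (l' k)"
    and nn: "\<And>k i. 0 \<le> l k i" "\<And>k. 0 \<le> l' k"
    and lim: "\<And>k. 1 \<le> k \<Longrightarrow> (\<lambda>i. l k i) \<longlonglongrightarrow> l' k"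
    and c: "continuous_on UNIV c"
  shows "(\<lambda>i. LINT z|m i. exp (- z) * c (exp (- z))) \<longlonglongrightarrow> (LINT z|m'. exp (- z) * c (exp (- z)))"
    and "\<And>i. integrable (m i) (\<lambda>z. exp (- z) * c (exp (- z)))"
    and "integrable m' (\<lambda>z. exp (- z) * c (exp (- z)))"
proof -
  note [measurable_cong] = sets
  have [measurable]: "c \<in> borel_measurable borel"
    by (rule borel_measurable_continuous_onI[OF c])
  have c_bound: "\<exists>B. \<forall>v\<in>{0..1}. \<bar>c v\<bar> \<le> B"
    using compact_imp_bounded[OF compact_continuous_image[OF continuous_on_subset[OF c] compact_Icc[of 0 1]]]
    by (auto simp: bounded_iff)
  have pow_eq: "exp (- z) * exp (- z) ^ j = exp (- (real (Suc j) * z))" for z :: real and j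
    by (simp add: exp_of_nat_mult[symmetric] exp_add[symmetric] algebra_simps)
  have moments: "integrable \<mu> (\<lambda>z. exp (- z) * exp (- z) ^ j)"
       "(LINT z|\<mu>. exp (- z) * exp (- z) ^ j) = L (Suc j)"
    if [measurable_cong]: "sets \<mu> = sets borel"
      and "\<And>k. 1 \<le> k \<Longrightarrow> (\<integral>\<^sup>+z. ennreal (exp (- (real k * z))) \<partial>\<mu>) = ennreal (L k)" "\<And>k. 0 \<le> L k"
    for \<mu> :: "real measure" and L :: "nat \<Rightarrow> real" and j
  proof -
    have eq: "(\<integral>\<^sup>+z. ennreal (exp (- z) * exp (- z) ^ j) \<partial>\<mu>) = ennreal (L (Suc j))"
      using that(2)[of "Suc j"] by (simp add: pow_eq del: of_nat_Suc)
    show "integrable \<mu> (\<lambda>z. exp (- z) * exp (- z) ^ j)"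
      by (rule integrableI_nonneg) (auto simp: eq)
    show "(LINT z|\<mu>. exp (- z) * exp (- z) ^ j) = L (Suc j)"
      by (subst integral_eq_nn_integral) (auto simp: eq that)
  qed
  have fm: "integrable \<mu> (\<lambda>z. exp (- z) * c (exp (- z)))"
    if [measurable_cong]: "sets \<mu> = sets borel" and ae: "AE z in \<mu>. 0 \<le> z"
      and "integrable \<mu> (\<lambda>z. exp (- z) * exp (- z) ^ 0)" for \<mu> :: "real measure"
  proof -
    obtain B where B: "\<And>v. v \<in> {0..1} \<Longrightarrow> \<bar>c v\<bar> \<le> B" using c_bound by blast
    show ?thesis
    proof (rule Bochner_Integration.integrable_bound)
      show "integrable \<mu> (\<lambda>z. B * exp (- z))" using that(3) by simp
      show "AE z in \<mu>. norm (exp (- z) * c (exp (- z))) \<le> norm (B * exp (- z))"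
        using ae
      proof eventually_elim
        case (elim z)
        then have "\<bar>c (exp (- z))\<bar> \<le> \<bar>B\<bar>" by (intro order_trans[OF B]) auto
        then show ?case by (simp add: abs_mult)
      qed
    qed simp
  qed
  show "\<And>i. integrable (m i) (\<lambda>z. exp (- z) * c (exp (- z)))"
    using fm[OF sets(1) nonneg(1) moments(1)[OF sets(1) lap nn(1)]] .
  show "integrable m' (\<lambda>z. exp (- z) * c (exp (- z)))"
    using fm[OF sets(2) nonneg(2) moments(1)[OF sets(2) lap' nn(2)]] .
  show "(\<lambda>i. LINT z|m i. exp (- z) * c (exp (- z))) \<longlonglongrightarrow> (LINT z|m'. exp (- z) * c (exp (- z)))"
  proof (rule LIMSEQ_I)
    fix e :: real assume "0 < e"
    \<comment> \<open>The weighted measures have total masses \<open>l 1 i\<close> and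
      \<open>l' 1\<close>, and eventually their sum is below \<open>D\<close>. With
      \<open>d = e / (2 * D)\<close> the two polynomial approximation errors together cost at most e
      / 2; the other half is left for the convergence of the moments.\<close>
    define D where "D = 2 * l' 1 + 2"
    have D: "D > 0" using nn(2)[of 1] by (simp add: D_def)
    define d where "d = e / (2 * D)"
    have d: "0 < d" using D \<open>0 < e\<close> by (simp add: d_def)
    obtain n a where pol: "\<And>x. x \<in> {0..1} \<Longrightarrow> \<bar>c x - (\<Sum>i\<le>n. a i * x ^ i)\<bar> < d"
      using Weierstrass_polynomial[OF continuous_on_subset[OF c subset_UNIV] d] by blast
    define p where "p = (\<lambda>x. \<Sum>i\<le>n. a i * x ^ i)"
    have approx: "\<bar>(LINT z|\<mu>. exp (- z) * c (exp (- z))) - (\<Sum>j\<le>n. a j * L (Suc j))\<bar> \<le> d * L 1"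
      if [measurable_cong]: "sets \<mu> = sets borel" and ae: "AE z in \<mu>. 0 \<le> z"
        and L: "\<And>k. 1 \<le> k \<Longrightarrow> (\<integral>\<^sup>+z. ennreal (exp (- (real k * z))) \<partial>\<mu>) = ennreal (L k)" "\<And>k. 0 \<le> L k"
      for \<mu> :: "real measure" and L :: "nat \<Rightarrow> real"
    proof -
      note mo = moments[OF that(1) L]
      have p_eq: "exp (- z) * p (exp (- z)) = (\<Sum>j\<le>n. a j * (exp (- z) * exp (- z) ^ j))" for z
        unfolding p_def by (subst sum_distrib_left) (simp add: mult.left_commute)
      have p_int: "integrable \<mu> (\<lambda>z. exp (- z) * p (exp (- z)))"
        unfolding p_eq by (intro Bochner_Integration.integrable_sum integrable_mult_right mo(1))
      have "(LINT z|\<mu>. exp (- z) * p (exp (- z))) = (\<Sum>j\<le>n. a j * L (Suc j))"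
        unfolding p_eq
        by (subst Bochner_Integration.integral_sum)
          (simp_all only: integral_mult_right_zero mo(2) integrable_mult_right mo(1))
      then have "(LINT z|\<mu>. exp (- z) * c (exp (- z))) - (\<Sum>j\<le>n. a j * L (Suc j))
          = (LINT z|\<mu>. exp (- z) * c (exp (- z)) - exp (- z) * p (exp (- z)))"
        using Bochner_Integration.integral_diff[OF fm[OF that(1) ae mo(1)] p_int] by simp
      also have "\<bar>\<dots>\<bar> \<le> (LINT z|\<mu>. \<bar>exp (- z) * c (exp (- z)) - exp (- z) * p (exp (- z))\<bar>)"
        by (rule integral_abs_bound)
      also have "\<dots> \<le> (LINT z|\<mu>. d * (exp (- z) * exp (- z) ^ 0))"
      proof (rule integral_mono_AE)
        show "integrable \<mu> (\<lambda>z. \<bar>exp (- z) * c (exp (- z)) - exp (- z) * p (exp (- z))\<bar>)"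
          by (intro integrable_abs Bochner_Integration.integrable_diff fm[OF that(1) ae mo(1)] p_int)
        show "integrable \<mu> (\<lambda>z. d * (exp (- z) * exp (- z) ^ 0))"
          by (intro integrable_mult_right mo(1))
        show "AE z in \<mu>. \<bar>exp (- z) * c (exp (- z)) - exp (- z) * p (exp (- z))\<bar> \<le> d * (exp (- z) * exp (- z) ^ 0)"
          using ae
        proof eventually_elim
          case (elim z)
          then have "\<bar>c (exp (- z)) - p (exp (- z))\<bar> < d" unfolding p_def by (intro pol) auto
          then have "exp (- z) * \<bar>c (exp (- z)) - p (exp (- z))\<bar> \<le> exp (- z) * d" by simp
          then show ?case by (simp add: abs_mult right_diff_distrib[symmetric] mult.commute)
        qed
      qed
      finally show ?thesis using mo(2)[of 0] by simp
    qed
    let ?S = "\<lambda>L. \<Sum>j\<le>n. a j * L (Suc j)"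
    have "(\<lambda>i. ?S (\<lambda>k. l k i)) \<longlonglongrightarrow> ?S l'"
      by (intro tendsto_intros lim) auto
    then have "\<forall>\<^sub>F i in sequentially. \<bar>?S (\<lambda>k. l k i) - ?S l'\<bar> < e / 2"
      using \<open>0 < e\<close> by (auto simp: tendsto_iff dist_real_def dest: spec[of _ "e / 2"])
    moreover have "\<forall>\<^sub>F i in sequentially. \<bar>l 1 i - l' 1\<bar> < 1"
      using lim[of 1] by (auto simp: tendsto_iff dist_real_def dest: spec[of _ 1])
    ultimately have "\<forall>\<^sub>F i in sequentially.
      \<bar>(LINT z|m i. exp (- z) * c (exp (- z))) - (LINT z|m'. exp (- z) * c (exp (- z)))\<bar> < e"
    proof eventually_elim
      case (elim i)
      have "\<bar>(LINT z|m i. exp (- z) * c (exp (- z))) - ?S (\<lambda>k. l k i)\<bar> \<le> d * l 1 i"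
        by (rule approx[OF sets(1) nonneg(1) lap nn(1)])
      moreover have "\<bar>(LINT z|m'. exp (- z) * c (exp (- z))) - ?S l'\<bar> \<le> d * l' 1"
        by (rule approx[OF sets(2) nonneg(2) lap' nn(2)])
      moreover have "d * l 1 i + d * l' 1 \<le> d * D"
        using elim(2) d by (auto simp: D_def distrib_left[symmetric])
      moreover have "d * D = e / 2" using D by (simp add: d_def)
      ultimately show ?case using elim(1) by linarith
    qed
    then show "\<exists>N. \<forall>i\<ge>N. norm ((LINT z|m i. exp (- z) * c (exp (- z))) - (LINT z|m'. exp (- z) * c (exp (- z)))) < e"
      by (auto simp: eventually_sequentially)
  qed
qed

text \<open>Lower orthants are closed under intersection and generate the Borel sets. The Euclidean
  generality serves two uses: measures on the line for Laplace uniqueness, and the joint law of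
  passage time and undershoot in the plane.\<close>

lemma measure_eqI_atMost:
  fixes m m' :: "'a :: ordered_euclidean_space measure"
  assumes sets: "sets m = sets borel" "sets m' = sets borel"
    and fin: "\<And>a. emeasure m {..a} \<noteq> \<infinity>" and eq: "\<And>a. emeasure m {..a} = emeasure m' {..a}"
  shows "m = m'"
proof (rule measure_eqI_generator_eq[where \<Omega> = UNIV and E = "range atMost" and A = "\<lambda>i. {..real i *\<^sub>R One}"])
  have "{..a} \<inter> {..b} = {..inf a b}" for a b :: 'a
    by auto
  then show "Int_stable (range atMost :: 'a set set)"
    by (auto simp: Int_stable_def)
  show "sets m = sigma_sets UNIV (range atMost)" "sets m' = sigma_sets UNIV (range atMost)"
    by (simp_all add: sets borel_eq_atMost image_def[symmetric])
  have "\<exists>i. x \<le> real i *\<^sub>R One" for x :: 'a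
  proof -
    obtain i where "norm x \<le> real i" using real_arch_simple by blast
    then have "x \<bullet> b \<le> real i" if "b \<in> Basis" for b
      using Basis_le_norm[OF that, of x] by linarith
    then show ?thesis by (intro exI[of _ i]) (simp add: eucl_le[where 'a = 'a])
  qed
  then show "(\<Union>i. {..real i *\<^sub>R One :: 'a}) = UNIV" by auto
qed (use fin eq in auto)

text \<open>\<open>Laplace_continuity\<close> for a constant sequence shows that both measures agree
  on all weighted test functions; dominated convergence along ramps then gives equality on every
  half-line {..a}.\<close>

lemma Laplace_unique:
  fixes m m' :: "real measure"
  assumes sets: "sets m = sets borel" "sets m' = sets borel"
    and nonneg: "AE z in m. 0 \<le> z" "AE z in m'. 0 \<le> z"
    and lap: "\<And>k. 1 \<le> k \<Longrightarrow> (\<integral>\<^sup>+z. ennreal (exp (- (real k * z))) \<partial>m) = ennreal (l k)"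
      "\<And>k. 1 \<le> k \<Longrightarrow> (\<integral>\<^sup>+z. ennreal (exp (- (real k * z))) \<partial>m') = ennreal (l k)"
    and nn: "\<And>k. 0 \<le> l k"
  shows "m = m'"
proof -
  note [measurable_cong] = sets
  have lc: "(LINT z|m. exp (- z) * c (exp (- z))) = (LINT z|m'. exp (- z) * c (exp (- z)))"
    "integrable m (\<lambda>z. exp (- z) * c (exp (- z)))" "integrable m' (\<lambda>z. exp (- z) * c (exp (- z)))"
    if "continuous_on UNIV c" for c
    using Laplace_continuity[of "\<lambda>_. m" m' "\<lambda>k _. l k" l, OF sets nonneg lap nn nn tendsto_const that]
    by (auto simp: LIMSEQ_const_iff)
  \<comment> \<open>A ramp in v = exp (- z) that steepens to the indicator of v \<ge> exp (- a),
    divided by v to cancel the weight exp (- z). The \<open>max\<close> in the denominator keeps it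
    continuous and bounded and changes nothing where v \<ge> exp (- a).\<close>
  define c where "c = (\<lambda>a (i::nat) v::real. max 0 (min 1 (1 + real i * (v - exp (- a)))) / max v (exp (- a) / 2))"
  have cont: "continuous_on UNIV (c a i)" for a i
    unfolding c_def by (intro continuous_intros) (auto simp: max_def)
  have lim: "(\<lambda>i. exp (- z) * c a i (exp (- z))) \<longlonglongrightarrow> indicator {..a} z" for a z
  proof (cases "z \<le> a")
    case True
    then have "exp (- a) \<le> exp (- z)" by simp
    moreover from this have "exp (- a) < 2 * exp (- z)" using exp_gt_zero[of "- z"] by linarith
    ultimately have "exp (- z) * c a i (exp (- z)) = 1" for i
      by (simp add: c_def max_def min_def mult_nonneg_nonneg)
    then show ?thesis using True by simp
  next
    case False
    define y where "y = exp (- a) - exp (- z)"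
    have "0 < y" using False by (simp add: y_def)
    then obtain n where n: "1 < real n * y" using reals_Archimedean3 by blast
    have "exp (- z) * c a i (exp (- z)) = 0" if "i \<ge> n" for i
    proof -
      have "real n * y \<le> real i * y" using that \<open>0 < y\<close> by (intro mult_right_mono) auto
      then have "1 + real i * (exp (- z) - exp (- a)) \<le> 0" using n by (simp add: y_def algebra_simps)
      then show ?thesis by (simp add: c_def max_def min_def)
    qed
    then have "(\<lambda>i. exp (- z) * c a i (exp (- z))) \<longlonglongrightarrow> 0"
      by (intro tendsto_eventually) (auto simp: eventually_sequentially)
    then show ?thesis using False by simp
  qed
  have bound: "\<bar>exp (- z) * c a i (exp (- z))\<bar> \<le> exp (- z) * (2 / exp (- a))" for a i z
  proof -
    have "\<bar>c a i v\<bar> \<le> 1 / (exp (- a) / 2)" for v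
    proof -
      have "0 \<le> c a i v" unfolding c_def by (intro divide_nonneg_nonneg) (auto simp: le_max_iff_disj)
      moreover have "c a i v \<le> 1 / (exp (- a) / 2)" unfolding c_def by (intro frac_le) auto
      ultimately show ?thesis by simp
    qed
    from mult_left_mono[OF this[of "exp (- z)"], of "exp (- z)"] show ?thesis by (simp add: abs_mult)
  qed
  have conv: "(\<lambda>i. LINT z|\<mu>. exp (- z) * c a i (exp (- z))) \<longlonglongrightarrow> (LINT z|\<mu>. indicator {..a} z)"
      "integrable \<mu> (indicator {..a} :: real \<Rightarrow> real)"
    if [measurable_cong]: "sets \<mu> = sets borel" and i: "integrable \<mu> (\<lambda>z. exp (- z) * 1)" for \<mu> a
  proof -
    have [measurable]: "c a i \<in> borel_measurable borel" for i
      by (rule borel_measurable_continuous_onI[OF cont])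
    have w: "integrable \<mu> (\<lambda>z. exp (- z) * (2 / exp (- a)))"
      using integrable_mult_left[OF i, of "2 / exp (- a)"] by simp
    show "(\<lambda>i. LINT z|\<mu>. exp (- z) * c a i (exp (- z))) \<longlonglongrightarrow> (LINT z|\<mu>. indicator {..a} z)"
      by (rule integral_dominated_convergence[where w = "\<lambda>z. exp (- z) * (2 / exp (- a))"])
        (use lim bound w in auto)
    show "integrable \<mu> (indicator {..a} :: real \<Rightarrow> real)"
      by (rule integrable_dominated_convergence[where w = "\<lambda>z. exp (- z) * (2 / exp (- a))" and s = "\<lambda>i z. exp (- z) * c a i (exp (- z))"])
        (use lim bound w in auto)
  qed
  note i = lc(2,3)[OF continuous_on_const[of UNIV 1]]
  have "(LINT z|m. indicator {..a} z :: real) = (LINT z|m'. indicator {..a} z)" for a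
    using LIMSEQ_unique[OF conv(1)[OF sets(1) i(1), of a]] conv(1)[OF sets(2) i(2), of a] lc(1)[OF cont] by simp
  moreover have "emeasure m {..a} < \<infinity>" "emeasure m' {..a} < \<infinity>" for a
    using conv(2)[OF sets(1) i(1), of a] conv(2)[OF sets(2) i(2), of a] by (auto simp: integrable_indicator_iff)
  ultimately show ?thesis
    by (intro measure_eqI_atMost sets) (auto simp: emeasure_eq_ennreal_measure top.not_eq_extremum)
qed

text \<open>Transforms control only integrals against test functions. Monotonicity upgrades this to
  pointwise convergence: for a bump of mass \<open>W\<close> supported in [u, w], the integral of g
  lies between g(w) W and g(u) W, and likewise for n. Letting u or w approach z and using continuity
  of n closes the gap.\<close>

lemma Laplace_tendsto_antimono:
  fixes g :: "nat \<Rightarrow> real \<Rightarrow> real" and n :: "real \<Rightarrow> real"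
  assumes [measurable]: "\<And>i. g i \<in> borel_measurable borel" "n \<in> borel_measurable borel"
    and g0: "\<And>i z. 0 < z \<Longrightarrow> 0 \<le> g i z" and n0: "\<And>z. 0 < z \<Longrightarrow> 0 \<le> n z"
    and g_anti: "\<And>i z z'. 0 < z \<Longrightarrow> z \<le> z' \<Longrightarrow> g i z' \<le> g i z"
    and n_anti: "\<And>z z'. 0 < z \<Longrightarrow> z \<le> z' \<Longrightarrow> n z' \<le> n z"
    and n_cont: "continuous_on {0<..} n"
    and lap: "\<And>k i. 1 \<le> k \<Longrightarrow>
        (\<integral>\<^sup>+z. ennreal (indicator {0<..} z * g i z) * ennreal (exp (- (real k * z))) \<partial>lborel) = ennreal (l k i)"
      "\<And>k. 1 \<le> k \<Longrightarrow>
        (\<integral>\<^sup>+z. ennreal (indicator {0<..} z * n z) * ennreal (exp (- (real k * z))) \<partial>lborel) = ennreal (l' k)"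
    and nn: "\<And>k i. 0 \<le> l k i" "\<And>k. 0 \<le> l' k"
    and lim: "\<And>k. 1 \<le> k \<Longrightarrow> (\<lambda>i. l k i) \<longlonglongrightarrow> l' k"
    and z: "0 < z"
  shows "(\<lambda>i. g i z) \<longlonglongrightarrow> n z"
proof -
  have key: "\<exists>W>0. \<exists>I I'. I \<longlonglongrightarrow> I' \<and> (\<forall>i. g i w * W \<le> I i \<and> I i \<le> g i u * W) \<and> n w * W \<le> I' \<and> I' \<le> n u * W"
    if uw: "0 < u" "u < w" for u w
  proof -
    \<comment> \<open>In the variable v = exp (- z) this is a parabola cut off at 0; it is positive
      exactly for u < z < w.\<close>
    define c where "c = (\<lambda>v. max 0 ((v - exp (- w)) * (exp (- u) - v)))"
    define \<psi> where "\<psi> = (\<lambda>z. exp (- z) * c (exp (- z)))"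
    have c: "continuous_on UNIV c" unfolding c_def by (intro continuous_intros)
    have [measurable]: "\<psi> \<in> borel_measurable borel"
      unfolding \<psi>_def c_def by measurable
    have \<psi>0: "0 \<le> \<psi> z" for z by (simp add: \<psi>_def c_def)
    have \<psi>_pos: "0 < \<psi> z" if "u < z" "z < w" for z
      using that by (auto simp: \<psi>_def c_def less_max_iff_disj)
    have \<psi>_zero: "\<psi> z = 0" if "z \<le> u \<or> w \<le> z" for z
    proof -
      have "(exp (- z) - exp (- w)) * (exp (- u) - exp (- z)) \<le> 0"
        using that uw by (auto intro: mult_nonneg_nonpos mult_nonpos_nonneg)
      then show ?thesis by (simp add: \<psi>_def c_def)
    qed
    have \<psi>_int: "integrable lborel (\<lambda>z. \<psi> z)"
    proof -
      have "continuous_on {u..w} \<psi>" unfolding \<psi>_def c_def by (intro continuous_intros)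
      then have "set_integrable lborel {u..w} \<psi>" by (rule borel_integrable_compact[OF compact_Icc, simplified set_integrable_def[symmetric]])
      moreover have "indicator {u..w} z *\<^sub>R \<psi> z = \<psi> z" for z using \<psi>_zero[of z] by (cases "z \<le> u \<or> w \<le> z") (auto simp: indicator_def)
      ultimately show ?thesis by (simp only: set_integrable_def)
    qed
    define W where "W = (LINT z|lborel. \<psi> z)"
    have W: "0 < W"
    proof -
      have "W \<noteq> 0"
      proof
        assume "W = 0"
        then have "AE z in lborel. \<psi> z = 0"
          using integral_nonneg_eq_0_iff_AE[OF \<psi>_int] \<psi>0 by (simp add: W_def)
        then have "AE z in lborel. z \<notin> {u<..<w}"
          by eventually_elim (use \<psi>_pos in force)
        then have "emeasure lborel {u<..<w} = 0"
          by (subst (asm) AE_iff_measurable[where N = "{u<..<w}"]) auto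
        then show False using uw by simp
      qed
      then show ?thesis using \<psi>0 by (simp add: W_def order.not_eq_order_implies_strict)
    qed
    define I where "I = (\<lambda>i. LINT z|density lborel (\<lambda>z. ennreal (indicator {0<..} z * g i z)). \<psi> z)"
    define I' where "I' = (LINT z|density lborel (\<lambda>z. ennreal (indicator {0<..} z * n z)). \<psi> z)"
    have dens: "AE z in density lborel (\<lambda>z. ennreal (indicator {0<..} z * f z)). 0 \<le> z"
      "(\<integral>\<^sup>+z. ennreal (exp (- (real k * z))) \<partial>density lborel (\<lambda>z. ennreal (indicator {0<..} z * f z)))
        = (\<integral>\<^sup>+z. ennreal (indicator {0<..} z * f z) * ennreal (exp (- (real k * z))) \<partial>lborel)"
      if [measurable]: "f \<in> borel_measurable borel" for f k
    proof -
      show "AE z in density lborel (\<lambda>z. ennreal (indicator {0<..} z * f z)). 0 \<le> z"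
        by (subst AE_density) (auto simp: indicator_def)
    qed (subst nn_integral_density, simp_all)
    note lc = Laplace_continuity[of "\<lambda>i. density lborel (\<lambda>z. ennreal (indicator {0<..} z * g i z))"
        "density lborel (\<lambda>z. ennreal (indicator {0<..} z * n z))" l l', OF _ _ dens(1) dens(1) _ _ nn lim c,
        unfolded dens(2)[OF assms(1)] dens(2)[OF assms(2)], OF _ _ assms(1,2) lap]
    have L: "I \<longlonglongrightarrow> I'" "\<And>i. integrable (density lborel (\<lambda>z. ennreal (indicator {0<..} z * g i z))) \<psi>"
       "integrable (density lborel (\<lambda>z. ennreal (indicator {0<..} z * n z))) \<psi>"
      unfolding I_def I'_def \<psi>_def by (rule lc; simp)+
    have sandwich: "f w * W \<le> J \<and> J \<le> f u * W"
      if [measurable]: "f \<in> borel_measurable borel" and f0: "\<And>z. 0 < z \<Longrightarrow> 0 \<le> f z"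
        and anti: "\<And>z z'. 0 < z \<Longrightarrow> z \<le> z' \<Longrightarrow> f z' \<le> f z"
        and int: "integrable (density lborel (\<lambda>z. ennreal (indicator {0<..} z * f z))) \<psi>"
        and J: "J = (LINT z|density lborel (\<lambda>z. ennreal (indicator {0<..} z * f z)). \<psi> z)" for f J
    proof -
      have J': "J = (LINT z|lborel. (indicator {0<..} z * f z) * \<psi> z)"
        unfolding J by (subst integral_density) (auto simp: indicator_def f0)
      have int': "integrable lborel (\<lambda>z. (indicator {0<..} z * f z) * \<psi> z)"
        using int by (subst (asm) integrable_density) (auto simp: indicator_def f0)
      have le: "f w * \<psi> z \<le> (indicator {0<..} z * f z) * \<psi> z" "(indicator {0<..} z * f z) * \<psi> z \<le> f u * \<psi> z" for z
      proof -
        have "f w * \<psi> z \<le> (indicator {0<..} z * f z) * \<psi> z \<and> (indicator {0<..} z * f z) * \<psi> z \<le> f u * \<psi> z"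
        proof (cases "u < z \<and> z < w")
          case True
          then show ?thesis using anti[of z w] anti[of u z] uw \<psi>0[of z] by (simp add: mult_right_mono)
        next
          case False
          then have "\<psi> z = 0" by (intro \<psi>_zero) auto
          then show ?thesis by simp
        qed
        then show "f w * \<psi> z \<le> (indicator {0<..} z * f z) * \<psi> z" "(indicator {0<..} z * f z) * \<psi> z \<le> f u * \<psi> z" by auto
      qed
      show ?thesis unfolding J' W_def integral_mult_right_zero[symmetric]
        by (intro conjI integral_mono int' integrable_mult_right \<psi>_int le)
    qed
    have "g i w * W \<le> I i \<and> I i \<le> g i u * W" for i
      by (rule sandwich[OF _ g0 g_anti L(2)]) (auto simp: I_def)
    moreover have "n w * W \<le> I' \<and> I' \<le> n u * W"
      by (rule sandwich[OF _ n0 n_anti L(3)]) (auto simp: I'_def)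
    ultimately show ?thesis using W L(1) by blast
  qed
  have n_lim: "(n \<longlongrightarrow> n z) (at z)"
    using n_cont z by (simp add: continuous_on_eq_continuous_at isCont_def)
  show ?thesis
  proof (rule order_tendstoI)
    fix a assume "a < n z"
    then have "\<forall>\<^sub>F y in at_right z. a < n y"
      using order_tendstoD(1)[OF n_lim] eventually_at_split by blast
    then have "\<forall>\<^sub>F y in at_right z. a < n y \<and> z < y"
      using eventually_at_right_less[of z] by eventually_elim auto
    then obtain w where w: "a < n w" "z < w" using eventually_happens'[OF trivial_limit_at_right_real] by blast
    obtain W I I' where W: "0 < W" "I \<longlonglongrightarrow> I'" "\<And>i. I i \<le> g i z * W" "n w * W \<le> I'"
      using key[OF z w(2)] by blast
    have "a * W < I'" using w(1) W by (intro less_le_trans[OF _ W(4)]) simp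
    from order_tendstoD(1)[OF W(2) this] show "\<forall>\<^sub>F i in sequentially. a < g i z"
      by eventually_elim (use W(1,3) in \<open>meson less_le_trans mult_less_cancel_right_pos\<close>)
  next
    fix a assume "n z < a"
    then have "\<forall>\<^sub>F y in at_left z. n y < a"
      using order_tendstoD(2)[OF n_lim] eventually_at_split by blast
    then have "\<forall>\<^sub>F y in at_left z. n y < a \<and> y < z \<and> 0 < y"
      using z by (auto simp: eventually_conj_iff eventually_at_left[OF z] intro: exI[of _ 0])
    then obtain u where u: "n u < a" "u < z" "0 < u" using eventually_happens'[OF trivial_limit_at_left_real] by blast
    obtain W I I' where W: "0 < W" "I \<longlonglongrightarrow> I'" "\<And>i. g i z * W \<le> I i" "I' \<le> n u * W"
      using key[OF u(3,2)] by blast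
    have "I' < a * W" using u(1) W by (intro le_less_trans[OF W(4)]) simp
    from order_tendstoD(2)[OF W(2) this] show "\<forall>\<^sub>F i in sequentially. g i z < a"
      by eventually_elim (use W(1,3) in \<open>meson le_less_trans mult_less_cancel_right_pos\<close>)
  qed
qed

section \<open>Subordinators with regular paths\<close>

text \<open>Paths live on the whole time axis and vanish at nonpositive times, so no domain
  conditions arise when times are subtracted. Unboundedness makes every passage time a real
  number.\<close>

definition regular_path :: "(real \<Rightarrow> real) \<Rightarrow> bool" where
  "regular_path y \<longleftrightarrow> mono y \<and> (\<forall>t. continuous (at_right t) y) \<and> (\<forall>t\<le>0. y t = 0) \<and> (\<forall>a. \<exists>t. a \<le> y t)"

definition passage :: "(real \<Rightarrow> real) \<Rightarrow> real \<Rightarrow> real" where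
  "passage y x = (if x \<le> 0 then 0 else Inf {t. x \<le> y t})"

text \<open>This is the left limit y(\<tau>-) at the passage time \<tau>, not the gap x -
  y(\<tau>-); see \<open>tendsto_undershoot\<close>. As a supremum over values below x it can be
  tested at rational times, which gives measurability.\<close>

definition undershoot :: "(real \<Rightarrow> real) \<Rightarrow> real \<Rightarrow> real" where
  "undershoot y x = (if x \<le> 0 then 0 else SUP s\<in>{s. y s < x}. y s)"

lemma regular_pathD:
  assumes "regular_path y"
  shows "s \<le> t \<Longrightarrow> y s \<le> y t" "t \<le> 0 \<Longrightarrow> y t = 0" "0 \<le> y t" "\<exists>t. a \<le> y t"
proof -
  have mono: "mono y" and zero: "\<And>t. t \<le> 0 \<Longrightarrow> y t = 0"
    using assms unfolding regular_path_def by blast+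
  show "s \<le> t \<Longrightarrow> y s \<le> y t" using monoD[OF mono] .
  show "t \<le> 0 \<Longrightarrow> y t = 0" using zero .
  show "\<exists>t. a \<le> y t" using assms unfolding regular_path_def by blast
  show "0 \<le> y t" using monoD[OF mono, of 0 t] zero[of 0] zero[of t] by (cases "t \<le> 0") auto
qed

text \<open>Right continuity moves a strict inequality to a later rational time. Together with
  monotonicity this reduces conditions over all times to countably many.\<close>

lemma regular_path_less_right:
  assumes "regular_path y" "y t < c"
  obtains q where "q \<in> \<rat>" "t < q" "y q < c"
proof -
  have "(y \<longlongrightarrow> y t) (at_right t)"
    using assms(1) by (simp add: regular_path_def continuous_within)
  then have "\<forall>\<^sub>F s in at_right t. y s < c" using assms(2) by (rule order_tendstoD)
  then obtain b where b: "t < b" "\<And>s. t < s \<Longrightarrow> s < b \<Longrightarrow> y s < c"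
    by (auto simp: eventually_at_right_field)
  obtain q where "q \<in> \<rat>" "t < q" "q < b" using Rats_dense_in_real[OF b(1)] by blast
  with b(2) that show ?thesis by blast
qed

context
  fixes y :: "real \<Rightarrow> real" and x :: real
  assumes y: "regular_path y" and x: "0 < x"
begin

text \<open>By right continuity the infimum is attained, so \<open>passage\<close> is an exact
  generalised inverse of the path; the later arguments about passage times go through this
  equivalence.\<close>

lemma passage_le_iff: "passage y x \<le> t \<longleftrightarrow> x \<le> y t"
proof
  have ne: "{t. x \<le> y t} \<noteq> {}" and bdd: "bdd_below {t. x \<le> y t}"
  proof -
    show "{t. x \<le> y t} \<noteq> {}" using regular_pathD(4)[OF y, of x] by blast
    show "bdd_below {t. x \<le> y t}"
    proof (rule bdd_belowI[of _ 0])
      fix t assume "t \<in> {t. x \<le> y t}"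
      then show "0 \<le> t" using regular_pathD(2)[OF y, of t] x by (cases "t \<le> 0") auto
    qed
  qed
  show "passage y x \<le> t" if "x \<le> y t"
    using that x bdd by (auto simp: passage_def intro: cInf_lower)
  assume "passage y x \<le> t"
  show "x \<le> y t"
  proof (rule ccontr)
    assume "\<not> x \<le> y t"
    then obtain q where q: "t < q" "y q < x" using regular_path_less_right[OF y, of t x] by auto
    have "q \<le> passage y x"
      unfolding passage_def if_not_P[OF x[folded not_le]]
    proof (rule cInf_greatest[OF ne])
      fix s assume "s \<in> {t. x \<le> y t}"
      then show "q \<le> s" using q(2) regular_pathD(1)[OF y, of s q] by (cases "q \<le> s") auto
    qed
    then show False using \<open>passage y x \<le> t\<close> q by simp
  qed
qed

lemma passage_pos: "0 < passage y x"
  using passage_le_iff[of 0] regular_pathD(2)[OF y, of 0] x by linarith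

lemma less_passage_iff: "t < passage y x \<longleftrightarrow> y t < x"
  using passage_le_iff[of t] by linarith

lemma undershoot_le_iff: "undershoot y x \<le> c \<longleftrightarrow> (\<forall>s. y s < x \<longrightarrow> y s \<le> c)"
proof -
  have "y 0 < x" using regular_pathD(2)[OF y, of 0] x by simp
  moreover have "bdd_above (y ` {s. y s < x})"
    by (rule bdd_aboveI[of _ x]) auto
  ultimately show ?thesis
    unfolding undershoot_def using x by (subst if_not_P, simp, subst cSUP_le_iff) auto
qed

lemma le_undershoot: "y s < x \<Longrightarrow> y s \<le> undershoot y x"
  using undershoot_le_iff by blast

lemma undershoot_nonneg: "0 \<le> undershoot y x"
  using le_undershoot[of 0] regular_pathD(2)[OF y, of 0] x by simp

lemma tendsto_undershoot: "(y \<longlongrightarrow> undershoot y x) (at_left (passage y x))"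
proof (rule order_tendstoI)
  fix a assume "a < undershoot y x"
  then obtain s where s: "y s < x" "a < y s"
    using undershoot_le_iff[of a] by force
  have "\<forall>\<^sub>F r in at_left (passage y x). s < r"
    using s by (intro eventually_at_leftI[of s]) (auto simp: less_passage_iff)
  then show "\<forall>\<^sub>F r in at_left (passage y x). a < y r"
    by eventually_elim (use s regular_pathD(1)[OF y] in \<open>meson less_imp_le less_le_trans\<close>)
next
  fix a assume a: "undershoot y x < a"
  have "\<forall>\<^sub>F r in at_left (passage y x). r < passage y x" by (auto simp: eventually_at_filter)
  then show "\<forall>\<^sub>F r in at_left (passage y x). y r < a"
    by eventually_elim (use le_undershoot a in \<open>force simp: less_passage_iff\<close>)
qed

end

lemma passage_nonpos [simp]: "x \<le> 0 \<Longrightarrow> passage y x = 0"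
  and undershoot_nonpos [simp]: "x \<le> 0 \<Longrightarrow> undershoot y x = 0"
  by (simp_all add: passage_def undershoot_def)

section \<open>Joint measurability of values, passage times and undershoots\<close>

context
  fixes M :: "'a measure" and Y :: "'a \<Rightarrow> real \<Rightarrow> real"
  assumes meas [measurable]: "\<And>t. (\<lambda>\<omega>. Y \<omega> t) \<in> borel_measurable M"
    and reg: "\<And>\<omega>. \<omega> \<in> space M \<Longrightarrow> regular_path (Y \<omega>)"
begin

lemma measurable_regular_path: "(\<lambda>(t, \<omega>). Y \<omega> t) \<in> borel_measurable (borel \<Otimes>\<^sub>M M)"
proof (subst borel_measurable_iff_less, intro allI)
  fix c :: real
  have "{p \<in> space (borel \<Otimes>\<^sub>M M). (case p of (t, \<omega>) \<Rightarrow> Y \<omega> t) < c}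
      = {p \<in> space (borel \<Otimes>\<^sub>M M). \<exists>q::rat. fst p < of_rat q \<and> Y (snd p) (of_rat q) < c}"
  proof (intro Collect_cong conj_cong refl, clarsimp simp: space_pair_measure)
    fix t \<omega> assume "\<omega> \<in> space M"
    note r = reg[OF this]
    show "Y \<omega> t < c \<longleftrightarrow> (\<exists>q. t < of_rat q \<and> Y \<omega> (of_rat q) < c)"
      using regular_path_less_right[OF r, of t c] regular_pathD(1)[OF r]
      by (metis Rats_cases le_less_trans less_imp_le)
  qed
  also have "\<dots> \<in> sets (borel \<Otimes>\<^sub>M M)" by measurable
  finally show "{p \<in> space (borel \<Otimes>\<^sub>M M). (case p of (t, \<omega>) \<Rightarrow> Y \<omega> t) < c} \<in> sets (borel \<Otimes>\<^sub>M M)" .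
qed

lemma measurable_passage: "(\<lambda>(x, \<omega>). passage (Y \<omega>) x) \<in> borel_measurable (borel \<Otimes>\<^sub>M M)"
proof (subst borel_measurable_iff_le, intro allI)
  fix c :: real
  have "{p \<in> space (borel \<Otimes>\<^sub>M M). (case p of (x, \<omega>) \<Rightarrow> passage (Y \<omega>) x) \<le> c}
      = {p \<in> space (borel \<Otimes>\<^sub>M M). (fst p \<le> 0 \<and> 0 \<le> c) \<or> (0 < fst p \<and> fst p \<le> Y (snd p) c)}"
  proof (intro Collect_cong conj_cong refl, clarsimp simp: space_pair_measure)
    fix x \<omega> assume "\<omega> \<in> space M"
    then show "passage (Y \<omega>) x \<le> c \<longleftrightarrow> x \<le> 0 \<and> 0 \<le> c \<or> 0 < x \<and> x \<le> Y \<omega> c"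
      by (cases "0 < x") (simp_all add: passage_le_iff reg)
  qed
  also have "\<dots> \<in> sets (borel \<Otimes>\<^sub>M M)" by measurable
  finally show "{p \<in> space (borel \<Otimes>\<^sub>M M). (case p of (x, \<omega>) \<Rightarrow> passage (Y \<omega>) x) \<le> c} \<in> sets (borel \<Otimes>\<^sub>M M)" .
qed

lemma measurable_undershoot: "(\<lambda>(x, \<omega>). undershoot (Y \<omega>) x) \<in> borel_measurable (borel \<Otimes>\<^sub>M M)"
proof (subst borel_measurable_iff_le, intro allI)
  fix c :: real
  have "{p \<in> space (borel \<Otimes>\<^sub>M M). (case p of (x, \<omega>) \<Rightarrow> undershoot (Y \<omega>) x) \<le> c}
      = {p \<in> space (borel \<Otimes>\<^sub>M M). (fst p \<le> 0 \<and> 0 \<le> c) \<or>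
          (0 < fst p \<and> (\<forall>q::rat. Y (snd p) (of_rat q) < fst p \<longrightarrow> Y (snd p) (of_rat q) \<le> c))}"
  proof (intro Collect_cong conj_cong refl, clarsimp simp: space_pair_measure)
    fix x \<omega> assume "\<omega> \<in> space M"
    note r = reg[OF this]
    show "undershoot (Y \<omega>) x \<le> c \<longleftrightarrow> x \<le> 0 \<and> 0 \<le> c \<or> 0 < x \<and> (\<forall>q. Y \<omega> (of_rat q) < x \<longrightarrow> Y \<omega> (of_rat q) \<le> c)"
    proof (cases "0 < x")
      case True
      have "(\<forall>s. Y \<omega> s < x \<longrightarrow> Y \<omega> s \<le> c) \<longleftrightarrow> (\<forall>q. Y \<omega> (of_rat q) < x \<longrightarrow> Y \<omega> (of_rat q) \<le> c)"
        using regular_path_less_right[OF r, of _ x] regular_pathD(1)[OF r]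
        by (metis Rats_cases order_trans less_imp_le)
      then show ?thesis using True by (simp add: undershoot_le_iff[OF r])
    qed simp
  qed
  also have "\<dots> \<in> sets (borel \<Otimes>\<^sub>M M)" by measurable
  finally show "{p \<in> space (borel \<Otimes>\<^sub>M M). (case p of (x, \<omega>) \<Rightarrow> undershoot (Y \<omega>) x) \<le> c} \<in> sets (borel \<Otimes>\<^sub>M M)" .
qed

end

text \<open>Regularity holds for every outcome, so no null sets appear inside the locale. In
  \<open>increments\<close> the independent copy of the process is a second integral over the same
  space; this two-time formula is the Markov property at fixed times.\<close>

locale regular_subordinator = prob_space M for M :: "'a measure" +
  fixes Y :: "'a \<Rightarrow> real \<Rightarrow> real" and \<beta> :: real
  assumes \<beta>: "0 < \<beta>" "\<beta> < 1"
    and meas: "\<And>t. (\<lambda>\<omega>. Y \<omega> t) \<in> borel_measurable M"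
    and reg: "\<And>\<omega>. \<omega> \<in> space M \<Longrightarrow> regular_path (Y \<omega>)"
    and laplace: "\<And>k t. 0 < k \<Longrightarrow> 0 \<le> t \<Longrightarrow> (\<integral>\<^sup>+\<omega>. ennreal (exp (- (k * Y \<omega> t))) \<partial>M) = ennreal (exp (- (t * k powr \<beta>)))"
    and increments: "\<And>s t H. 0 \<le> s \<Longrightarrow> s \<le> t \<Longrightarrow> H \<in> borel_measurable (borel \<Otimes>\<^sub>M borel) \<Longrightarrow>
      (\<integral>\<^sup>+\<omega>. H (Y \<omega> s, Y \<omega> t - Y \<omega> s) \<partial>M) = (\<integral>\<^sup>+\<omega>. \<integral>\<^sup>+\<omega>'. H (Y \<omega> s, Y \<omega>' (t - s)) \<partial>M \<partial>M)"
begin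

sublocale M_lborel: pair_sigma_finite M lborel ..
sublocale M_M: pair_sigma_finite M M ..

lemma measurable_Y [measurable (raw)]:
  assumes "f \<in> borel_measurable N" "g \<in> N \<rightarrow>\<^sub>M M"
  shows "(\<lambda>x. Y (g x) (f x)) \<in> borel_measurable N"
    "(\<lambda>x. passage (Y (g x)) (f x)) \<in> borel_measurable N"
    "(\<lambda>x. undershoot (Y (g x)) (f x)) \<in> borel_measurable N"
  using measurable_compose[OF measurable_Pair[OF assms] measurable_regular_path[OF meas reg]]
    measurable_compose[OF measurable_Pair[OF assms] measurable_passage[OF meas reg]]
    measurable_compose[OF measurable_Pair[OF assms] measurable_undershoot[OF meas reg]]
  by simp_all

lemma Gamma_beta_pos: "0 < Gamma \<beta>" "0 < Gamma (1 - \<beta>)"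
  using \<beta> by (auto intro!: Gamma_real_pos)

lemma expectation_exp:
  assumes "0 < k" "0 \<le> t"
  shows "integrable M (\<lambda>\<omega>. exp (- (k * Y \<omega> t)))" "expectation (\<lambda>\<omega>. exp (- (k * Y \<omega> t))) = exp (- (t * k powr \<beta>))"
proof -
  show "integrable M (\<lambda>\<omega>. exp (- (k * Y \<omega> t)))"
    by (rule integrableI_nonneg) (auto simp: laplace[OF assms])
  show "expectation (\<lambda>\<omega>. exp (- (k * Y \<omega> t))) = exp (- (t * k powr \<beta>))"
    by (subst integral_eq_nn_integral) (auto simp: laplace[OF assms])
qed

section \<open>Small-time tails and the jump intensity\<close>

definition tail :: "real \<Rightarrow> real \<Rightarrow> real" where
  "tail e z = prob {\<omega>\<in>space M. z \<le> Y \<omega> e}"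

lemma tail_antimono: "z \<le> z' \<Longrightarrow> tail e z' \<le> tail e z"
  unfolding tail_def by (rule finite_measure_mono) auto

lemma measurable_tail [measurable]: "tail e \<in> borel_measurable borel"
proof -
  have "mono (\<lambda>z. - tail e z)" by (intro monoI) (simp add: tail_antimono)
  then have "(\<lambda>z. - (- tail e z)) \<in> borel_measurable borel"
    by (intro borel_measurable_uminus borel_measurable_mono)
  then show ?thesis by simp
qed

text \<open>Markov's inequality for 1 - exp (- Y / z), which is at least 1 - exp (- 1) where Y \<ge>
  z, followed by 1 - exp (- a) \<le> a. Linearity in the time e is the point: it dominates
  \<open>tail e z / e\<close> as e tends to 0, and it makes early restarts improbable in the proof
  of strong continuity.\<close>

lemma tail_bound:
  assumes e: "0 \<le> e" and z: "0 < z"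
  shows "tail e z \<le> e * (z powr (- \<beta>) / (1 - exp (- 1)))"
proof -
  have "(1 - exp (- 1)) * tail e z = expectation (\<lambda>\<omega>. (1 - exp (- 1)) * indicator {\<omega>\<in>space M. z \<le> Y \<omega> e} \<omega>)"
    by (simp add: tail_def)
  also have "\<dots> \<le> expectation (\<lambda>\<omega>. 1 - exp (- (1 / z * Y \<omega> e)))"
  proof (rule integral_mono)
    show "integrable M (\<lambda>\<omega>. 1 - exp (- (1 / z * Y \<omega> e)))"
      using expectation_exp(1)[of "1 / z" e] e z by (intro Bochner_Integration.integrable_diff) auto
    fix \<omega> assume "\<omega> \<in> space M"
    then have "0 \<le> Y \<omega> e" using regular_pathD(3)[OF reg] by blast
    then show "(1 - exp (- 1)) * indicator {\<omega>\<in>space M. z \<le> Y \<omega> e} \<omega> \<le> 1 - exp (- (1 / z * Y \<omega> e))"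
      using z by (auto simp: indicator_def field_simps)
  qed (auto intro!: integrable_mult_right simp: integrable_indicator_iff less_top[symmetric])
  also have "\<dots> = 1 - exp (- (e * (1 / z) powr \<beta>))"
    using expectation_exp[of "1 / z" e] e z by (simp add: prob_space)
  also have "\<dots> \<le> e * (1 / z) powr \<beta>"
    using exp_ge_add_one_self[of "- (e * (1 / z) powr \<beta>)"] by linarith
  also have "(1 / z) powr \<beta> = z powr (- \<beta>)" using z by (simp add: powr_divide powr_minus field_simps)
  finally show ?thesis by (simp add: field_simps)
qed

text \<open>Writing the tail as the expectation of an indicator and exchanging integrals leaves the
  expectation of the integral of exp (- k z) over [0, Y].\<close>

lemma tail_laplace:
  assumes k: "0 < k" and e: "0 < e"
  shows "(\<integral>\<^sup>+z. ennreal (indicator {0<..} z * (tail e z / e)) * ennreal (exp (- (k * z))) \<partial>lborel)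
    = ennreal ((1 - exp (- (e * k powr \<beta>))) / (e * k))"
proof -
  have inner: "(\<integral>\<^sup>+z. ennreal (exp (- (k * z))) * indicator {0..b} z \<partial>lborel) = ennreal ((1 - exp (- (k * b))) / k)"
    if "0 \<le> b" for b
  proof -
    have "(\<integral>\<^sup>+z. ennreal (exp (- (k * z))) * indicator {0..b} z \<partial>lborel)
        = ennreal (- exp (- (k * b)) / k - (- exp (- (k * 0)) / k))"
      using k that by (intro nn_integral_FTC_Icc) (auto intro!: derivative_eq_intros)
    then show ?thesis by (simp add: diff_divide_distrib)
  qed
  have "(\<integral>\<^sup>+z. ennreal (indicator {0<..} z * (tail e z / e)) * ennreal (exp (- (k * z))) \<partial>lborel)
     = (\<integral>\<^sup>+z. \<integral>\<^sup>+\<omega>. ennreal (1 / e) * (ennreal (exp (- (k * z))) * indicator {0..Y \<omega> e} z) \<partial>M \<partial>lborel)"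
  proof (rule nn_integral_cong_AE)
    show "AE z in lborel. ennreal (indicator {0<..} z * (tail e z / e)) * ennreal (exp (- (k * z)))
      = (\<integral>\<^sup>+\<omega>. ennreal (1 / e) * (ennreal (exp (- (k * z))) * indicator {0..Y \<omega> e} z) \<partial>M)"
      using AE_lborel_singleton[of 0]
    proof eventually_elim
      case (elim z)
      have "(\<integral>\<^sup>+\<omega>. ennreal (1 / e) * (ennreal (exp (- (k * z))) * indicator {0..Y \<omega> e} z) \<partial>M)
        = (\<integral>\<^sup>+\<omega>. ennreal (1 / e) * (ennreal (exp (- (k * z)))) * (indicator {0<..} z * indicator {\<omega>\<in>space M. z \<le> Y \<omega> e} \<omega>) \<partial>M)"
        using elim by (intro nn_integral_cong) (auto simp: indicator_def)
      also have "\<dots> = ennreal (1 / e) * (ennreal (exp (- (k * z)))) * (indicator {0<..} z * emeasure M {\<omega>\<in>space M. z \<le> Y \<omega> e})"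
        by (simp add: nn_integral_cmult)
      also have "\<dots> = ennreal (indicator {0<..} z * (tail e z / e)) * ennreal (exp (- (k * z)))"
        using e by (auto simp: tail_def emeasure_eq_measure ennreal_mult[symmetric] indicator_def mult_ac divide_inverse)
      finally show ?case by simp
    qed
  qed
  also have "\<dots> = (\<integral>\<^sup>+\<omega>. \<integral>\<^sup>+z. ennreal (1 / e) * (ennreal (exp (- (k * z))) * indicator {0..Y \<omega> e} z) \<partial>lborel \<partial>M)"
    by (rule M_lborel.Fubini') (simp add: indicator_def)
  also have "\<dots> = (\<integral>\<^sup>+\<omega>. ennreal ((1 - exp (- (k * Y \<omega> e))) / (e * k)) \<partial>M)"
    using e k by (intro nn_integral_cong)
      (simp add: nn_integral_cmult inner regular_pathD(3)[OF reg] ennreal_mult[symmetric])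
  also have "\<dots> = ennreal (expectation (\<lambda>\<omega>. (1 - exp (- (k * Y \<omega> e))) / (e * k)))"
    using e k regular_pathD(3)[OF reg] expectation_exp(1)[of k e]
    by (intro nn_integral_eq_integral integrable_divide_zero Bochner_Integration.integrable_diff) auto
  also have "expectation (\<lambda>\<omega>. (1 - exp (- (k * Y \<omega> e))) / (e * k)) = (1 - exp (- (e * k powr \<beta>))) / (e * k)"
    using expectation_exp[of k e] e k by (simp add: prob_space)
  finally show ?thesis .
qed

text \<open>The limit is the tail of the jump measure. By \<open>tail_laplace\<close> the transforms
  are (1 - exp (- e k^\<beta>)) / (e k), a difference quotient tending to k^(\<beta> - 1), the
  transform of z^(- \<beta>) / Gamma (1 - \<beta>).\<close>

lemma tail_tendsto:
  assumes z: "0 < z"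
  shows "(\<lambda>i. real (Suc i) * tail (1 / real (Suc i)) z) \<longlonglongrightarrow> z powr (- \<beta>) / Gamma (1 - \<beta>)"
proof (rule Laplace_tendsto_antimono[OF _ _ _ _ _ _ _ _ _ _ _ _ z,
      where l = "\<lambda>k i. real (Suc i) * (1 - exp (- (real k powr \<beta> / real (Suc i)))) / real k"
        and l' = "\<lambda>k. real k powr (\<beta> - 1)"])
  show "0 \<le> real (Suc i) * tail (1 / real (Suc i)) z" for i z by (simp add: tail_def)
  show "real (Suc i) * tail (1 / real (Suc i)) z' \<le> real (Suc i) * tail (1 / real (Suc i)) z" if "z \<le> z'" for i z z'
    using that by (intro mult_left_mono tail_antimono) auto
  show "z' powr - \<beta> / Gamma (1 - \<beta>) \<le> z powr - \<beta> / Gamma (1 - \<beta>)" if "0 < z" "z \<le> z'" for z z'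
    using that \<beta> Gamma_beta_pos by (intro divide_right_mono powr_mono2') auto
  show "continuous_on {0<..} (\<lambda>z. z powr - \<beta> / Gamma (1 - \<beta>))"
    using Gamma_beta_pos by (intro continuous_intros) auto
  show "(\<integral>\<^sup>+z. ennreal (indicator {0<..} z * (real (Suc i) * tail (1 / real (Suc i)) z)) * ennreal (exp (- (real k * z))) \<partial>lborel)
      = ennreal (real (Suc i) * (1 - exp (- (real k powr \<beta> / real (Suc i)))) / real k)" if "1 \<le> k" for k i
    using tail_laplace[of "real k" "1 / real (Suc i)"] that by (simp add: mult.commute del: of_nat_Suc)
  show "(\<integral>\<^sup>+z. ennreal (indicator {0<..} z * (z powr - \<beta> / Gamma (1 - \<beta>))) * ennreal (exp (- (real k * z))) \<partial>lborel)
      = ennreal (real k powr (\<beta> - 1))" if "1 \<le> k" for k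
  proof -
    have "ennreal (indicator {0<..} z * (z powr - \<beta> / Gamma (1 - \<beta>))) = pw (1 - \<beta>) z" for z
      by (simp add: pw_def indicator_def)
    then show ?thesis using nn_integral_pw_exp[of "1 - \<beta>" "real k"] \<beta> that by simp
  qed
  show "(\<lambda>i. real (Suc i) * (1 - exp (- (real k powr \<beta> / real (Suc i)))) / real k) \<longlonglongrightarrow> real k powr (\<beta> - 1)"
    if "1 \<le> k" for k
  proof -
    let ?c = "real k powr \<beta>"
    have "((\<lambda>h. - exp (- (?c * h))) has_field_derivative ?c) (at 0)"
      by (auto intro!: derivative_eq_intros)
    then have "((\<lambda>h. (1 - exp (- (?c * h))) / h) \<longlongrightarrow> ?c) (at 0)"
      by (simp add: has_field_derivative_iff)
    moreover have "filterlim (\<lambda>i. inverse (real (Suc i))) (at 0) sequentially"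
      using LIMSEQ_inverse_real_of_nat by (auto simp: filterlim_at)
    ultimately have "(\<lambda>i. (1 - exp (- (?c * inverse (real (Suc i))))) / inverse (real (Suc i))) \<longlonglongrightarrow> ?c"
      by (rule filterlim_compose)
    then have "(\<lambda>i. (1 - exp (- (?c * inverse (real (Suc i))))) / inverse (real (Suc i)) / real k) \<longlonglongrightarrow> ?c / real k"
      by (intro tendsto_divide) (use that in auto)
    moreover have "?c / real k = real k powr (\<beta> - 1)" using that by (simp add: powr_diff)
    ultimately show ?thesis by (simp add: divide_inverse mult_ac)
  qed
qed (use Gamma_beta_pos \<beta> in \<open>auto\<close>)

end

section \<open>The law of the undershoot\<close>

text \<open>The average of \<open>y\<close> over a window of length \<open>e\<close> that ends at the passage time replaces a
  discretisation of time: it is eventually constant as \<open>e\<close> tends to \<open>0\<close>.\<close>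

lemma sliding_window:
  fixes t x a :: real
  assumes y: "regular_path y" and x: "0 < x" and a: "0 < a" and t: "0 \<le> t"
    and [measurable]: "y \<in> borel_measurable borel"
  defines "F \<equiv> \<lambda>e. \<integral>\<^sup>+s. (if 0 \<le> s \<and> s \<le> t \<and> y s \<le> x - a \<and> x \<le> y (s + e) then ennreal (1 / e) else 0) \<partial>lborel"
  shows "0 < e \<Longrightarrow> F e \<le> 1"
    and "\<forall>\<^sub>F e in at_right 0. F e = (if passage y x \<le> t \<and> a \<le> x - undershoot y x then 1 else 0)"
proof -
  let ?\<tau> = "passage y x"
  note le = passage_le_iff[OF y x]
  have iff: "y s \<le> x - a \<longrightarrow> s < ?\<tau>" for s using le[of s] a by linarith
  have win: "(\<integral>\<^sup>+s. (if s \<in> {?\<tau> - e..?\<tau>} then ennreal (1 / e) else 0) \<partial>lborel) = 1" if "0 < e" for e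
  proof -
    have "(\<integral>\<^sup>+s. (if s \<in> {?\<tau> - e..?\<tau>} then ennreal (1 / e) else 0) \<partial>lborel)
       = (\<integral>\<^sup>+s. ennreal (1 / e) * indicator {?\<tau> - e..?\<tau>} s \<partial>lborel)"
      by (intro nn_integral_cong) (auto simp: indicator_def)
    then show ?thesis using that by (simp add: nn_integral_cmult ennreal_mult[symmetric])
  qed
  show "F e \<le> 1" if "0 < e"
    unfolding F_def win[OF that, symmetric]
    by (intro nn_integral_mono) (use iff le in \<open>auto simp: field_simps less_imp_le\<close>)
  show "\<forall>\<^sub>F e in at_right 0. F e = (if ?\<tau> \<le> t \<and> a \<le> x - undershoot y x then 1 else 0)"
  proof -
    \<comment> \<open>The integrand is 1 / e on times s that lie in the window [\<tau> - e, \<tau>]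
      and meet the two side conditions. In the first case the whole window qualifies up to its
      endpoint. In the others the window is eventually too short: it lies after t, or after a time r
      < \<tau> at which the path already exceeds x - a.\<close>
    consider "?\<tau> \<le> t" "a \<le> x - undershoot y x" | "t < ?\<tau>" | "x - a < undershoot y x" by linarith
    then show ?thesis
    proof cases
      case 1
      have "F e = 1" if e: "0 < e" "e < ?\<tau>" for e
        unfolding F_def win[OF e(1), symmetric]
      proof (rule nn_integral_cong_AE)
        show "AE s in lborel. (if 0 \<le> s \<and> s \<le> t \<and> y s \<le> x - a \<and> x \<le> y (s + e) then ennreal (1 / e) else 0)
           = (if s \<in> {?\<tau> - e..?\<tau>} then ennreal (1 / e) else 0)"
          using AE_lborel_singleton[of ?\<tau>]
        proof eventually_elim
          case (elim s)
          have "y s \<le> x - a" if "s < ?\<tau>"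
            using le_undershoot[OF y x, of s] less_passage_iff[OF y x, of s] that 1 by linarith
          moreover have "x \<le> y (s + e) \<longleftrightarrow> ?\<tau> - e \<le> s" using le[of "s + e"] by linarith
          ultimately have "0 \<le> s \<and> s \<le> t \<and> y s \<le> x - a \<and> x \<le> y (s + e) \<longleftrightarrow> s \<in> {?\<tau> - e..?\<tau>}"
            using e 1 elim iff[of s] by auto
          then show ?case by simp
        qed
      qed
      then show ?thesis using 1 passage_pos[OF y x] by (auto simp: eventually_at_right_field intro!: exI[of _ ?\<tau>])
    next
      case 2
      have "F e = 0" if e: "0 < e" "e < ?\<tau> - t" for e
      proof -
        have "\<not> (s \<le> t \<and> x \<le> y (s + e))" for s using le[of "s + e"] e by auto
        then have "F e = (\<integral>\<^sup>+(s::real). 0 \<partial>lborel)" unfolding F_def by (intro nn_integral_cong) auto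
        then show ?thesis by simp
      qed
      then show ?thesis using 2 by (auto simp: eventually_at_right_field intro!: exI[of _ "?\<tau> - t"])
    next
      case 3
      then obtain r where r: "y r < x" "x - a < y r"
        using undershoot_le_iff[OF y x, of "x - a"] by force
      then have "r < ?\<tau>" using less_passage_iff[OF y x] by simp
      have "F e = 0" if e: "0 < e" "e < ?\<tau> - r" for e
      proof -
        have "\<not> (y s \<le> x - a \<and> x \<le> y (s + e))" for s
          using le[of "s + e"] e regular_pathD(1)[OF y, of r s] r by (cases "r \<le> s") auto
        then have "F e = (\<integral>\<^sup>+(s::real). 0 \<partial>lborel)" unfolding F_def by (intro nn_integral_cong) auto
        then show ?thesis by simp
      qed
      then show ?thesis using 3 \<open>r < ?\<tau>\<close> by (auto simp: eventually_at_right_field intro!: exI[of _ "?\<tau> - r"])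
    qed
  qed
qed

context regular_subordinator
begin

text \<open>The expectation of the window average is computed in two ways. Pathwise it converges to
  the event on the left by \<open>sliding_window\<close>. By \<open>increments\<close> it equals the
  time integral of the expectation of tail(e, x - Y_s) / e over Y_s \<le> x - a, which converges to
  the right-hand side by \<open>tail_tendsto\<close>. The gap a > 0 keeps away from the singularity
  of z^(- \<beta>) and supplies the dominating constant \<open>C\<close>.\<close>

lemma passage_law_aux:
  assumes x: "0 < x" and a: "0 < a" and t: "0 \<le> t"
  shows "(\<integral>\<^sup>+\<omega>. (if passage (Y \<omega>) x \<le> t \<and> a \<le> x - undershoot (Y \<omega>) x then 1 else 0) \<partial>M)
    = (\<integral>\<^sup>+s. \<integral>\<^sup>+\<omega>. (if 0 \<le> s \<and> s \<le> t \<and> a \<le> x - Y \<omega> s then pw (1 - \<beta>) (x - Y \<omega> s) else 0) \<partial>M \<partial>lborel)"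
proof -
  define e where "e = (\<lambda>i. 1 / real (Suc i))"
  have e0: "0 < e i" "0 \<le> e i" for i by (auto simp: e_def)
  have e_lim: "filterlim e (at_right 0) sequentially"
    unfolding filterlim_at e_def using LIMSEQ_inverse_real_of_nat by (auto simp: divide_inverse)
  define F where "F = (\<lambda>i \<omega>. \<integral>\<^sup>+s. (if 0 \<le> s \<and> s \<le> t \<and> Y \<omega> s \<le> x - a \<and> x \<le> Y \<omega> (s + e i) then ennreal (1 / e i) else 0) \<partial>lborel)"
  define C where "C = a powr (- \<beta>) / (1 - exp (- 1))"
  have C: "0 \<le> C" by (simp add: C_def)
  have "(\<lambda>i. \<integral>\<^sup>+\<omega>. F i \<omega> \<partial>M) \<longlonglongrightarrow> (\<integral>\<^sup>+\<omega>. (if passage (Y \<omega>) x \<le> t \<and> a \<le> x - undershoot (Y \<omega>) x then 1 else 0) \<partial>M)"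
  proof (rule nn_integral_dominated_convergence[where w = "\<lambda>_. 1"])
    have Ym: "Y \<omega> \<in> borel_measurable borel" if "\<omega> \<in> space M" for \<omega>
      using measurable_Y(1)[of id borel "\<lambda>_. \<omega>"] that by simp
    show "AE \<omega> in M. F i \<omega> \<le> 1" for i
      unfolding F_def using sliding_window(1)[OF reg x a t Ym e0(1)] by simp
    show "AE \<omega> in M. (\<lambda>i. F i \<omega>) \<longlonglongrightarrow> (if passage (Y \<omega>) x \<le> t \<and> a \<le> x - undershoot (Y \<omega>) x then 1 else 0)"
      unfolding F_def
      using eventually_compose_filterlim[OF sliding_window(2)[OF reg x a t Ym] e_lim]
      by (intro AE_I2 tendsto_eventually) auto
    show "F i \<in> borel_measurable M" for i unfolding F_def by measurable
  qed (auto simp: emeasure_space_1)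
  moreover have "(\<lambda>i. \<integral>\<^sup>+\<omega>. F i \<omega> \<partial>M) \<longlonglongrightarrow>
     (\<integral>\<^sup>+s. \<integral>\<^sup>+\<omega>. (if 0 \<le> s \<and> s \<le> t \<and> a \<le> x - Y \<omega> s then pw (1 - \<beta>) (x - Y \<omega> s) else 0) \<partial>M \<partial>lborel)"
  proof -
    define G where "G = (\<lambda>i s. \<integral>\<^sup>+\<omega>. (if 0 \<le> s \<and> s \<le> t \<and> a \<le> x - Y \<omega> s then ennreal (1 / e i * tail (e i) (x - Y \<omega> s)) else 0) \<partial>M)"
    have "(\<integral>\<^sup>+\<omega>. F i \<omega> \<partial>M) = (\<integral>\<^sup>+s. G i s \<partial>lborel)" for i
    proof -
      have "(\<integral>\<^sup>+\<omega>. F i \<omega> \<partial>M) = (\<integral>\<^sup>+s. \<integral>\<^sup>+\<omega>. (if 0 \<le> s \<and> s \<le> t \<and> Y \<omega> s \<le> x - a \<and> x \<le> Y \<omega> (s + e i) then ennreal (1 / e i) else 0) \<partial>M \<partial>lborel)"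
        unfolding F_def by (rule M_lborel.Fubini'[symmetric]) simp
      also have "\<dots> = (\<integral>\<^sup>+s. G i s \<partial>lborel)"
      proof (rule nn_integral_cong)
        fix s
        show "(\<integral>\<^sup>+\<omega>. (if 0 \<le> s \<and> s \<le> t \<and> Y \<omega> s \<le> x - a \<and> x \<le> Y \<omega> (s + e i) then ennreal (1 / e i) else 0) \<partial>M) = G i s"
        proof (cases "0 \<le> s \<and> s \<le> t")
          case True
          have "(\<integral>\<^sup>+\<omega>. (if 0 \<le> s \<and> s \<le> t \<and> Y \<omega> s \<le> x - a \<and> x \<le> Y \<omega> (s + e i) then ennreal (1 / e i) else 0) \<partial>M)
            = (\<integral>\<^sup>+\<omega>. (\<lambda>(u, v). if u \<le> x - a \<and> x \<le> u + v then ennreal (1 / e i) else 0) (Y \<omega> s, Y \<omega> (s + e i) - Y \<omega> s) \<partial>M)"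
            using True by (intro nn_integral_cong) auto
          also have "\<dots> = (\<integral>\<^sup>+\<omega>. \<integral>\<^sup>+\<omega>'. (\<lambda>(u, v). if u \<le> x - a \<and> x \<le> u + v then ennreal (1 / e i) else 0) (Y \<omega> s, Y \<omega>' (s + e i - s)) \<partial>M \<partial>M)"
            using True e0[of i] by (intro increments) auto
          also have "\<dots> = G i s"
            unfolding G_def
          proof (rule nn_integral_cong)
            fix \<omega> assume "\<omega> \<in> space M"
            have "(\<integral>\<^sup>+\<omega>'. (\<lambda>(u, v). if u \<le> x - a \<and> x \<le> u + v then ennreal (1 / e i) else 0) (Y \<omega> s, Y \<omega>' (s + e i - s)) \<partial>M)
              = (\<integral>\<^sup>+\<omega>'. (if a \<le> x - Y \<omega> s then ennreal (1 / e i) else 0) * indicator {\<omega>'\<in>space M. x - Y \<omega> s \<le> Y \<omega>' (e i)} \<omega>' \<partial>M)"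
              by (intro nn_integral_cong) (auto simp: indicator_def)
            also have "\<dots> = (if a \<le> x - Y \<omega> s then ennreal (1 / e i) else 0) * emeasure M {\<omega>'\<in>space M. x - Y \<omega> s \<le> Y \<omega>' (e i)}"
              by (rule nn_integral_cmult_indicator) measurable
            also have "\<dots> = (if 0 \<le> s \<and> s \<le> t \<and> a \<le> x - Y \<omega> s then ennreal (1 / e i * tail (e i) (x - Y \<omega> s)) else 0)"
              using True e0[of i] by (simp add: tail_def emeasure_eq_measure ennreal_mult[symmetric])
            finally show "(\<integral>\<^sup>+\<omega>'. (\<lambda>(u, v). if u \<le> x - a \<and> x \<le> u + v then ennreal (1 / e i) else 0) (Y \<omega> s, Y \<omega>' (s + e i - s)) \<partial>M)
              = (if 0 \<le> s \<and> s \<le> t \<and> a \<le> x - Y \<omega> s then ennreal (1 / e i * tail (e i) (x - Y \<omega> s)) else 0)" .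
          qed
          finally show ?thesis .
        qed (auto simp: G_def)
      qed
      finally show ?thesis .
    qed
    moreover have "(\<lambda>i. \<integral>\<^sup>+s. G i s \<partial>lborel) \<longlonglongrightarrow> (\<integral>\<^sup>+s. \<integral>\<^sup>+\<omega>. (if 0 \<le> s \<and> s \<le> t \<and> a \<le> x - Y \<omega> s then pw (1 - \<beta>) (x - Y \<omega> s) else 0) \<partial>M \<partial>lborel)"
    proof (rule nn_integral_dominated_convergence[where w = "\<lambda>s. ennreal C * indicator {0..t} s"])
      have bound: "1 / e i * tail (e i) z \<le> C" if "a \<le> z" for i z
      proof -
        have "tail (e i) z \<le> e i * (z powr (- \<beta>) / (1 - exp (- 1)))" using a that e0 by (intro tail_bound) auto
        also have "\<dots> \<le> e i * C" unfolding C_def using a that \<beta> e0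
          by (intro mult_left_mono divide_right_mono powr_mono2') auto
        finally show ?thesis using e0[of i] by (simp add: field_simps)
      qed
      show "AE s in lborel. G i s \<le> ennreal C * indicator {0..t} s" for i
      proof (rule AE_I2)
        fix s
        have "G i s \<le> (\<integral>\<^sup>+\<omega>. ennreal C * indicator {0..t} s \<partial>M)" unfolding G_def
          using bound C by (intro nn_integral_mono) (auto intro!: ennreal_leI)
        then show "G i s \<le> ennreal C * indicator {0..t} s" by (simp add: emeasure_space_1)
      qed
      show "AE s in lborel. (\<lambda>i. G i s) \<longlonglongrightarrow> (\<integral>\<^sup>+\<omega>. (if 0 \<le> s \<and> s \<le> t \<and> a \<le> x - Y \<omega> s then pw (1 - \<beta>) (x - Y \<omega> s) else 0) \<partial>M)"
      proof (rule AE_I2)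
        fix s
        show "(\<lambda>i. G i s) \<longlonglongrightarrow> (\<integral>\<^sup>+\<omega>. (if 0 \<le> s \<and> s \<le> t \<and> a \<le> x - Y \<omega> s then pw (1 - \<beta>) (x - Y \<omega> s) else 0) \<partial>M)"
          unfolding G_def
        proof (rule nn_integral_dominated_convergence[where w = "\<lambda>s. ennreal C"])
          have *: "(\<lambda>i. ennreal (1 / e i * tail (e i) z)) \<longlonglongrightarrow> pw (1 - \<beta>) z" if "a \<le> z" for z
            using tail_tendsto[of z] a that by (auto simp: e_def pw_def intro!: tendsto_ennrealI)
          show "AE \<omega> in M. (\<lambda>i. if 0 \<le> s \<and> s \<le> t \<and> a \<le> x - Y \<omega> s then ennreal (1 / e i * tail (e i) (x - Y \<omega> s)) else 0)
             \<longlonglongrightarrow> (if 0 \<le> s \<and> s \<le> t \<and> a \<le> x - Y \<omega> s then pw (1 - \<beta>) (x - Y \<omega> s) else 0)"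
          proof (rule AE_I2)
            fix \<omega>
            show "(\<lambda>i. if 0 \<le> s \<and> s \<le> t \<and> a \<le> x - Y \<omega> s then ennreal (1 / e i * tail (e i) (x - Y \<omega> s)) else 0)
             \<longlonglongrightarrow> (if 0 \<le> s \<and> s \<le> t \<and> a \<le> x - Y \<omega> s then pw (1 - \<beta>) (x - Y \<omega> s) else 0)"
              using *[of "x - Y \<omega> s"] by (cases "0 \<le> s \<and> s \<le> t \<and> a \<le> x - Y \<omega> s") auto
          qed
          show "AE \<omega> in M. (if 0 \<le> s \<and> s \<le> t \<and> a \<le> x - Y \<omega> s then ennreal (1 / e i * tail (e i) (x - Y \<omega> s)) else 0) \<le> ennreal C" for i
            using bound by (auto intro!: ennreal_leI)
        qed (auto simp: emeasure_space_1)
      qed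
      show "(\<integral>\<^sup>+s. ennreal C * indicator {0..t} s \<partial>lborel) < \<infinity>"
        using t by (simp add: nn_integral_cmult ennreal_mult[symmetric] C)
    qed (auto simp: G_def)
    ultimately show ?thesis by simp
  qed
  ultimately show ?thesis by (rule LIMSEQ_unique)
qed

text \<open>Both sides are integrals against measures on the plane, which are compared on lower
  orthants. Negating the second coordinate turns the condition a \<le> x - undershoot into such an
  orthant.\<close>

lemma passage_law:
  assumes x: "0 < x" and [measurable]: "h \<in> borel_measurable (borel \<Otimes>\<^sub>M borel)"
  shows "(\<integral>\<^sup>+\<omega>. (if undershoot (Y \<omega>) x < x then h (passage (Y \<omega>) x, x - undershoot (Y \<omega>) x) else 0) \<partial>M)
    = (\<integral>\<^sup>+s. \<integral>\<^sup>+\<omega>. (if 0 \<le> s then pw (1 - \<beta>) (x - Y \<omega> s) * h (s, x - Y \<omega> s) else 0) \<partial>M \<partial>lborel)"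
proof -
  define A where "A = distr (density M (\<lambda>\<omega>. if undershoot (Y \<omega>) x < x then 1 else 0)) borel
     (\<lambda>\<omega>. (passage (Y \<omega>) x, - (x - undershoot (Y \<omega>) x)))"
  define B where "B = distr (density (lborel \<Otimes>\<^sub>M M) (\<lambda>(s, \<omega>). if 0 \<le> s then pw (1 - \<beta>) (x - Y \<omega> s) else 0)) borel
     (\<lambda>(s, \<omega>). (s, - (x - Y \<omega> s)))"
  have nA: "(\<integral>\<^sup>+p. g p \<partial>A) = (\<integral>\<^sup>+\<omega>. (if undershoot (Y \<omega>) x < x then g (passage (Y \<omega>) x, - (x - undershoot (Y \<omega>) x)) else 0) \<partial>M)"
    if g[measurable]: "g \<in> borel_measurable borel" for g :: "real \<times> real \<Rightarrow> ennreal"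
  proof -
    have "(\<lambda>\<omega>. (passage (Y \<omega>) x, - (x - undershoot (Y \<omega>) x))) \<in> M \<rightarrow>\<^sub>M (borel :: (real \<times> real) measure)"
      unfolding borel_prod[symmetric] by measurable
    then show ?thesis unfolding A_def
      by (subst nn_integral_distr, simp, simp, subst nn_integral_density) (auto intro!: nn_integral_cong)
  qed
  have nB: "(\<integral>\<^sup>+p. g p \<partial>B) = (\<integral>\<^sup>+s. \<integral>\<^sup>+\<omega>. (if 0 \<le> s then pw (1 - \<beta>) (x - Y \<omega> s) * g (s, - (x - Y \<omega> s)) else 0) \<partial>M \<partial>lborel)"
    if g[measurable]: "g \<in> borel_measurable borel" for g :: "real \<times> real \<Rightarrow> ennreal"
  proof -
    have [measurable]: "(\<lambda>(s, \<omega>). (s, - (x - Y \<omega> s))) \<in> lborel \<Otimes>\<^sub>M M \<rightarrow>\<^sub>M (borel :: (real \<times> real) measure)"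
      unfolding borel_prod[symmetric] by measurable
    have "(\<integral>\<^sup>+p. g p \<partial>B) = (\<integral>\<^sup>+p. (case p of (s, \<omega>) \<Rightarrow> if 0 \<le> s then pw (1 - \<beta>) (x - Y \<omega> s) else 0) * g (case p of (s, \<omega>) \<Rightarrow> (s, - (x - Y \<omega> s))) \<partial>(lborel \<Otimes>\<^sub>M M))"
      unfolding B_def by (subst nn_integral_distr, simp, simp, subst nn_integral_density) auto
    also have "\<dots> = (\<integral>\<^sup>+s. \<integral>\<^sup>+\<omega>. (if 0 \<le> s then pw (1 - \<beta>) (x - Y \<omega> s) else 0) * g (s, - (x - Y \<omega> s)) \<partial>M \<partial>lborel)"
      by (subst nn_integral_fst[symmetric]) auto
    finally show ?thesis by (simp add: if_distrib[of "\<lambda>z. z * _"] cong: if_cong)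
  qed
  have sets: "sets A = sets borel" "sets B = sets borel" by (simp_all add: A_def B_def)
  have eA: "emeasure A {..(t, b)} = (\<integral>\<^sup>+\<omega>. (if undershoot (Y \<omega>) x < x \<and> passage (Y \<omega>) x \<le> t \<and> - b \<le> x - undershoot (Y \<omega>) x then 1 else 0) \<partial>M)" for t b
    using nA[of "indicator {..(t, b)}"] by (simp add: sets if_distrib[of "\<lambda>z. z * _"]) (auto intro!: nn_integral_cong simp: indicator_def)
  have eB: "emeasure B {..(t, b)} = (\<integral>\<^sup>+s. \<integral>\<^sup>+\<omega>. (if 0 \<le> s \<and> s \<le> t \<and> - b \<le> x - Y \<omega> s then pw (1 - \<beta>) (x - Y \<omega> s) else 0) \<partial>M \<partial>lborel)" for t b
    using nB[of "indicator {..(t, b)}"] by (simp add: sets) (auto intro!: nn_integral_cong simp: indicator_def)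
  have neg: "emeasure A {..(t, b)} = emeasure B {..(t, b)}" if "b < 0" for t b
  proof (cases "0 \<le> t")
    case True
    have "emeasure A {..(t, b)} = (\<integral>\<^sup>+\<omega>. (if passage (Y \<omega>) x \<le> t \<and> - b \<le> x - undershoot (Y \<omega>) x then 1 else 0) \<partial>M)"
      unfolding eA using that by (intro nn_integral_cong) auto
    then show ?thesis unfolding eB using passage_law_aux[OF x, of "- b" t] True that by simp
  next
    case False
    then have "emeasure A {..(t, b)} = (\<integral>\<^sup>+\<omega>. 0 \<partial>M)"
      unfolding eA using passage_pos[OF reg x] by (intro nn_integral_cong) force
    moreover have "emeasure B {..(t, b)} = (\<integral>\<^sup>+(s::real). \<integral>\<^sup>+\<omega>. 0 \<partial>M \<partial>lborel)"
      unfolding eB using False by (intro nn_integral_cong) auto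
    ultimately show ?thesis by simp
  qed
  have "A = B"
  proof (rule measure_eqI_atMost[OF sets])
    fix a :: "real \<times> real"
    obtain t b where a: "a = (t, b)" by (cases a)
    show "emeasure A {..a} \<noteq> \<infinity>"
    proof -
      have "emeasure A {..a} \<le> (\<integral>\<^sup>+\<omega>. 1 \<partial>M)" unfolding a eA by (intro nn_integral_mono) auto
      then show ?thesis by (auto simp: emeasure_space_1 top_unique)
    qed
    show "emeasure A {..a} = emeasure B {..a}"
    proof (cases "b < 0")
      case False
      \<comment> \<open>Both measures live on strictly positive gaps: \<open>A\<close> by its
        density, \<open>B\<close> because \<open>pw\<close> vanishes at nonpositive arguments. Hence
        an orthant with b \<ge> 0 has the mass of the increasing union of the orthants at the
        heights - 1 / (i + 1), which are already settled.\<close>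
      define c where "c = (\<lambda>i. (t, - (1 / real (Suc i))))"
      have inc: "incseq (\<lambda>i. {..c i})"
        unfolding c_def by (intro monoI) (auto simp: field_simps intro: order_trans)
      have U: "(\<Union>i. {..c i}) = {p. fst p \<le> t \<and> snd p < 0}"
      proof (intro set_eqI iffI)
        fix p :: "real \<times> real" assume "p \<in> {p. fst p \<le> t \<and> snd p < 0}"
        moreover from this obtain i where "inverse (real (Suc i)) < - snd p"
          using reals_Archimedean[of "- snd p"] by auto
        ultimately have "p \<le> c i"
          by (simp add: c_def less_eq_prod_def inverse_eq_divide del: of_nat_Suc)
        then show "p \<in> (\<Union>i. {..c i})" by auto
      qed (auto simp: c_def less_eq_prod_def intro: le_less_trans)
      have lim: "emeasure C {..a} = (SUP i. emeasure C {..c i})"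
        if C: "sets C = sets borel" and ae: "(\<integral>\<^sup>+p. (if 0 \<le> snd p then 1 else 0) \<partial>C) = 0" for C :: "(real \<times> real) measure"
      proof -
        have [measurable_cong]: "sets C = sets (borel \<Otimes>\<^sub>M borel)" by (simp only: C borel_prod)
        have "AE p in C. \<not> 0 \<le> snd p"
          using ae by (subst (asm) nn_integral_0_iff_AE) auto
        then have "AE p in C. p \<in> {..a} \<longleftrightarrow> p \<in> {p. fst p \<le> t \<and> snd p < 0}"
          by eventually_elim (use False in \<open>auto simp: a less_eq_prod_def\<close>)
        moreover have "{p \<in> space (borel \<Otimes>\<^sub>M borel). fst p \<le> t \<and> snd p < 0} \<in> sets (borel \<Otimes>\<^sub>M borel :: (real \<times> real) measure)"
          by measurable
        then have "{p. fst p \<le> t \<and> snd p < 0} \<in> sets (borel :: (real \<times> real) measure)"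
          unfolding borel_prod by simp
        ultimately have "emeasure C {..a} = emeasure C {p. fst p \<le> t \<and> snd p < 0}"
          by (intro emeasure_eq_AE) (auto simp: C borel_prod)
        then show ?thesis using SUP_emeasure_incseq[OF _ inc, of C] by (simp add: U C image_subset_iff)
      qed
      have "emeasure A {..a} = (SUP i. emeasure A {..c i})"
        by (rule lim[OF sets(1)], subst nA) (auto simp: borel_prod[symmetric] intro!: nn_integral_zero')
      also have "\<dots> = (SUP i. emeasure B {..c i})"
        unfolding c_def by (simp add: neg)
      also have "\<dots> = emeasure B {..a}"
        by (rule lim[OF sets(2), symmetric], subst nB) (auto simp: borel_prod[symmetric] intro!: nn_integral_zero')
      finally show ?thesis .
    qed (simp add: a neg)
  qed
  moreover have "(\<lambda>p. h (fst p, - snd p)) \<in> borel_measurable borel"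
    unfolding borel_prod[symmetric] by measurable
  ultimately show ?thesis using nA[of "\<lambda>p. h (fst p, - snd p)"] nB[of "\<lambda>p. h (fst p, - snd p)"] by (simp cong: if_cong)
qed

text \<open>The potential measure has Laplace transform k^(- \<beta>), the integral of exp (- s
  k^\<beta>) over s \<ge> 0, and this is also the transform of \<open>pw \<beta>\<close>.\<close>

lemma potential:
  assumes [measurable]: "h \<in> borel_measurable borel"
  shows "(\<integral>\<^sup>+s. \<integral>\<^sup>+\<omega>. (if 0 \<le> s then h (Y \<omega> s) else 0) \<partial>M \<partial>lborel) = (\<integral>\<^sup>+r. pw \<beta> r * h r \<partial>lborel)"
proof -
  define m where "m = distr (density (lborel \<Otimes>\<^sub>M M) (\<lambda>(s, \<omega>). if 0 \<le> s then 1 else 0)) borel (\<lambda>(s, \<omega>). Y \<omega> s)"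
  have nm: "(\<integral>\<^sup>+r. g r \<partial>m) = (\<integral>\<^sup>+s. \<integral>\<^sup>+\<omega>. (if 0 \<le> s then g (Y \<omega> s) else 0) \<partial>M \<partial>lborel)"
    if [measurable]: "g \<in> borel_measurable borel" for g :: "real \<Rightarrow> ennreal"
  proof -
    have "(\<integral>\<^sup>+r. g r \<partial>m) = (\<integral>\<^sup>+p. (case p of (s, \<omega>) \<Rightarrow> if 0 \<le> s then 1 else 0) * g (case p of (s, \<omega>) \<Rightarrow> Y \<omega> s) \<partial>(lborel \<Otimes>\<^sub>M M))"
      unfolding m_def by (subst nn_integral_distr, simp, simp, subst nn_integral_density) auto
    also have "\<dots> = (\<integral>\<^sup>+s. \<integral>\<^sup>+\<omega>. (if 0 \<le> s then 1 else 0) * g (Y \<omega> s) \<partial>M \<partial>lborel)"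
      by (subst nn_integral_fst[symmetric]) auto
    finally show ?thesis by (simp add: if_distrib[of "\<lambda>z. z * _"] cong: if_cong)
  qed
  have "m = density lborel (pw \<beta>)"
  proof (rule Laplace_unique)
    show "sets m = sets borel" "sets (density lborel (pw \<beta>)) = sets borel" by (simp_all add: m_def)
    show "AE z in m. 0 \<le> z"
      unfolding m_def using regular_pathD(3)[OF reg]
      by (subst AE_distr_iff, simp, simp, subst AE_density) (auto intro!: AE_I2 simp: space_pair_measure)
    show "AE z in density lborel (pw \<beta>). 0 \<le> z"
      by (subst AE_density) (auto simp: pw_def)
    fix k :: nat assume k: "1 \<le> k"
    show "(\<integral>\<^sup>+z. ennreal (exp (- (real k * z))) \<partial>density lborel (pw \<beta>)) = ennreal (real k powr (- \<beta>))"
      using k \<beta> nn_integral_pw_exp[of \<beta> "real k"] by (subst nn_integral_density) auto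
    have "(\<integral>\<^sup>+z. ennreal (exp (- (real k * z))) \<partial>m) = (\<integral>\<^sup>+s. pw 1 s * ennreal (exp (- (real k powr \<beta> * s))) \<partial>lborel)"
      unfolding nm[of "\<lambda>z. ennreal (exp (- (real k * z)))", simplified]
    proof (rule nn_integral_cong_AE)
      show "AE s in lborel. (\<integral>\<^sup>+\<omega>. (if 0 \<le> s then ennreal (exp (- (real k * Y \<omega> s))) else 0) \<partial>M) = pw 1 s * ennreal (exp (- (real k powr \<beta> * s)))"
        using AE_lborel_singleton[of 0]
        by eventually_elim (use k laplace[of "real k"] in \<open>auto simp: pw_def mult.commute\<close>)
    qed
    also have "\<dots> = ennreal (real k powr (- \<beta>))"
      using k nn_integral_pw_exp[of 1 "real k powr \<beta>"] by (simp add: powr_powr powr_minus)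
    finally show "(\<integral>\<^sup>+z. ennreal (exp (- (real k * z))) \<partial>m) = ennreal (real k powr (- \<beta>))" .
  qed simp
  then show ?thesis using nm[of h] by (simp add: nn_integral_density)
qed

end

section \<open>The renewal expansion of the censored semigroup\<close>

lemma suminf_antidiagonal_ennreal:
  fixes a :: "nat \<Rightarrow> nat \<Rightarrow> ennreal"
  shows "(\<Sum>n. \<Sum>k\<le>n. a k (n - k)) = (\<Sum>k. \<Sum>m. a k m)"
proof -
  have "(\<Sum>n. \<Sum>k\<le>n. a k (n - k)) = (\<Sum>n. \<Sum>k. if k \<le> n then a k (n - k) else 0)"
  proof (rule suminf_cong)
    fix n
    have "(\<Sum>k. if k \<le> n then a k (n - k) else 0) = (\<Sum>k\<in>{..n}. if k \<le> n then a k (n - k) else 0)"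
      by (rule suminf_finite) auto
    then show "(\<Sum>k\<le>n. a k (n - k)) = (\<Sum>k. if k \<le> n then a k (n - k) else 0)" by simp
  qed
  also have "\<dots> = (\<integral>\<^sup>+n. (\<Sum>k. if k \<le> n then a k (n - k) else 0) \<partial>count_space UNIV)"
    by (simp add: nn_integral_count_space_nat)
  also have "\<dots> = (\<Sum>k. \<integral>\<^sup>+n. (if k \<le> n then a k (n - k) else 0) \<partial>count_space UNIV)"
    by (rule nn_integral_suminf) simp
  also have "\<dots> = (\<Sum>k. \<Sum>n. if k \<le> n then a k (n - k) else 0)"
    by (simp add: nn_integral_count_space_nat)
  also have "\<dots> = (\<Sum>k. \<Sum>m. a k m)"
  proof (rule suminf_cong)
    fix k
    have "(\<Sum>n. if k \<le> n then a k (n - k) else 0) = (\<Sum>m. if k \<le> m + k then a k (m + k - k) else 0) + (\<Sum>n<k. if k \<le> n then a k (n - k) else 0)"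
      by (rule suminf_offset) simp
    then show "(\<Sum>n. if k \<le> n then a k (n - k) else 0) = (\<Sum>m. a k m)" by simp
  qed
  finally show ?thesis .
qed

text \<open>Declared locally as \<open>measurable (raw)\<close>, this and the three-argument variant
  let the measurability prover compose curried functions whose joint measurability is known.\<close>

lemma measurable_curried:
  assumes "case_prod h \<in> M1 \<Otimes>\<^sub>M M2 \<rightarrow>\<^sub>M L" "f \<in> K \<rightarrow>\<^sub>M M1" "g \<in> K \<rightarrow>\<^sub>M M2"
  shows "(\<lambda>z. h (f z) (g z)) \<in> K \<rightarrow>\<^sub>M L"
  using measurable_compose[OF measurable_Pair[OF assms(2,3)] assms(1)] by simp

lemma measurable_curried3:
  assumes "(\<lambda>(t, s, x). h t s x) \<in> M1 \<Otimes>\<^sub>M M2 \<Otimes>\<^sub>M M3 \<rightarrow>\<^sub>M L" "f \<in> K \<rightarrow>\<^sub>M M1" "g \<in> K \<rightarrow>\<^sub>M M2" "k \<in> K \<rightarrow>\<^sub>M M3"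
  shows "(\<lambda>z. h (f z) (g z) (k z)) \<in> K \<rightarrow>\<^sub>M L"
  using measurable_compose[OF measurable_Pair[OF assms(2) measurable_Pair[OF assms(3,4)]] assms(1)] by simp

context regular_subordinator
begin

text \<open>\<open>kill_op\<close> is the semigroup of the process killed on leaving $(0,\infty)$, for functions that
  vanish on $(-\infty,0]$. \<open>restart h\<close> is the expectation of \<open>h\<close> at the remaining time and the position
  of the first restart, \<open>dyson f n\<close> the part of the censored semigroup with exactly \<open>n\<close> restarts.\<close>

definition kill_op :: "real \<Rightarrow> (real \<Rightarrow> ennreal) \<Rightarrow> real \<Rightarrow> ennreal" where
  "kill_op t f x = (\<integral>\<^sup>+\<omega>. f (x - Y \<omega> t) \<partial>M)"

definition restart :: "(real \<Rightarrow> real \<Rightarrow> ennreal) \<Rightarrow> real \<Rightarrow> real \<Rightarrow> ennreal" where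
  "restart h t x = (\<integral>\<^sup>+s. \<integral>\<^sup>+\<omega>. (if 0 \<le> s \<and> s \<le> t then pw (1 - \<beta>) (x - Y \<omega> s) * h (t - s) (x - Y \<omega> s) else 0) \<partial>M \<partial>lborel)"

definition dyson :: "(real \<Rightarrow> ennreal) \<Rightarrow> nat \<Rightarrow> real \<Rightarrow> real \<Rightarrow> ennreal" where
  "dyson f n = (restart ^^ n) (\<lambda>t. kill_op t f)"

definition cens :: "(real \<Rightarrow> ennreal) \<Rightarrow> real \<Rightarrow> real \<Rightarrow> ennreal" where
  "cens f t x = (\<Sum>n. dyson f n t x)"

lemma Y_nonneg: "\<omega> \<in> space M \<Longrightarrow> 0 \<le> Y \<omega> t"
  using regular_pathD(3)[OF reg] .

lemma dyson_0: "dyson f 0 t = kill_op t f"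
  and dyson_Suc: "dyson f (Suc n) = restart (dyson f n)"
  by (simp_all add: dyson_def)

lemma measurable_kill_op:
  assumes "case_prod F \<in> borel_measurable (K \<Otimes>\<^sub>M borel)"
  shows "(\<lambda>(z, s, x). kill_op s (F z) x) \<in> borel_measurable (K \<Otimes>\<^sub>M borel \<Otimes>\<^sub>M borel)"
proof -
  note [measurable (raw)] = measurable_curried[OF assms]
  show ?thesis unfolding kill_op_def by measurable
qed

lemma measurable_restart:
  assumes "(\<lambda>(z, s, x). H z s x) \<in> borel_measurable (K \<Otimes>\<^sub>M borel \<Otimes>\<^sub>M borel)"
  shows "(\<lambda>(z, s, x). restart (H z) s x) \<in> borel_measurable (K \<Otimes>\<^sub>M borel \<Otimes>\<^sub>M borel)"
proof -
  note [measurable (raw)] = measurable_curried3[OF assms]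
  show ?thesis unfolding restart_def by measurable
qed

text \<open>The extra parameter z is for terminal functions that depend on a time that is integrated
  later, as in \<open>dyson_nn_integral\<close>.\<close>

lemma measurable_dyson3:
  assumes "case_prod F \<in> borel_measurable (K \<Otimes>\<^sub>M borel)"
  shows "(\<lambda>(z, s, x). dyson (F z) n s x) \<in> borel_measurable (K \<Otimes>\<^sub>M borel \<Otimes>\<^sub>M borel)"
  by (induction n) (simp_all add: dyson_0 dyson_Suc measurable_kill_op[OF assms] measurable_restart)

lemma measurable_restart2:
  assumes "case_prod h \<in> borel_measurable (borel \<Otimes>\<^sub>M borel)"
  shows "case_prod (restart h) \<in> borel_measurable (borel \<Otimes>\<^sub>M borel)"
proof -
  note [measurable (raw)] = measurable_curried[OF assms]
  show ?thesis unfolding restart_def by measurable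
qed

lemma measurable_funpow_restart:
  assumes "case_prod h \<in> borel_measurable (borel \<Otimes>\<^sub>M borel)"
  shows "case_prod ((restart ^^ n) h) \<in> borel_measurable (borel \<Otimes>\<^sub>M borel)"
  by (induction n) (simp_all add: assms measurable_restart2)

lemma measurable_dyson:
  assumes [measurable]: "f \<in> borel_measurable borel"
  shows "case_prod (dyson f n) \<in> borel_measurable (borel \<Otimes>\<^sub>M borel)"
proof -
  have "case_prod (\<lambda>t. kill_op t f) \<in> borel_measurable (borel \<Otimes>\<^sub>M borel)"
    unfolding kill_op_def by measurable
  then show ?thesis unfolding dyson_def by (rule measurable_funpow_restart)
qed

lemma measurable_cens:
  assumes "f \<in> borel_measurable borel"
  shows "case_prod (cens f) \<in> borel_measurable (borel \<Otimes>\<^sub>M borel)"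
proof -
  note [measurable (raw)] = measurable_curried[OF measurable_dyson[OF assms]]
  show ?thesis unfolding cens_def by measurable
qed

lemma measurable_dyson_time: "f \<in> borel_measurable borel \<Longrightarrow> dyson f n t \<in> borel_measurable borel"
  using measurable_Pair2[OF measurable_dyson, of f t n] by simp

lemma kill_op_nonpos: "(\<And>y. y \<le> 0 \<Longrightarrow> f y = 0) \<Longrightarrow> x \<le> 0 \<Longrightarrow> kill_op t f x = 0"
proof -
  assume f: "\<And>y. y \<le> 0 \<Longrightarrow> f y = 0" and x: "x \<le> 0"
  have "x - Y \<omega> t \<le> 0" if "\<omega> \<in> space M" for \<omega> using x Y_nonneg[OF that, of t] by linarith
  then have "kill_op t f x = (\<integral>\<^sup>+\<omega>. 0 \<partial>M)" unfolding kill_op_def by (intro nn_integral_cong f)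
  then show ?thesis by simp
qed

lemma restart_nonpos: "x \<le> 0 \<Longrightarrow> restart h t x = 0"
proof -
  assume x: "x \<le> 0"
  have "pw (1 - \<beta>) (x - Y \<omega> s) = 0" if "\<omega> \<in> space M" for \<omega> s
    using x Y_nonneg[OF that, of s] by (intro pw_nonpos) linarith
  then have "restart h t x = (\<integral>\<^sup>+(s::real). \<integral>\<^sup>+\<omega>. 0 \<partial>M \<partial>lborel)" unfolding restart_def
    by (intro nn_integral_cong) simp
  then show ?thesis by simp
qed

lemma dyson_nonpos: "(\<And>y. y \<le> 0 \<Longrightarrow> f y = 0) \<Longrightarrow> x \<le> 0 \<Longrightarrow> dyson f n t x = 0"
  by (cases n) (simp_all add: dyson_0 dyson_Suc kill_op_nonpos restart_nonpos)

lemma cens_nonpos: "(\<And>y. y \<le> 0 \<Longrightarrow> f y = 0) \<Longrightarrow> x \<le> 0 \<Longrightarrow> cens f t x = 0"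
  by (simp add: cens_def dyson_nonpos)

lemma restart_mono:
  assumes "\<And>r y. 0 \<le> r \<Longrightarrow> r \<le> t \<Longrightarrow> 0 < y \<Longrightarrow> y \<le> x \<Longrightarrow> h r y \<le> h' r y"
  shows "restart h t x \<le> restart h' t x"
  unfolding restart_def
proof (intro nn_integral_mono)
  fix s \<omega> assume "\<omega> \<in> space M"
  then have "0 \<le> Y \<omega> s" by (rule Y_nonneg)
  then show "(if 0 \<le> s \<and> s \<le> t then pw (1 - \<beta>) (x - Y \<omega> s) * h (t - s) (x - Y \<omega> s) else 0)
    \<le> (if 0 \<le> s \<and> s \<le> t then pw (1 - \<beta>) (x - Y \<omega> s) * h' (t - s) (x - Y \<omega> s) else 0)"
    using assms[of "t - s" "x - Y \<omega> s"] by (cases "0 < x - Y \<omega> s") (auto intro!: mult_left_mono)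
qed

lemma restart_cong:
  assumes "\<And>r y. 0 \<le> r \<Longrightarrow> r \<le> t \<Longrightarrow> 0 < y \<Longrightarrow> y \<le> x \<Longrightarrow> h r y = h' r y"
  shows "restart h t x = restart h' t x"
  using restart_mono[of t x h h'] restart_mono[of t x h' h] assms by (simp add: antisym)

text \<open>The process never moves up, so values of f above the starting point are not seen. This
  is what allows functions on [0, T] to be continued beyond T at will.\<close>

lemma dyson_cong:
  assumes "\<And>y. y \<le> x \<Longrightarrow> f y = g y"
  shows "dyson f n t x = dyson g n t x"
  using assms
proof (induction n arbitrary: t x)
  case 0
  then show ?case unfolding dyson_0 kill_op_def by (intro nn_integral_cong) (use Y_nonneg in force)
next
  case (Suc n)
  then show ?case unfolding dyson_Suc by (intro restart_cong) auto
qed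

lemma cens_cong: "(\<And>y. y \<le> x \<Longrightarrow> f y = g y) \<Longrightarrow> cens f t x = cens g t x"
  unfolding cens_def by (simp cong: dyson_cong)

lemma restart_suminf:
  assumes "\<And>i. case_prod (h i) \<in> borel_measurable (borel \<Otimes>\<^sub>M borel)"
  shows "restart (\<lambda>r y. \<Sum>i. h i r y) t x = (\<Sum>i. restart (h i) t x)"
proof -
  note [measurable (raw)] = measurable_curried[OF assms]
  have "restart (\<lambda>r y. \<Sum>i. h i r y) t x
     = (\<integral>\<^sup>+s. \<integral>\<^sup>+\<omega>. (\<Sum>i. if 0 \<le> s \<and> s \<le> t then pw (1 - \<beta>) (x - Y \<omega> s) * h i (t - s) (x - Y \<omega> s) else 0) \<partial>M \<partial>lborel)"
    unfolding restart_def by (intro nn_integral_cong) auto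
  also have "\<dots> = (\<integral>\<^sup>+s. (\<Sum>i. \<integral>\<^sup>+\<omega>. (if 0 \<le> s \<and> s \<le> t then pw (1 - \<beta>) (x - Y \<omega> s) * h i (t - s) (x - Y \<omega> s) else 0) \<partial>M) \<partial>lborel)"
    by (intro nn_integral_cong nn_integral_suminf) measurable
  also have "\<dots> = (\<Sum>i. restart (h i) t x)"
    unfolding restart_def by (intro nn_integral_suminf) measurable
  finally show ?thesis .
qed

lemma restart_sum:
  assumes fin: "finite I" and "\<And>i. i \<in> I \<Longrightarrow> case_prod (h i) \<in> borel_measurable (borel \<Otimes>\<^sub>M borel)"
  shows "restart (\<lambda>r y. \<Sum>i\<in>I. h i r y) t x = (\<Sum>i\<in>I. restart (h i) t x)"
proof -
  note [measurable (raw)] = measurable_curried[OF assms(2)]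
  have "restart (\<lambda>r y. \<Sum>i\<in>I. h i r y) t x
     = (\<integral>\<^sup>+s. \<integral>\<^sup>+\<omega>. (\<Sum>i\<in>I. if 0 \<le> s \<and> s \<le> t then pw (1 - \<beta>) (x - Y \<omega> s) * h i (t - s) (x - Y \<omega> s) else 0) \<partial>M \<partial>lborel)"
    unfolding restart_def by (intro nn_integral_cong) (auto simp: sum_distrib_left)
  also have "\<dots> = (\<integral>\<^sup>+s. (\<Sum>i\<in>I. \<integral>\<^sup>+\<omega>. (if 0 \<le> s \<and> s \<le> t then pw (1 - \<beta>) (x - Y \<omega> s) * h i (t - s) (x - Y \<omega> s) else 0) \<partial>M) \<partial>lborel)"
    by (intro nn_integral_cong nn_integral_sum) measurable
  also have "\<dots> = (\<Sum>i\<in>I. restart (h i) t x)"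
    unfolding restart_def by (intro nn_integral_sum) measurable
  finally show ?thesis .
qed

lemma funpow_restart_suminf:
  assumes "\<And>i. case_prod (h i) \<in> borel_measurable (borel \<Otimes>\<^sub>M borel)"
  shows "(restart ^^ n) (\<lambda>r y. \<Sum>i. h i r y) = (\<lambda>t x. \<Sum>i. (restart ^^ n) (h i) t x)"
proof (induction n)
  case (Suc n)
  then show ?case by (simp add: restart_suminf[OF measurable_funpow_restart[OF assms]])
qed simp

lemma dyson_suminf:
  assumes "\<And>i. g i \<in> borel_measurable borel"
  shows "dyson (\<lambda>y. \<Sum>i. g i y) n s x = (\<Sum>i. dyson (g i) n s x)"
proof -
  note [measurable] = assms
  have "(\<lambda>t. kill_op t (\<lambda>y. \<Sum>i. g i y)) = (\<lambda>t y. \<Sum>i. kill_op t (g i) y)"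
    unfolding kill_op_def fun_eq_iff by (intro allI nn_integral_suminf) measurable
  moreover have "case_prod (\<lambda>t. kill_op t (g i)) \<in> borel_measurable (borel \<Otimes>\<^sub>M borel)" for i
    unfolding kill_op_def by measurable
  ultimately show ?thesis unfolding dyson_def by (simp add: funpow_restart_suminf)
qed

section \<open>The semigroup property\<close>

lemma kill_op_add:
  assumes [measurable]: "f \<in> borel_measurable borel" and "0 \<le> s" "0 \<le> t"
  shows "kill_op (s + t) f x = kill_op s (kill_op t f) x"
proof -
  have "kill_op (s + t) f x = (\<integral>\<^sup>+\<omega>. (\<lambda>(u, v). f (x - u - v)) (Y \<omega> s, Y \<omega> (s + t) - Y \<omega> s) \<partial>M)"
    unfolding kill_op_def by (intro nn_integral_cong) simp
  also have "\<dots> = (\<integral>\<^sup>+\<omega>. \<integral>\<^sup>+\<omega>'. (\<lambda>(u, v). f (x - u - v)) (Y \<omega> s, Y \<omega>' (s + t - s)) \<partial>M \<partial>M)"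
    using assms by (intro increments) auto
  finally show ?thesis by (simp add: kill_op_def)
qed

text \<open>The time of the first restart is split at s. If it comes before s, the remaining horizon
  grows by t; if it comes later, the process survives up to s and starts afresh from there by
  \<open>kill_op_add\<close>.\<close>

lemma restart_add:
  assumes h: "case_prod h \<in> borel_measurable (borel \<Otimes>\<^sub>M borel)" and s: "0 \<le> s" and t: "0 \<le> t"
  shows "restart h (s + t) x = restart (\<lambda>r. h (r + t)) s x + kill_op s (restart h t) x"
proof -
  note [measurable (raw)] = measurable_curried[OF h]
  define G where "G = (\<lambda>T r. kill_op r (\<lambda>y. pw (1 - \<beta>) y * h (T - r) y) x)"
  have [measurable]: "G T \<in> borel_measurable borel" for T unfolding G_def kill_op_def by measurable
  have R: "restart h T x = (\<integral>\<^sup>+r. (if 0 \<le> r \<and> r \<le> T then G T r else 0) \<partial>lborel)" for T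
    unfolding restart_def G_def kill_op_def by (intro nn_integral_cong) auto
  have "restart h (s + t) x = (\<integral>\<^sup>+r. (if 0 \<le> r \<and> r \<le> s then G (s + t) r else 0) + (if s < r \<and> r \<le> s + t then G (s + t) r else 0) \<partial>lborel)"
    unfolding R using s t by (intro nn_integral_cong) auto
  also have "\<dots> = (\<integral>\<^sup>+r. (if 0 \<le> r \<and> r \<le> s then G (s + t) r else 0) \<partial>lborel) + (\<integral>\<^sup>+r. (if s < r \<and> r \<le> s + t then G (s + t) r else 0) \<partial>lborel)"
    by (rule nn_integral_add) measurable
  also have "(\<integral>\<^sup>+r. (if 0 \<le> r \<and> r \<le> s then G (s + t) r else 0) \<partial>lborel) = restart (\<lambda>r. h (r + t)) s x"
    unfolding restart_def G_def kill_op_def by (intro nn_integral_cong) (auto simp: algebra_simps)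
  also have "(\<integral>\<^sup>+r. (if s < r \<and> r \<le> s + t then G (s + t) r else 0) \<partial>lborel)
     = (\<integral>\<^sup>+r. (if s < s + 1 * r \<and> s + 1 * r \<le> s + t then G (s + t) (s + 1 * r) else 0) \<partial>lborel)"
    by (subst nn_integral_real_affine[where t = s and c = 1]) auto
  also have "\<dots> = (\<integral>\<^sup>+r. \<integral>\<^sup>+\<omega>. (if 0 \<le> r \<and> r \<le> t then kill_op r (\<lambda>y. pw (1 - \<beta>) y * h (t - r) y) (x - Y \<omega> s) else 0) \<partial>M \<partial>lborel)"
  proof (rule nn_integral_cong_AE)
    show "AE r in lborel. (if s < s + 1 * r \<and> s + 1 * r \<le> s + t then G (s + t) (s + 1 * r) else 0)
      = (\<integral>\<^sup>+\<omega>. (if 0 \<le> r \<and> r \<le> t then kill_op r (\<lambda>y. pw (1 - \<beta>) y * h (t - r) y) (x - Y \<omega> s) else 0) \<partial>M)"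
      using AE_lborel_singleton[of 0]
    proof eventually_elim
      case (elim r)
      show ?case
      proof (cases "0 \<le> r \<and> r \<le> t")
        case True
        then have "G (s + t) (s + 1 * r) = kill_op s (kill_op r (\<lambda>y. pw (1 - \<beta>) y * h (t - r) y)) x"
          unfolding G_def using s by (subst kill_op_add[symmetric]) auto
        then show ?thesis using True elim by (simp add: kill_op_def[of s])
      qed auto
    qed
  qed
  also have "\<dots> = (\<integral>\<^sup>+\<omega>. \<integral>\<^sup>+r. (if 0 \<le> r \<and> r \<le> t then kill_op r (\<lambda>y. pw (1 - \<beta>) y * h (t - r) y) (x - Y \<omega> s) else 0) \<partial>lborel \<partial>M)"
    by (rule M_lborel.Fubini') (unfold kill_op_def, measurable)
  also have "\<dots> = kill_op s (restart h t) x"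
    unfolding kill_op_def[of s] restart_def by (intro nn_integral_cong) (auto simp: kill_op_def)
  finally show ?thesis .
qed

text \<open>Of n restarts during s + t, some k fall into the first period and n - k into the second.
  Summing over n turns the right-hand side into a Cauchy product, which is
  \<open>cens_add\<close>.\<close>

lemma dyson_add:
  assumes f: "f \<in> borel_measurable borel" and "0 \<le> s" "0 \<le> t"
  shows "dyson f n (s + t) x = (\<Sum>k\<le>n. dyson (dyson f (n - k) t) k s x)"
  using \<open>0 \<le> s\<close>
proof (induction n arbitrary: s x)
  case 0
  then show ?case using assms by (simp add: dyson_0 kill_op_add)
next
  case (Suc n)
  note m = measurable_dyson_time[OF f]
  have "dyson f (Suc n) (s + t) x = restart (\<lambda>r. dyson f n (r + t)) s x + kill_op s (dyson f (Suc n) t) x"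
    unfolding dyson_Suc using Suc.prems assms by (intro restart_add measurable_dyson)
  also have "restart (\<lambda>r. dyson f n (r + t)) s x = restart (\<lambda>r y. \<Sum>k\<le>n. dyson (dyson f (n - k) t) k r y) s x"
    by (intro restart_cong Suc.IH)
  also have "\<dots> = (\<Sum>k\<le>n. dyson (dyson f (n - k) t) (Suc k) s x)"
    unfolding dyson_Suc by (intro restart_sum measurable_dyson m) auto
  finally show ?case by (simp add: sum.atMost_Suc_shift dyson_0 add.commute del: sum.atMost_Suc)
qed

lemma cens_add:
  assumes f: "f \<in> borel_measurable borel" and "0 \<le> s" "0 \<le> t"
  shows "cens (cens f t) s x = cens f (s + t) x"
proof -
  note m = measurable_dyson_time[OF f]
  have "cens (cens f t) s x = (\<Sum>k. \<Sum>m. dyson (dyson f m t) k s x)"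
    unfolding cens_def by (simp add: dyson_suminf[OF m])
  also have "\<dots> = (\<Sum>n. \<Sum>k\<le>n. dyson (dyson f (n - k) t) k s x)"
    by (rule suminf_antidiagonal_ennreal[symmetric])
  also have "\<dots> = cens f (s + t) x"
    unfolding cens_def by (simp add: dyson_add[OF assms])
  finally show ?thesis .
qed

text \<open>The remainder of the expansion is exact: it is \<open>cens f\<close> itself under n
  restarts. Any bound on \<open>cens f\<close> that contracts under \<open>restart\<close> therefore
  controls the speed of convergence.\<close>

lemma cens_restart:
  assumes f: "f \<in> borel_measurable borel"
  shows "cens f t x = (\<Sum>m<n. dyson f m t x) + (restart ^^ n) (cens f) t x"
proof -
  have "(restart ^^ n) (cens f) = (\<lambda>t x. \<Sum>m. (restart ^^ n) (dyson f m) t x)"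
    unfolding cens_def[abs_def] by (rule funpow_restart_suminf[OF measurable_dyson[OF f]])
  moreover have "(restart ^^ n) (dyson f m) = dyson f (m + n)" for m
    unfolding dyson_def by (subst add.commute, subst funpow_add) simp
  ultimately show ?thesis unfolding cens_def by (subst suminf_offset[of _ n]) (simp_all add: add.commute)
qed

lemma cens_eq_kill_op_restart:
  "f \<in> borel_measurable borel \<Longrightarrow> cens f t x = kill_op t f x + restart (cens f) t x"
  using cens_restart[of f t x 1] by (simp add: dyson_0)

text \<open>The bridge between the two descriptions of a restart: the density form suits potential
  theory, the path form suits pathwise bounds and the strong Markov step.\<close>

lemma restart_eq_passage:
  assumes x: "0 < x" and "case_prod h \<in> borel_measurable (borel \<Otimes>\<^sub>M borel)"
  shows "restart h t x = (\<integral>\<^sup>+\<omega>. (if undershoot (Y \<omega>) x < x \<and> passage (Y \<omega>) x \<le> t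
    then h (t - passage (Y \<omega>) x) (x - undershoot (Y \<omega>) x) else 0) \<partial>M)"
proof -
  note [measurable (raw)] = measurable_curried[OF assms(2)]
  have "restart h t x = (\<integral>\<^sup>+s. \<integral>\<^sup>+\<omega>. (if 0 \<le> s then pw (1 - \<beta>) (x - Y \<omega> s) * (\<lambda>(s, y). if s \<le> t then h (t - s) y else 0) (s, x - Y \<omega> s) else 0) \<partial>M \<partial>lborel)"
    unfolding restart_def by (intro nn_integral_cong) auto
  also have "\<dots> = (\<integral>\<^sup>+\<omega>. (if undershoot (Y \<omega>) x < x then (\<lambda>(s, y). if s \<le> t then h (t - s) y else 0) (passage (Y \<omega>) x, x - undershoot (Y \<omega>) x) else 0) \<partial>M)"
    by (rule passage_law[OF x, symmetric]) measurable
  also have "\<dots> = (\<integral>\<^sup>+\<omega>. (if undershoot (Y \<omega>) x < x \<and> passage (Y \<omega>) x \<le> t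
    then h (t - passage (Y \<omega>) x) (x - undershoot (Y \<omega>) x) else 0) \<partial>M)"
    by (intro nn_integral_cong) auto
  finally show ?thesis .
qed

text \<open>At time \<open>t\<close> the process has either survived or restarted, and both positions lie below \<open>x\<close>.\<close>

lemma kill_op_restart_le:
  assumes x: "0 < x" and w: "\<And>y z. 0 < y \<Longrightarrow> y \<le> z \<Longrightarrow> w y \<le> w z" and [measurable]: "w \<in> borel_measurable borel"
  shows "kill_op t (\<lambda>y. if 0 < y then w y else 0) x + restart (\<lambda>_. w) t x \<le> w x"
proof -
  have "kill_op t (\<lambda>y. if 0 < y then w y else 0) x + restart (\<lambda>_. w) t x
     = (\<integral>\<^sup>+\<omega>. (if 0 < x - Y \<omega> t then w (x - Y \<omega> t) else 0) + (if undershoot (Y \<omega>) x < x \<and> passage (Y \<omega>) x \<le> t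
    then w (x - undershoot (Y \<omega>) x) else 0) \<partial>M)"
    by (subst restart_eq_passage[OF x]) (auto simp: kill_op_def intro!: nn_integral_add[symmetric])
  also have "\<dots> \<le> (\<integral>\<^sup>+\<omega>. w x \<partial>M)"
  proof (rule nn_integral_mono)
    fix \<omega> assume \<omega>: "\<omega> \<in> space M"
    show "(if 0 < x - Y \<omega> t then w (x - Y \<omega> t) else 0) + (if undershoot (Y \<omega>) x < x \<and> passage (Y \<omega>) x \<le> t
      then w (x - undershoot (Y \<omega>) x) else 0) \<le> w x"
      using w[of "x - Y \<omega> t" x] w[of "x - undershoot (Y \<omega>) x" x] Y_nonneg[OF \<omega>, of t]
        undershoot_nonneg[OF reg[OF \<omega>] x] passage_le_iff[OF reg[OF \<omega>] x, of t]
      by (cases "Y \<omega> t < x") auto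
  qed
  also have "\<dots> = w x" by (simp add: emeasure_space_1)
  finally show ?thesis .
qed

text \<open>Increasing functions can only decrease in expectation, as the process moves down.
  Induction over the number of restarts bounds the partial sums; constant w gives contractivity,
  affine w the decay near 0.\<close>

lemma cens_le:
  assumes x: "0 < x" and t: "0 \<le> t" and f: "f \<in> borel_measurable borel"
    and w: "\<And>y z. 0 < y \<Longrightarrow> y \<le> z \<Longrightarrow> w y \<le> w z" "w \<in> borel_measurable borel"
    and fw: "\<And>y. f y \<le> (if 0 < y then w y else 0)"
  shows "cens f t x \<le> w x"
proof -
  have "(\<Sum>m<n. dyson f m t x) \<le> w x" for n
    using x t
  proof (induction n arbitrary: t x)
    case (Suc n)
    have "(\<Sum>m<Suc n. dyson f m t x) = kill_op t f x + restart (\<lambda>r y. \<Sum>m<n. dyson f m r y) t x"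
      by (simp add: sum.lessThan_Suc_shift dyson_0 dyson_Suc restart_sum[OF _ measurable_dyson[OF f]] del: sum.lessThan_Suc)
    also have "\<dots> \<le> kill_op t (\<lambda>y. if 0 < y then w y else 0) x + restart (\<lambda>_. w) t x"
      unfolding kill_op_def by (intro add_mono nn_integral_mono fw restart_mono Suc.IH) auto
    also have "\<dots> \<le> w x" using Suc.prems w by (intro kill_op_restart_le)
    finally show ?case .
  qed simp
  then show ?thesis unfolding cens_def suminf_eq_SUP by (intro SUP_least)
qed

end

section \<open>Continuity, and the potential of the censored process\<close>

text \<open>Functions on the whole line that vanish on (-\<infinity>, 0], so that a path that has
  crossed 0 contributes nothing and killing needs no separate bookkeeping.\<close>

definition test_fun :: "(real \<Rightarrow> real) \<Rightarrow> bool" where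
  "test_fun f \<longleftrightarrow> uniformly_continuous_on UNIV f \<and> (\<forall>y. 0 \<le> f y) \<and> (\<forall>y\<le>0. f y = 0) \<and> (\<exists>B. \<forall>y. f y \<le> B)"

lemma test_funD:
  assumes "test_fun f"
  shows "uniformly_continuous_on UNIV f" "continuous_on UNIV f" "0 \<le> f y" "y \<le> 0 \<Longrightarrow> f y = 0"
    "\<exists>B\<ge>0. \<forall>y. f y \<le> B" "f \<in> borel_measurable borel" "(\<lambda>y. ennreal (f y)) \<in> borel_measurable borel"
proof -
  show u: "uniformly_continuous_on UNIV f" using assms unfolding test_fun_def by blast
  have n: "0 \<le> f y" for y using assms unfolding test_fun_def by blast
  then show "0 \<le> f y" .
  show "y \<le> 0 \<Longrightarrow> f y = 0" using assms unfolding test_fun_def by blast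
  show c: "continuous_on UNIV f" using uniformly_continuous_imp_continuous[OF u] .
  show "f \<in> borel_measurable borel" "(\<lambda>y. ennreal (f y)) \<in> borel_measurable borel"
    using borel_measurable_continuous_onI[OF c] by measurable
  obtain B where "\<And>y. f y \<le> B" using assms unfolding test_fun_def by blast
  then show "\<exists>B\<ge>0. \<forall>y. f y \<le> B" using n[of 0] order_trans by blast
qed

text \<open>Vanishing at 0 in quantitative form: near 0 the function is below e by continuity, and
  beyond distance d the slope B / d dominates the bound B.\<close>

lemma test_fun_affine_bound:
  assumes f: "test_fun f" and e: "0 < e"
  obtains C where "0 \<le> C" "\<And>y. 0 < y \<Longrightarrow> f y \<le> e + C * y"
proof -
  obtain B where B: "0 \<le> B" "\<And>y. f y \<le> B" using test_funD(5)[OF f] by blast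
  obtain d where d: "0 < d" "\<And>y. dist y 0 < d \<Longrightarrow> dist (f y) (f 0) < e"
    using test_funD(2)[OF f] e unfolding continuous_on_iff by blast
  have "f y \<le> e + B / d * y" if "0 < y" for y
  proof (cases "y < d")
    case True
    then have "f y < e" using d(2)[of y] that test_funD(4)[OF f, of 0] by (simp add: dist_real_def)
    moreover have "0 \<le> B / d * y" using B d that by simp
    ultimately show ?thesis by linarith
  next
    case False
    then have "B * 1 \<le> B * (y / d)" using B d by (intro mult_left_mono) (auto simp: field_simps)
    then show ?thesis using B(2)[of y] e by (simp add: mult.commute)
  qed
  then show ?thesis using that[of "B / d"] B d by simp
qed

context regular_subordinator
begin

section \<open>Affine bounds and their contraction under restarts\<close>

lemma potential_conv:
  assumes [measurable]: "g \<in> borel_measurable borel"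
  shows "(\<integral>\<^sup>+s. \<integral>\<^sup>+\<omega>. (if 0 \<le> s then g (x - Y \<omega> s) else 0) \<partial>M \<partial>lborel) = (\<integral>\<^sup>+r. pw \<beta> (x - r) * g r \<partial>lborel)"
proof -
  have "(\<integral>\<^sup>+s. \<integral>\<^sup>+\<omega>. (if 0 \<le> s then g (x - Y \<omega> s) else 0) \<partial>M \<partial>lborel) = (\<integral>\<^sup>+r. pw \<beta> r * g (x - r) \<partial>lborel)"
    using potential[of "\<lambda>r. g (x - r)"] by simp
  also have "\<dots> = (\<integral>\<^sup>+r. pw \<beta> (x - r) * g r \<partial>lborel)"
    by (subst nn_integral_real_affine[where t = x and c = "- 1"]) auto
  finally show ?thesis .
qed

text \<open>The kernel of \<open>K_op\<close> fixes constants and multiplies the function x by 1 -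
  \<beta>. The factor arises because r \<open>pw (1 - \<beta>) r\<close> is (1 - \<beta>)
  \<open>pw (2 - \<beta>) r\<close>, by the recursion of the Gamma function.\<close>

lemma pw_conv_affine:
  assumes "0 < x" "0 \<le> e" "0 \<le> C"
  shows "(\<integral>\<^sup>+r. pw \<beta> (x - r) * (pw (1 - \<beta>) r * ennreal (e + C * r)) \<partial>lborel) = ennreal (e + C * (1 - \<beta>) * x)"
proof -
  have G: "Gamma (2 - \<beta>) = (1 - \<beta>) * Gamma (1 - \<beta>)"
  proof -
    have "1 - \<beta> \<notin> \<int>\<^sub>\<le>\<^sub>0" using \<beta> by (auto elim!: nonpos_Ints_cases)
    from Gamma_plus1[OF this] show ?thesis by simp
  qed
  have "pw (1 - \<beta>) r * ennreal (e + C * r) = ennreal e * pw (1 - \<beta>) r + ennreal (C * (1 - \<beta>)) * pw (2 - \<beta>) r" for r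
  proof (cases "0 < r")
    case True
    have "r powr (1 - \<beta>) = r * r powr (- \<beta>)"
      using True powr_add[of r 1 "- \<beta>"] by simp
    then have "r powr (1 - \<beta> - 1) / Gamma (1 - \<beta>) * (e + C * r)
        = e * (r powr (1 - \<beta> - 1) / Gamma (1 - \<beta>)) + C * (1 - \<beta>) * (r powr (2 - \<beta> - 1) / Gamma (2 - \<beta>))"
    proof -
      have "C * (1 - \<beta>) * (q / ((1 - \<beta>) * Gamma (1 - \<beta>))) = C * q / Gamma (1 - \<beta>)" for q
        using \<beta> by simp
      then show ?thesis using \<open>r powr (1 - \<beta>) = r * r powr (- \<beta>)\<close> unfolding G
        by (simp add: mult_ac del: times_divide_eq_right) (simp add: algebra_simps add_divide_distrib)
    qed
    then show ?thesis using True assms \<beta> Gamma_beta_pos Gamma_real_pos[of "2 - \<beta>"]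
      by (simp add: pw_def ennreal_mult[symmetric] ennreal_plus[symmetric] del: ennreal_plus)
  qed simp
  then have "(\<integral>\<^sup>+r. pw \<beta> (x - r) * (pw (1 - \<beta>) r * ennreal (e + C * r)) \<partial>lborel)
     = (\<integral>\<^sup>+r. ennreal e * (pw \<beta> (x - r) * pw (1 - \<beta>) r) + ennreal (C * (1 - \<beta>)) * (pw \<beta> (x - r) * pw (2 - \<beta>) r) \<partial>lborel)"
    by (intro nn_integral_cong) (simp add: distrib_left mult_ac)
  also have "\<dots> = ennreal e * pw 1 x + ennreal (C * (1 - \<beta>)) * pw 2 x"
    using \<beta> by (simp add: nn_integral_add nn_integral_cmult nn_integral_pw_conv)
  also have "\<dots> = ennreal (e + C * (1 - \<beta>) * x)"
    using assms \<beta> Gamma_fact[of 1, where 'a = real] by (simp add: pw_def ennreal_mult[symmetric] ennreal_plus[symmetric] del: ennreal_plus)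
  finally show ?thesis .
qed

text \<open>Dropping the horizon s \<le> t turns the time integral into a potential, so that one
  restart costs at most one application of the kernel of \<open>K_op\<close>, uniformly in
  t.\<close>

lemma restart_affine:
  assumes x: "0 < x" and C: "0 \<le> e" "0 \<le> C"
    and h: "\<And>r y. 0 \<le> r \<Longrightarrow> 0 < y \<Longrightarrow> h r y \<le> ennreal (e + C * y)"
  shows "restart h t x \<le> ennreal (e + C * (1 - \<beta>) * x)"
proof -
  have "restart h t x \<le> (\<integral>\<^sup>+s. \<integral>\<^sup>+\<omega>. (if 0 \<le> s then pw (1 - \<beta>) (x - Y \<omega> s) * ennreal (e + C * (x - Y \<omega> s)) else 0) \<partial>M \<partial>lborel)"
    unfolding restart_def
  proof (intro nn_integral_mono)
    fix s \<omega>
    show "(if 0 \<le> s \<and> s \<le> t then pw (1 - \<beta>) (x - Y \<omega> s) * h (t - s) (x - Y \<omega> s) else 0)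
       \<le> (if 0 \<le> s then pw (1 - \<beta>) (x - Y \<omega> s) * ennreal (e + C * (x - Y \<omega> s)) else 0)"
      using h[of "t - s" "x - Y \<omega> s"] by (cases "0 < x - Y \<omega> s") (auto intro!: mult_left_mono)
  qed
  also have "\<dots> = (\<integral>\<^sup>+r. pw \<beta> (x - r) * (pw (1 - \<beta>) r * ennreal (e + C * r)) \<partial>lborel)"
    using potential_conv[of "\<lambda>y. pw (1 - \<beta>) y * ennreal (e + C * y)" x] by simp
  finally show ?thesis using pw_conv_affine[OF x C] by simp
qed

lemma funpow_restart_affine:
  assumes x: "0 < x" and C: "0 \<le> e" "0 \<le> C" and t: "0 \<le> t"
    and h: "\<And>r y. 0 \<le> r \<Longrightarrow> 0 < y \<Longrightarrow> h r y \<le> ennreal (e + C * y)"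
  shows "(restart ^^ n) h t x \<le> ennreal (e + C * (1 - \<beta>) ^ n * x)"
  using x t
proof (induction n arbitrary: t x)
  case 0
  then show ?case using h by simp
next
  case (Suc n)
  have "restart ((restart ^^ n) h) t x \<le> ennreal (e + C * (1 - \<beta>) ^ n * (1 - \<beta>) * x)"
    using Suc C \<beta> by (intro restart_affine) auto
  then show ?case by (simp add: mult_ac)
qed

text \<open>An invariant of \<open>restart\<close> strong enough to carry continuity through every
  term of the expansion. The affine bound, uniform in time and with e as small as desired, is what
  tames the singular factor y^(- \<beta>).\<close>

definition tame :: "(real \<Rightarrow> real \<Rightarrow> ennreal) \<Rightarrow> bool" where
  "tame h \<longleftrightarrow> case_prod h \<in> borel_measurable (borel \<Otimes>\<^sub>M borel) \<and> (\<forall>t\<ge>0. \<forall>y\<le>0. h t y = 0) \<and>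
     (\<forall>t\<ge>0. continuous_on UNIV (\<lambda>y. enn2real (h t y))) \<and>
     (\<forall>e>0. \<exists>C\<ge>0. \<forall>t\<ge>0. \<forall>y>0. h t y \<le> ennreal (e + C * y))"

lemma tameD:
  assumes "tame h"
  shows "case_prod h \<in> borel_measurable (borel \<Otimes>\<^sub>M borel)"
    and "0 \<le> t \<Longrightarrow> y \<le> 0 \<Longrightarrow> h t y = 0"
    and "0 \<le> t \<Longrightarrow> continuous_on UNIV (\<lambda>y. enn2real (h t y))"
    and "0 < e \<Longrightarrow> \<exists>C\<ge>0. \<forall>t\<ge>0. \<forall>y>0. h t y \<le> ennreal (e + C * y)"
  using assms unfolding tame_def by simp_all

lemma tame_finite:
  assumes h: "tame h" and t: "0 \<le> t"
  shows "h t y < \<top>"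
proof (cases "0 < y")
  case True
  obtain C where "\<forall>t\<ge>0. \<forall>y>0. h t y \<le> ennreal (1 + C * y)"
    using tameD(4)[OF h zero_less_one] by blast
  then have "h t y \<le> ennreal (1 + C * y)" using t True by simp
  then show ?thesis by (rule le_less_trans) simp
qed (use tameD(2)[OF h t] in simp)

lemma tame_kill_op:
  assumes f: "test_fun f"
  shows "tame (\<lambda>t. kill_op t (\<lambda>y. ennreal (f y)))"
  unfolding tame_def
proof (intro conjI allI impI)
  note [measurable] = test_funD(6)[OF f]
  show "case_prod (\<lambda>t. kill_op t (\<lambda>y. ennreal (f y))) \<in> borel_measurable (borel \<Otimes>\<^sub>M borel)"
    unfolding kill_op_def by measurable
  show "kill_op t (\<lambda>y. ennreal (f y)) y = 0" if "y \<le> 0" for t y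
    using that test_funD(4)[OF f] by (intro kill_op_nonpos) auto
  obtain B where B: "\<And>y. f y \<le> B" using test_funD(5)[OF f] by blast
  show "continuous_on UNIV (\<lambda>y. enn2real (kill_op t (\<lambda>y. ennreal (f y)) y))" for t
  proof -
    have eq: "enn2real (kill_op t (\<lambda>y. ennreal (f y)) x) = (LINT \<omega>|M. f (x - Y \<omega> t))" for x
      unfolding kill_op_def using test_funD(3)[OF f] by (subst integral_eq_nn_integral) auto
    show ?thesis unfolding eq continuous_on_sequentially
    proof (intro allI impI ballI)
      fix X :: "nat \<Rightarrow> real" and x assume "(\<forall>n. X n \<in> UNIV) \<and> X \<longlonglongrightarrow> x"
      then have X: "X \<longlonglongrightarrow> x" by simp
      have "(\<lambda>i. LINT \<omega>|M. f (X i - Y \<omega> t)) \<longlonglongrightarrow> (LINT \<omega>|M. f (x - Y \<omega> t))"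
      proof (rule integral_dominated_convergence[where w = "\<lambda>_. B"])
        show "AE \<omega> in M. (\<lambda>i. f (X i - Y \<omega> t)) \<longlonglongrightarrow> f (x - Y \<omega> t)"
          using X by (intro AE_I2 continuous_on_tendsto_compose[OF test_funD(2)[OF f]] tendsto_diff tendsto_const) auto
      qed (use B test_funD(3)[OF f] in auto)
      then show "((\<lambda>x. LINT \<omega>|M. f (x - Y \<omega> t)) \<circ> X) \<longlonglongrightarrow> (LINT \<omega>|M. f (x - Y \<omega> t))" by (simp add: o_def)
    qed
  qed
  fix e :: real assume "0 < e"
  then obtain C where C: "0 \<le> C" "\<And>y. 0 < y \<Longrightarrow> f y \<le> e + C * y" using test_fun_affine_bound[OF f] by blast
  have "kill_op t (\<lambda>y. ennreal (f y)) x \<le> ennreal (e + C * x)" if "0 < x" for t x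
  proof -
    have "kill_op t (\<lambda>y. ennreal (f y)) x \<le> (\<integral>\<^sup>+\<omega>. ennreal (e + C * x) \<partial>M)"
      unfolding kill_op_def
    proof (intro nn_integral_mono ennreal_leI)
      fix \<omega> assume \<omega>: "\<omega> \<in> space M"
      show "f (x - Y \<omega> t) \<le> e + C * x"
      proof (cases "0 < x - Y \<omega> t")
        case True
        have "C * (x - Y \<omega> t) \<le> C * x" using C Y_nonneg[OF \<omega>] by (intro mult_left_mono) auto
        then show ?thesis using C(2)[OF True] by simp
      next
        case False
        then show ?thesis using test_funD(4)[OF f] \<open>0 < e\<close> C that by simp
      qed
    qed
    then show ?thesis by (simp add: emeasure_space_1)
  qed
  then show "\<exists>C\<ge>0. \<forall>t\<ge>0. \<forall>y>0. kill_op t (\<lambda>y. ennreal (f y)) y \<le> ennreal (e + C * y)" using C by blast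
qed

text \<open>The kernel $y^{-\beta}$ is truncated at \<open>d\<close>; what is cut off is controlled uniformly, because a tame
  function is small near \<open>0\<close>.\<close>

lemma tame_restart:
  assumes h: "tame h"
  shows "tame (restart h)"
  unfolding tame_def
proof (intro conjI allI impI)
  have hm: "case_prod h \<in> borel_measurable (borel \<Otimes>\<^sub>M borel)" using tameD(1)[OF h] .
  show "case_prod (restart h) \<in> borel_measurable (borel \<Otimes>\<^sub>M borel)" by (rule measurable_restart2[OF hm])
  show "restart h t y = 0" if "y \<le> 0" for t y using that by (rule restart_nonpos)
  have h0: "h t y = 0" if "0 \<le> t" "y \<le> 0" for t y using tameD(2)[OF h] that .
  have hb: "\<exists>C\<ge>0. \<forall>t\<ge>0. \<forall>y>0. h t y \<le> ennreal (e + C * y)" if "0 < e" for e :: real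
    using tameD(4)[OF h that] .
  have bound: "\<exists>C\<ge>0. \<forall>t\<ge>0. \<forall>y>0. restart h t y \<le> ennreal (e + C * y)" if e: "0 < e" for e :: real
  proof -
    obtain C where C: "0 \<le> C" "\<And>t y. 0 \<le> t \<Longrightarrow> 0 < y \<Longrightarrow> h t y \<le> ennreal (e + C * y)" using hb[OF e] by blast
    have "restart h t y \<le> ennreal (e + (C * (1 - \<beta>)) * y)" if "0 < y" for t y
      using C e that by (intro restart_affine) auto
    moreover have "0 \<le> C * (1 - \<beta>)" using C \<beta> by simp
    ultimately show ?thesis by blast
  qed
  then show "0 < e \<Longrightarrow> \<exists>C\<ge>0. \<forall>t\<ge>0. \<forall>y>0. restart h t y \<le> ennreal (e + C * y)" for e :: real .
  fix t :: real assume t: "0 \<le> t"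
  define g where "g = (\<lambda>t y. enn2real (h t y))"
  have [measurable (raw)]: "(\<lambda>z. g (k z) (l z)) \<in> borel_measurable K"
    if "k \<in> borel_measurable K" "l \<in> borel_measurable K" for k l and K :: "'b measure"
    unfolding g_def using measurable_curried[OF hm that] by measurable
  have g: "h r y = ennreal (g r y)" if "0 \<le> r" for r y
    using tame_finite[OF h that, of y] by (simp add: g_def)
  have g0: "0 \<le> g r y" for r y by (simp add: g_def)
  have gc: "continuous_on UNIV (g r)" if "0 \<le> r" for r
    using tameD(3)[OF h that] by (simp add: g_def)
  \<comment> \<open>The truncated kernel agrees with \<open>pw (1 - \<beta>)\<close> for y \<ge> d,
    is continuous, and is bounded by \<open>p d d\<close>; so dominated convergence applies to
    \<open>Nd d\<close>, the restart operator with this kernel.\<close>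
  define p where "p = (\<lambda>d y. max y d powr (- \<beta>) / Gamma (1 - \<beta>))"
  have [measurable]: "p d \<in> borel_measurable borel" for d unfolding p_def by measurable
  have p0: "0 \<le> p d y" for d y using Gamma_beta_pos by (simp add: p_def)
  have pc: "continuous_on UNIV (p d)" if "0 < d" for d
    unfolding p_def using that Gamma_beta_pos by (intro continuous_intros) (auto simp: max_def)
  have p_le: "p d y \<le> p d d" if "0 < d" for d y
    using that \<beta> Gamma_beta_pos unfolding p_def by (intro divide_right_mono powr_mono2') auto
  define Nd where "Nd = (\<lambda>d x. \<integral>\<^sup>+s. \<integral>\<^sup>+\<omega>. (if 0 \<le> s \<and> s \<le> t then ennreal (p d (x - Y \<omega> s) * g (t - s) (x - Y \<omega> s)) else 0) \<partial>M \<partial>lborel)"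
  have Nd_le: "Nd d x \<le> restart h t x" if "0 < d" for d x
    unfolding Nd_def restart_def
  proof (intro nn_integral_mono)
    fix s \<omega>
    have "p d y \<le> y powr (- \<beta>) / Gamma (1 - \<beta>)" if "0 < y" for y
      using that \<open>0 < d\<close> \<beta> Gamma_beta_pos unfolding p_def by (intro divide_right_mono powr_mono2') auto
    then show "(if 0 \<le> s \<and> s \<le> t then ennreal (p d (x - Y \<omega> s) * g (t - s) (x - Y \<omega> s)) else 0)
       \<le> (if 0 \<le> s \<and> s \<le> t then pw (1 - \<beta>) (x - Y \<omega> s) * h (t - s) (x - Y \<omega> s) else 0)"
    proof (cases "0 < x - Y \<omega> s \<and> s \<le> t")
      case True
      then have "p d (x - Y \<omega> s) * g (t - s) (x - Y \<omega> s) \<le> (x - Y \<omega> s) powr (- \<beta>) / Gamma (1 - \<beta>) * g (t - s) (x - Y \<omega> s)"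
        using \<open>\<And>y. 0 < y \<Longrightarrow> p d y \<le> y powr (- \<beta>) / Gamma (1 - \<beta>)\<close> g0 by (intro mult_right_mono) auto
      then show ?thesis using True Gamma_beta_pos
        by (simp add: pw_def g g0 ennreal_mult[symmetric] ennreal_leI)
    next
      case False
      then show ?thesis using h0[of "t - s" "x - Y \<omega> s"] by (cases "s \<le> t") (auto simp: g_def)
    qed
  qed
  \<comment> \<open>The truncation acts only where 0 < y < d, and there h \<le> e + C d. Since
    \<open>restart\<close> maps a constant to at most itself, the error is at most e + C d for all x
    at once.\<close>
  have N_le: "restart h t x \<le> Nd d x + ennreal (e + C * d)"
    if d: "0 < d" and e: "0 < e" and C: "0 \<le> C" "\<And>t y. 0 \<le> t \<Longrightarrow> 0 < y \<Longrightarrow> h t y \<le> ennreal (e + C * y)" for d e C x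
  proof (cases "0 < x")
    case True
    have *: "pw (1 - \<beta>) y * h r y \<le> ennreal (p d y * g r y) + pw (1 - \<beta>) y * ennreal (e + C * d)" if "0 \<le> r" for r y
    proof (cases "0 < y \<and> y < d")
      case True
      have "h r y \<le> ennreal (e + C * y)" using C that True by auto
      also have "\<dots> \<le> ennreal (e + C * d)" using True C by (intro ennreal_leI add_left_mono mult_left_mono) auto
      finally have "pw (1 - \<beta>) y * h r y \<le> pw (1 - \<beta>) y * ennreal (e + C * d)"
        by (rule mult_left_mono) simp
      then show ?thesis by (rule add_increasing[rotated]) simp
    next
      case False
      then consider "y \<le> 0" | "d \<le> y" by linarith
      then show ?thesis
      proof cases
        case 2
        then have "pw (1 - \<beta>) y * h r y = ennreal (p d y * g r y)"
          using d g[OF that] Gamma_beta_pos by (simp add: pw_def p_def max_def ennreal_mult[symmetric] g0)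
        then show ?thesis by simp
      qed simp
    qed
    have "restart h t x \<le> (\<integral>\<^sup>+s. \<integral>\<^sup>+\<omega>. (if 0 \<le> s \<and> s \<le> t then ennreal (p d (x - Y \<omega> s) * g (t - s) (x - Y \<omega> s)) else 0)
       + (if 0 \<le> s \<and> s \<le> t then pw (1 - \<beta>) (x - Y \<omega> s) * ennreal (e + C * d) else 0) \<partial>M \<partial>lborel)"
      unfolding restart_def by (intro nn_integral_mono) (auto intro: *)
    also have "\<dots> = Nd d x + restart (\<lambda>_ _. ennreal (e + C * d)) t x"
      unfolding Nd_def restart_def by (simp add: nn_integral_add)
    also have "restart (\<lambda>_ _. ennreal (e + C * d)) t x \<le> ennreal ((e + C * d) + 0 * (1 - \<beta>) * x)"
      using True e d C by (intro restart_affine) auto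
    finally show ?thesis by (simp add: add_left_mono)
  qed (simp add: restart_nonpos)
  have fin: "restart h t x < \<top>" for x
  proof (cases "0 < x")
    case True
    then show ?thesis using bound[of 1] t by (meson le_less_trans ennreal_less_top zero_less_one)
  qed (simp add: restart_nonpos)
  have Nd_fin: "Nd d x < \<top>" if "0 < d" for d x using Nd_le[OF that] fin le_less_trans by blast
  have cont: "continuous_on UNIV (\<lambda>x. enn2real (Nd d x))" if d: "0 < d" for d
    unfolding continuous_on_sequentially
  proof (intro allI impI ballI)
    fix X :: "nat \<Rightarrow> real" and x assume "(\<forall>n. X n \<in> UNIV) \<and> X \<longlonglongrightarrow> x"
    then have X: "X \<longlonglongrightarrow> x" by simp
    obtain R where R: "\<And>i. X i \<le> R" using Bseq_bdd_above[OF convergent_imp_Bseq[OF convergentI[OF X]]] by (auto simp: bdd_above_def)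
    obtain C where C: "0 \<le> C" "\<And>t y. 0 \<le> t \<Longrightarrow> 0 < y \<Longrightarrow> h t y \<le> ennreal (1 + C * y)" using hb[OF zero_less_one] by blast
    define B where "B = p d d * (1 + C * \<bar>R\<bar>)"
    have B0: "0 \<le> B" using C p0[of d d] by (simp add: B_def)
    have bnd: "p d (X i - Y \<omega> s) * g (t - s) (X i - Y \<omega> s) \<le> B" if "s \<le> t" "\<omega> \<in> space M" for i s \<omega>
    proof -
      have "g (t - s) (X i - Y \<omega> s) \<le> 1 + C * \<bar>R\<bar>"
      proof (cases "0 < X i - Y \<omega> s")
        case True
        have "ennreal (g (t - s) (X i - Y \<omega> s)) \<le> ennreal (1 + C * (X i - Y \<omega> s))"
          using C(2)[of "t - s" "X i - Y \<omega> s"] True that g[of "t - s"] by simp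
        then have "g (t - s) (X i - Y \<omega> s) \<le> 1 + C * (X i - Y \<omega> s)" using C True by (subst (asm) ennreal_le_iff) auto
        also have "\<dots> \<le> 1 + C * \<bar>R\<bar>" using C R[of i] Y_nonneg[OF that(2), of s] by (intro add_left_mono mult_left_mono) auto
        finally show ?thesis .
      next
        case False
        then have "g (t - s) (X i - Y \<omega> s) = 0" using h0 that by (simp add: g_def)
        then show ?thesis using C by simp
      qed
      then show ?thesis unfolding B_def using p_le[OF d] p0 g0 by (intro mult_mono) auto
    qed
    have "(\<lambda>i. Nd d (X i)) \<longlonglongrightarrow> Nd d x"
      unfolding Nd_def
    proof (rule nn_integral_dominated_convergence[where w = "\<lambda>s. ennreal B * indicator {0..t} s"])
      show "AE s in lborel. (\<integral>\<^sup>+\<omega>. (if 0 \<le> s \<and> s \<le> t then ennreal (p d (X i - Y \<omega> s) * g (t - s) (X i - Y \<omega> s)) else 0) \<partial>M)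
          \<le> ennreal B * indicator {0..t} s" for i
      proof (rule AE_I2)
        fix s
        have "(\<integral>\<^sup>+\<omega>. (if 0 \<le> s \<and> s \<le> t then ennreal (p d (X i - Y \<omega> s) * g (t - s) (X i - Y \<omega> s)) else 0) \<partial>M)
          \<le> (\<integral>\<^sup>+\<omega>. ennreal B * indicator {0..t} s \<partial>M)"
          by (intro nn_integral_mono) (auto intro!: ennreal_leI bnd)
        then show "(\<integral>\<^sup>+\<omega>. (if 0 \<le> s \<and> s \<le> t then ennreal (p d (X i - Y \<omega> s) * g (t - s) (X i - Y \<omega> s)) else 0) \<partial>M)
          \<le> ennreal B * indicator {0..t} s" by (simp add: emeasure_space_1)
      qed
      show "AE s in lborel. (\<lambda>i. \<integral>\<^sup>+\<omega>. (if 0 \<le> s \<and> s \<le> t then ennreal (p d (X i - Y \<omega> s) * g (t - s) (X i - Y \<omega> s)) else 0) \<partial>M)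
        \<longlonglongrightarrow> (\<integral>\<^sup>+\<omega>. (if 0 \<le> s \<and> s \<le> t then ennreal (p d (x - Y \<omega> s) * g (t - s) (x - Y \<omega> s)) else 0) \<partial>M)"
      proof (rule AE_I2)
        fix s
        show "(\<lambda>i. \<integral>\<^sup>+\<omega>. (if 0 \<le> s \<and> s \<le> t then ennreal (p d (X i - Y \<omega> s) * g (t - s) (X i - Y \<omega> s)) else 0) \<partial>M)
        \<longlonglongrightarrow> (\<integral>\<^sup>+\<omega>. (if 0 \<le> s \<and> s \<le> t then ennreal (p d (x - Y \<omega> s) * g (t - s) (x - Y \<omega> s)) else 0) \<partial>M)"
        proof (cases "0 \<le> s \<and> s \<le> t")
          case True
          have "(\<lambda>i. \<integral>\<^sup>+\<omega>. ennreal (p d (X i - Y \<omega> s) * g (t - s) (X i - Y \<omega> s)) \<partial>M)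
             \<longlonglongrightarrow> (\<integral>\<^sup>+\<omega>. ennreal (p d (x - Y \<omega> s) * g (t - s) (x - Y \<omega> s)) \<partial>M)"
          proof (rule nn_integral_dominated_convergence[where w = "\<lambda>_. ennreal B"])
            show "AE \<omega> in M. ennreal (p d (X i - Y \<omega> s) * g (t - s) (X i - Y \<omega> s)) \<le> ennreal B" for i
              using True bnd by (intro AE_I2 ennreal_leI) auto
            have "(\<lambda>i. p d (X i - Y \<omega> s) * g (t - s) (X i - Y \<omega> s)) \<longlonglongrightarrow> p d (x - Y \<omega> s) * g (t - s) (x - Y \<omega> s)" for \<omega>
              using True X
              by (intro tendsto_mult continuous_on_tendsto_compose[OF pc[OF d]] continuous_on_tendsto_compose[OF gc] tendsto_diff tendsto_const) auto
            then show "AE \<omega> in M. (\<lambda>i. ennreal (p d (X i - Y \<omega> s) * g (t - s) (X i - Y \<omega> s))) \<longlonglongrightarrow> ennreal (p d (x - Y \<omega> s) * g (t - s) (x - Y \<omega> s))"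
              by (intro AE_I2 tendsto_ennrealI)
          qed (auto simp: emeasure_space_1)
          then show ?thesis using True by simp
        qed auto
      qed
    qed (auto simp: nn_integral_cmult ennreal_mult[symmetric] B0 t)
    then have "(\<lambda>i. Nd d (X i)) \<longlonglongrightarrow> ennreal (enn2real (Nd d x))" using Nd_fin[OF d, of x] by simp
    from tendsto_enn2real[OF this enn2real_nonneg]
    show "((\<lambda>x. enn2real (Nd d x)) \<circ> X) \<longlonglongrightarrow> enn2real (Nd d x)" by (simp add: o_def)
  qed
  show "continuous_on UNIV (\<lambda>y. enn2real (restart h t y))"
  proof (rule uniform_limit_theorem[where F = sequentially and f = "\<lambda>i y. enn2real (Nd (1 / real (Suc i)) y)"])
    show "\<forall>\<^sub>F n in sequentially. continuous_on UNIV (\<lambda>y. enn2real (Nd (1 / real (Suc n)) y))"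
      using cont by auto
    show "uniform_limit UNIV (\<lambda>i y. enn2real (Nd (1 / real (Suc i)) y)) (\<lambda>y. enn2real (restart h t y)) sequentially"
    proof (rule uniform_limitI)
      fix e :: real assume e: "0 < e"
      obtain C where C: "0 \<le> C" "\<And>t y. 0 \<le> t \<Longrightarrow> 0 < y \<Longrightarrow> h t y \<le> ennreal (e / 2 + C * y)"
        using hb[of "e / 2"] e by auto
      have "(\<lambda>i. e / 2 + C * (1 / real (Suc i))) \<longlonglongrightarrow> e / 2 + C * 0"
        using LIMSEQ_inverse_real_of_nat by (intro tendsto_intros) (simp add: inverse_eq_divide)
      then have "\<forall>\<^sub>F i in sequentially. e / 2 + C * (1 / real (Suc i)) < e"
        by (rule order_tendstoD) (use e in auto)
      then show "\<forall>\<^sub>F i in sequentially. \<forall>x\<in>UNIV. dist (enn2real (Nd (1 / real (Suc i)) x)) (enn2real (restart h t x)) < e"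
      proof (eventually_elim, intro ballI)
        fix i x assume i: "e / 2 + C * (1 / real (Suc i)) < e"
        define d where "d = 1 / real (Suc i)"
        have d: "0 < d" by (simp add: d_def)
        have 1: "enn2real (Nd d x) \<le> enn2real (restart h t x)"
          using Nd_le[OF d] fin by (intro enn2real_mono) auto
        have "restart h t x \<le> Nd d x + ennreal (e / 2 + C * d)" using C e d by (intro N_le) auto
        then have "enn2real (restart h t x) \<le> enn2real (Nd d x + ennreal (e / 2 + C * d))"
          using Nd_fin[OF d, of x] by (intro enn2real_mono) (auto simp: less_top)
        also have "\<dots> = enn2real (Nd d x) + (e / 2 + C * d)"
          using Nd_fin[OF d, of x] C(1) e d by (subst enn2real_plus) (auto simp del: ennreal_plus)
        finally show "dist (enn2real (Nd d x)) (enn2real (restart h t x)) < e"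
          using 1 i by (simp add: dist_real_def d_def)
      qed
    qed
  qed simp
qed

lemma tame_dyson: "test_fun f \<Longrightarrow> tame (dyson (\<lambda>y. ennreal (f y)) n)"
  by (induction n) (simp_all add: dyson_Suc tame_restart dyson_def[of _ 0] tame_kill_op)

lemma cens_affine:
  assumes f: "test_fun f" and "0 < x" "0 \<le> t" and C: "0 \<le> e" "0 \<le> C" "\<And>y. 0 < y \<Longrightarrow> f y \<le> e + C * y"
  shows "cens (\<lambda>y. ennreal (f y)) t x \<le> ennreal (e + C * x)"
proof (rule cens_le)
  show "(\<lambda>y. ennreal (f y)) \<in> borel_measurable borel" by (rule test_funD(7)[OF f])
  show "ennreal (f y) \<le> (if 0 < y then ennreal (e + C * y) else 0)" for y
    using C(3) test_funD(4)[OF f] by (auto intro!: ennreal_leI)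
qed (use assms in \<open>auto intro!: ennreal_leI mult_left_mono\<close>)

lemma cens_bound:
  assumes f: "test_fun f" and "0 \<le> t" and B: "\<And>y. f y \<le> B"
  shows "cens (\<lambda>y. ennreal (f y)) t x \<le> ennreal B"
proof (cases "0 < x")
  case True
  then show ?thesis using cens_affine[OF f True \<open>0 \<le> t\<close>, of B 0] B test_funD(3)[OF f, of 0] order_trans[OF _ B[of 0]] by simp
next
  case False
  then show ?thesis using cens_nonpos[of "\<lambda>y. ennreal (f y)" x t] test_funD(4)[OF f] by simp
qed

text \<open>The terms are continuous by tameness, and by \<open>cens_restart\<close> the remainder
  after n of them is at most e / 2 + C (1 - \<beta>)^n T on [0, T], so the convergence is
  uniform.\<close>

lemma continuous_cens:
  assumes f: "test_fun f" and t: "0 \<le> t"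
  shows "continuous_on {0..T} (\<lambda>x. enn2real (cens (\<lambda>y. ennreal (f y)) t x))"
proof -
  let ?f = "\<lambda>y. ennreal (f y)"
  note fm = test_funD(7)[OF f]
  have fin: "dyson ?f n t x < \<top>" for n x using tame_finite[OF tame_dyson[OF f] t] .
  show ?thesis
  proof (rule uniform_limit_theorem[where F = sequentially and f = "\<lambda>n x. \<Sum>m<n. enn2real (dyson ?f m t x)"])
    have "continuous_on UNIV (\<lambda>x. enn2real (dyson ?f m t x))" for m
      using tameD(3)[OF tame_dyson[OF f] t] .
    then show "\<forall>\<^sub>F n in sequentially. continuous_on {0..T} (\<lambda>x. \<Sum>m<n. enn2real (dyson ?f m t x))"
      by (intro always_eventually allI continuous_on_sum) (meson continuous_on_subset subset_UNIV)
    show "uniform_limit {0..T} (\<lambda>n x. \<Sum>m<n. enn2real (dyson ?f m t x)) (\<lambda>x. enn2real (cens ?f t x)) sequentially"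
    proof (rule uniform_limitI)
      fix e :: real assume e: "0 < e"
      obtain C where C: "0 \<le> C" "\<And>y. 0 < y \<Longrightarrow> f y \<le> e / 2 + C * y"
        using test_fun_affine_bound[OF f, of "e / 2"] e by auto
      have "(\<lambda>n. e / 2 + C * (1 - \<beta>) ^ n * \<bar>T\<bar>) \<longlonglongrightarrow> e / 2 + C * 0 * \<bar>T\<bar>"
        using \<beta> by (intro tendsto_intros LIMSEQ_power_zero) auto
      then have "\<forall>\<^sub>F n in sequentially. e / 2 + C * (1 - \<beta>) ^ n * \<bar>T\<bar> < e"
        by (rule order_tendstoD) (use e in auto)
      then show "\<forall>\<^sub>F n in sequentially. \<forall>x\<in>{0..T}. dist (\<Sum>m<n. enn2real (dyson ?f m t x)) (enn2real (cens ?f t x)) < e"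
      proof (eventually_elim, intro ballI)
        fix n x assume n: "e / 2 + C * (1 - \<beta>) ^ n * \<bar>T\<bar> < e" and x: "x \<in> {0..T}"
        show "dist (\<Sum>m<n. enn2real (dyson ?f m t x)) (enn2real (cens ?f t x)) < e"
        proof (cases "x = 0")
          case True
          then show ?thesis using dyson_nonpos[of ?f x] cens_nonpos[of ?f x] test_funD(4)[OF f] e by simp
        next
          case False
          let ?N = "(restart ^^ n) (cens ?f) t x"
          have N: "?N \<le> ennreal (e / 2 + C * (1 - \<beta>) ^ n * x)"
            using False x t C e by (intro funpow_restart_affine cens_affine[OF f]) auto
          then have "?N < \<top>" by (rule le_less_trans) simp
          have "enn2real (cens ?f t x) = enn2real ((\<Sum>m<n. dyson ?f m t x) + ?N)"
            by (subst cens_restart[OF fm, of t x n]) simp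
          also have "\<dots> = enn2real (\<Sum>m<n. dyson ?f m t x) + enn2real ?N"
            using fin \<open>?N < \<top>\<close> by (intro enn2real_plus) (auto simp: less_top)
          also have "enn2real (\<Sum>m<n. dyson ?f m t x) = (\<Sum>m<n. enn2real (dyson ?f m t x))"
            using enn2real_sum[of "{..<n}" "\<lambda>m. dyson ?f m t x"] fin by (simp add: o_def)
          finally have "dist (\<Sum>m<n. enn2real (dyson ?f m t x)) (enn2real (cens ?f t x)) = enn2real ?N"
            by (simp add: dist_real_def)
          also have "\<dots> \<le> e / 2 + C * (1 - \<beta>) ^ n * x"
            using N e C \<beta> x by (intro enn2real_leI) auto
          also have "\<dots> \<le> e / 2 + C * (1 - \<beta>) ^ n * \<bar>T\<bar>"
            using x C \<beta> by (intro add_left_mono mult_left_mono) auto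
          finally show ?thesis using n by simp
        qed
      qed
    qed
  qed simp
qed

text \<open>Near 0 both functions are small, by the affine bound. Away from 0 a restart before time
  t forces Y_t \<ge> x, which has probability of order t by \<open>tail_bound\<close>; without it,
  uniform continuity of f handles the small displacement.\<close>

lemma strongly_continuous_cens:
  assumes f: "test_fun f"
  shows "uniform_limit {0..T} (\<lambda>t x. enn2real (cens (\<lambda>y. ennreal (f y)) t x)) f (at_right 0)"
proof (rule uniform_limitI)
  let ?f = "\<lambda>y. ennreal (f y)"
  note [measurable] = test_funD(6)[OF f]
  fix e :: real assume e: "0 < e"
  obtain B where B: "0 \<le> B" "\<And>y. f y \<le> B" using test_funD(5)[OF f] by blast
  obtain C where C: "0 \<le> C" "\<And>y. 0 < y \<Longrightarrow> f y \<le> e / 4 + C * y"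
    using test_fun_affine_bound[OF f, of "e / 4"] e by auto
  have "0 < e / 4" using e by simp
  then obtain \<eta> where \<eta>: "0 < \<eta>" "\<And>y y'. dist y' y < \<eta> \<Longrightarrow> dist (f y') (f y) < e / 4"
    using test_funD(1)[OF f] unfolding uniformly_continuous_on_def by blast
  \<comment> \<open>Chosen so that e / 4 + C \<delta> \<le> e / 2, which bounds both f and its image
    on (0, \<delta>).\<close>
  define \<delta> where "\<delta> = e / (4 * (C + 1))"
  have \<delta>: "0 < \<delta>" "C * \<delta> \<le> e / 4" using e C by (auto simp: \<delta>_def field_simps)
  define m where "m = min \<eta> \<delta>"
  have m: "0 < m" "m \<le> \<eta>" "m \<le> \<delta>" using \<eta> \<delta> by (auto simp: m_def)
  \<comment> \<open>By \<open>tail_bound\<close>, t K bounds the probability of Y_t \<ge> m. The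
    bound B is paid twice for this event: once for the change of f along the surviving path and once
    for the restarted part.\<close>
  define K where "K = m powr (- \<beta>) / (1 - exp (- 1))"
  have "((\<lambda>t. 2 * B * (t * K)) \<longlongrightarrow> 2 * B * (0 * K)) (at_right 0)"
    by (intro tendsto_intros)
  then have "\<forall>\<^sub>F t in at_right 0. 2 * B * (t * K) < e / 2"
    by (rule order_tendstoD) (use e in auto)
  moreover have "\<forall>\<^sub>F t in at_right (0::real). 0 < t" by (rule eventually_at_right_less)
  ultimately show "\<forall>\<^sub>F t in at_right 0. \<forall>x\<in>{0..T}. dist (enn2real (cens ?f t x)) (f x) < e"
  proof (eventually_elim, intro ballI)
    fix t x assume t: "2 * B * (t * K) < e / 2" "0 < t" and x: "x \<in> {0..T}"
    consider "x = 0" | "0 < x" "x < \<delta>" | "\<delta> \<le> x" using x by fastforce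
    then show "dist (enn2real (cens ?f t x)) (f x) < e"
    proof cases
      case 1
      then show ?thesis using cens_nonpos[of ?f x t] test_funD(4)[OF f] e by simp
    next
      case 2
      have "C * x \<le> C * \<delta>" using 2 C by (intro mult_left_mono) auto
      then have le: "e / 4 + C * x \<le> e / 2" using \<delta> by simp
      have "cens ?f t x \<le> ennreal (e / 4 + C * x)" using 2 t e C by (intro cens_affine[OF f]) auto
      also have "\<dots> \<le> ennreal (e / 2)" using le by (rule ennreal_leI)
      finally have "enn2real (cens ?f t x) \<le> e / 2" using e by (intro enn2real_leI) auto
      moreover have "f x \<le> e / 2" using C(2)[OF 2(1)] le by simp
      moreover have "0 \<le> enn2real (cens ?f t x)" "0 \<le> f x" using test_funD(3)[OF f] by auto
      ultimately show ?thesis using e unfolding dist_real_def by linarith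
    next
      case 3
      then have x0: "0 < x" using \<delta> by simp
      have tail: "tail t m \<le> t * K" unfolding K_def using t m by (intro tail_bound) auto
      have kill: "kill_op t ?f x = ennreal (LINT \<omega>|M. f (x - Y \<omega> t))"
        unfolding kill_op_def using B test_funD(3)[OF f]
        by (intro nn_integral_eq_integral integrable_const_bound[where B = B]) auto
      have int: "integrable M (\<lambda>\<omega>. f (x - Y \<omega> t))"
        using B test_funD(3)[OF f] by (intro integrable_const_bound[where B = B]) auto
      have "\<bar>(LINT \<omega>|M. f (x - Y \<omega> t)) - f x\<bar> = \<bar>LINT \<omega>|M. f (x - Y \<omega> t) - f x\<bar>"
        using int by (simp add: prob_space)
      also have "\<dots> \<le> (LINT \<omega>|M. \<bar>f (x - Y \<omega> t) - f x\<bar>)" by (rule integral_abs_bound)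
      also have "\<dots> \<le> (LINT \<omega>|M. e / 4 + B * indicator {\<omega>\<in>space M. m \<le> Y \<omega> t} \<omega>)"
      proof (rule integral_mono)
        fix \<omega> assume \<omega>: "\<omega> \<in> space M"
        show "\<bar>f (x - Y \<omega> t) - f x\<bar> \<le> e / 4 + B * indicator {\<omega>\<in>space M. m \<le> Y \<omega> t} \<omega>"
        proof (cases "m \<le> Y \<omega> t")
          case True
          have "\<bar>f (x - Y \<omega> t) - f x\<bar> \<le> B"
            using B(2)[of x] B(2)[of "x - Y \<omega> t"] test_funD(3)[OF f, of x] test_funD(3)[OF f, of "x - Y \<omega> t"] by linarith
          then show ?thesis using True \<omega> e by simp
        next
          case False
          then have "dist (x - Y \<omega> t) x < \<eta>" using m Y_nonneg[OF \<omega>, of t] by (simp add: dist_real_def)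
          from \<eta>(2)[OF this] show ?thesis using False by (simp add: dist_real_def)
        qed
      qed (use int in \<open>auto simp: less_top[symmetric]\<close>)
      also have "\<dots> = e / 4 + B * tail t m"
        by (subst Bochner_Integration.integral_add) (auto simp: less_top[symmetric] prob_space tail_def)
      finally have k: "\<bar>(LINT \<omega>|M. f (x - Y \<omega> t)) - f x\<bar> \<le> e / 4 + B * tail t m" .
      have "restart (cens ?f) t x \<le> (\<integral>\<^sup>+\<omega>. ennreal B * indicator {\<omega>\<in>space M. m \<le> Y \<omega> t} \<omega> \<partial>M)"
        unfolding restart_eq_passage[OF x0 measurable_cens[OF test_funD(7)[OF f]]]
      proof (rule nn_integral_mono)
        fix \<omega> assume \<omega>: "\<omega> \<in> space M"
        show "(if undershoot (Y \<omega>) x < x \<and> passage (Y \<omega>) x \<le> t then cens ?f (t - passage (Y \<omega>) x) (x - undershoot (Y \<omega>) x) else 0)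
          \<le> ennreal B * indicator {\<omega>\<in>space M. m \<le> Y \<omega> t} \<omega>"
          using passage_le_iff[OF reg[OF \<omega>] x0, of t] m 3 \<omega> cens_bound[OF f _ B(2)] by auto
      qed
      also have "\<dots> = ennreal (B * tail t m)"
        using B by (simp add: nn_integral_cmult tail_def emeasure_eq_measure ennreal_mult)
      finally have r: "restart (cens ?f) t x \<le> ennreal (B * tail t m)" .
      then have rf: "restart (cens ?f) t x < \<top>" by (rule le_less_trans) simp
      have "enn2real (cens ?f t x) = (LINT \<omega>|M. f (x - Y \<omega> t)) + enn2real (restart (cens ?f) t x)"
        unfolding cens_eq_kill_op_restart[OF test_funD(7)[OF f], of t x] kill
        using rf test_funD(3)[OF f] by (subst enn2real_plus) auto
      moreover have "enn2real (restart (cens ?f) t x) \<le> B * tail t m"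
        using r B by (intro enn2real_leI) (auto simp: tail_def)
      moreover have "B * tail t m \<le> B * (t * K)" using tail B(1) by (rule mult_left_mono)
      moreover have "0 \<le> enn2real (restart (cens ?f) t x)" by simp
      ultimately show ?thesis using k t e unfolding dist_real_def by linarith
    qed
  qed
qed

section \<open>Time integrals of the censored semigroup\<close>

definition green :: "(real \<Rightarrow> ennreal) \<Rightarrow> nat \<Rightarrow> real \<Rightarrow> ennreal" where
  "green f n x = (\<integral>\<^sup>+t. (if 0 \<le> t then dyson f n t x else 0) \<partial>lborel)"

lemma measurable_green: "f \<in> borel_measurable borel \<Longrightarrow> green f n \<in> borel_measurable borel"
proof -
  assume "f \<in> borel_measurable borel"
  note [measurable (raw)] = measurable_curried[OF measurable_dyson[OF this]]
  show ?thesis unfolding green_def by measurable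
qed

lemma green_0: "f \<in> borel_measurable borel \<Longrightarrow> green f 0 x = (\<integral>\<^sup>+r. pw \<beta> (x - r) * f r \<partial>lborel)"
  unfolding green_def dyson_0 kill_op_def potential_conv[symmetric] by (intro nn_integral_cong) auto

text \<open>\<open>restart\<close> is a convolution in time, so integrating over all times separates
  its factors: shifting t by s integrates out the remaining time, and the integral over s becomes
  the potential of the subordinator.\<close>

lemma green_Suc:
  assumes f: "f \<in> borel_measurable borel"
  shows "green f (Suc n) x = (\<integral>\<^sup>+r. pw \<beta> (x - r) * (pw (1 - \<beta>) r * green f n r) \<partial>lborel)"
proof -
  note [measurable (raw)] = measurable_curried[OF measurable_dyson[OF f]]
  note [measurable] = measurable_green[OF f]
  have "green f (Suc n) x = (\<integral>\<^sup>+t. \<integral>\<^sup>+s. \<integral>\<^sup>+\<omega>. (if 0 \<le> t \<and> 0 \<le> s \<and> s \<le> t then pw (1 - \<beta>) (x - Y \<omega> s) * dyson f n (t - s) (x - Y \<omega> s) else 0) \<partial>M \<partial>lborel \<partial>lborel)"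
    unfolding green_def dyson_Suc restart_def by (intro nn_integral_cong) auto
  also have "\<dots> = (\<integral>\<^sup>+s. \<integral>\<^sup>+t. \<integral>\<^sup>+\<omega>. (if 0 \<le> t \<and> 0 \<le> s \<and> s \<le> t then pw (1 - \<beta>) (x - Y \<omega> s) * dyson f n (t - s) (x - Y \<omega> s) else 0) \<partial>M \<partial>lborel \<partial>lborel)"
    by (rule lborel_pair.Fubini') measurable
  also have "\<dots> = (\<integral>\<^sup>+s. \<integral>\<^sup>+\<omega>. \<integral>\<^sup>+t. (if 0 \<le> t \<and> 0 \<le> s \<and> s \<le> t then pw (1 - \<beta>) (x - Y \<omega> s) * dyson f n (t - s) (x - Y \<omega> s) else 0) \<partial>lborel \<partial>M \<partial>lborel)"
    by (intro nn_integral_cong M_lborel.Fubini') measurable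
  also have "\<dots> = (\<integral>\<^sup>+s. \<integral>\<^sup>+\<omega>. (if 0 \<le> s then pw (1 - \<beta>) (x - Y \<omega> s) * green f n (x - Y \<omega> s) else 0) \<partial>M \<partial>lborel)"
  proof (intro nn_integral_cong)
    fix s :: real and \<omega> assume "\<omega> \<in> space M"
    note [measurable] = measurable_const[OF this, of borel]
    show "(\<integral>\<^sup>+t. (if 0 \<le> t \<and> 0 \<le> s \<and> s \<le> t then pw (1 - \<beta>) (x - Y \<omega> s) * dyson f n (t - s) (x - Y \<omega> s) else 0) \<partial>lborel)
      = (if 0 \<le> s then pw (1 - \<beta>) (x - Y \<omega> s) * green f n (x - Y \<omega> s) else 0)"
    proof (cases "0 \<le> s")
      case True
      have "(\<integral>\<^sup>+t. (if 0 \<le> t \<and> 0 \<le> s \<and> s \<le> t then pw (1 - \<beta>) (x - Y \<omega> s) * dyson f n (t - s) (x - Y \<omega> s) else 0) \<partial>lborel)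
        = (\<integral>\<^sup>+t. pw (1 - \<beta>) (x - Y \<omega> s) * (if 0 \<le> t then dyson f n t (x - Y \<omega> s) else 0) \<partial>lborel)"
        using True by (subst nn_integral_real_affine[where t = s and c = 1]) (auto intro!: nn_integral_cong)
      also have "\<dots> = pw (1 - \<beta>) (x - Y \<omega> s) * green f n (x - Y \<omega> s)"
        unfolding green_def by (rule nn_integral_cmult) measurable
      finally show ?thesis using True by simp
    qed simp
  qed
  also have "\<dots> = (\<integral>\<^sup>+r. pw \<beta> (x - r) * (pw (1 - \<beta>) r * green f n r) \<partial>lborel)"
    by (rule potential_conv) measurable
  finally show ?thesis .
qed

lemma suminf_green:
  assumes f: "f \<in> borel_measurable borel"
  shows "(\<Sum>n. green f n x) = (\<integral>\<^sup>+t. (if 0 \<le> t then cens f t x else 0) \<partial>lborel)"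
proof -
  note [measurable (raw)] = measurable_curried[OF measurable_dyson[OF f]]
  have "(\<Sum>n. green f n x) = (\<integral>\<^sup>+t. (\<Sum>n. if 0 \<le> t then dyson f n t x else 0) \<partial>lborel)"
    unfolding green_def by (rule nn_integral_suminf[symmetric]) measurable
  also have "\<dots> = (\<integral>\<^sup>+t. (if 0 \<le> t then cens f t x else 0) \<partial>lborel)"
    by (intro nn_integral_cong) (auto simp: cens_def)
  finally show ?thesis .
qed

text \<open>Tonelli carried through n restarts; it is needed because the potential, an integral over
  time, is fed back into the semigroup.\<close>

lemma dyson_nn_integral:
  assumes F: "case_prod F \<in> borel_measurable (borel \<Otimes>\<^sub>M borel)"
  shows "dyson (\<lambda>y. \<integral>\<^sup>+t. F t y \<partial>lborel) n s x = (\<integral>\<^sup>+t. dyson (F t) n s x \<partial>lborel)"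
proof (induction n arbitrary: s x)
  case 0
  note [measurable (raw)] = measurable_curried[OF F]
  show ?case unfolding dyson_0 kill_op_def by (rule M_lborel.Fubini'[symmetric]) measurable
next
  case (Suc n)
  note [measurable (raw)] = measurable_curried3[OF measurable_dyson3[OF F]]
  have "dyson (\<lambda>y. \<integral>\<^sup>+t. F t y \<partial>lborel) (Suc n) s x
     = (\<integral>\<^sup>+r. \<integral>\<^sup>+\<omega>. \<integral>\<^sup>+t. (if 0 \<le> r \<and> r \<le> s then pw (1 - \<beta>) (x - Y \<omega> r) * dyson (F t) n (s - r) (x - Y \<omega> r) else 0) \<partial>lborel \<partial>M \<partial>lborel)"
    unfolding dyson_Suc restart_def Suc.IH
  proof (intro nn_integral_cong)
    fix r :: real and \<omega> assume "\<omega> \<in> space M"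
    show "(if 0 \<le> r \<and> r \<le> s then pw (1 - \<beta>) (x - Y \<omega> r) * (\<integral>\<^sup>+t. dyson (F t) n (s - r) (x - Y \<omega> r) \<partial>lborel) else 0)
      = (\<integral>\<^sup>+t. (if 0 \<le> r \<and> r \<le> s then pw (1 - \<beta>) (x - Y \<omega> r) * dyson (F t) n (s - r) (x - Y \<omega> r) else 0) \<partial>lborel)"
      by (auto intro!: nn_integral_cmult[symmetric])
  qed
  also have "\<dots> = (\<integral>\<^sup>+r. \<integral>\<^sup>+t. \<integral>\<^sup>+\<omega>. (if 0 \<le> r \<and> r \<le> s then pw (1 - \<beta>) (x - Y \<omega> r) * dyson (F t) n (s - r) (x - Y \<omega> r) else 0) \<partial>M \<partial>lborel \<partial>lborel)"
    by (intro nn_integral_cong M_lborel.Fubini'[symmetric]) measurable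
  also have "\<dots> = (\<integral>\<^sup>+t. \<integral>\<^sup>+r. \<integral>\<^sup>+\<omega>. (if 0 \<le> r \<and> r \<le> s then pw (1 - \<beta>) (x - Y \<omega> r) * dyson (F t) n (s - r) (x - Y \<omega> r) else 0) \<partial>M \<partial>lborel \<partial>lborel)"
    by (rule lborel_pair.Fubini') measurable
  finally show ?case unfolding dyson_Suc restart_def .
qed

lemma cens_nn_integral:
  assumes F: "case_prod F \<in> borel_measurable (borel \<Otimes>\<^sub>M borel)"
  shows "cens (\<lambda>y. \<integral>\<^sup>+t. F t y \<partial>lborel) s x = (\<integral>\<^sup>+t. cens (F t) s x \<partial>lborel)"
proof -
  note [measurable (raw)] = measurable_curried3[OF measurable_dyson3[OF F]]
  show ?thesis unfolding cens_def dyson_nn_integral[OF F] by (rule nn_integral_suminf[symmetric]) measurable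
qed

lemma cens_zero: "cens (\<lambda>_. 0) t x = 0"
proof -
  have "dyson (\<lambda>_. 0) n t x = 0" for n t x
    by (induction n arbitrary: t x) (simp_all add: dyson_0 kill_op_def dyson_Suc restart_def cong: if_cong)
  then show ?thesis by (simp add: cens_def)
qed

text \<open>Both sides of the first identity integrate \<open>cens f (t + h)\<close> over t \<ge> 0;
  the second splits the integral over all times at h. It is stated as a sum because subtraction is
  unsafe where values may be infinite.\<close>

lemma cens_potential:
  assumes f: "f \<in> borel_measurable borel" and h: "0 \<le> h"
  shows "cens (\<lambda>y. \<integral>\<^sup>+t. (if 0 \<le> t then cens f t y else 0) \<partial>lborel) h x
     = (\<integral>\<^sup>+t. (if 0 \<le> t then cens (cens f h) t x else 0) \<partial>lborel)" (is ?A)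
    and "(\<integral>\<^sup>+t. (if 0 \<le> t then cens (cens f h) t x else 0) \<partial>lborel) + (\<integral>\<^sup>+t. (if 0 \<le> t \<and> t < h then cens f t x else 0) \<partial>lborel)
     = (\<integral>\<^sup>+t. (if 0 \<le> t then cens f t x else 0) \<partial>lborel)" (is ?B)
proof -
  note [measurable (raw)] = measurable_curried[OF measurable_cens[OF f]]
  have "cens (\<lambda>y. \<integral>\<^sup>+t. (if 0 \<le> t then cens f t y else 0) \<partial>lborel) h x
    = (\<integral>\<^sup>+t. cens (\<lambda>y. if 0 \<le> t then cens f t y else 0) h x \<partial>lborel)"
    by (rule cens_nn_integral) measurable
  also have "\<dots> = (\<integral>\<^sup>+t. (if 0 \<le> t then cens (cens f h) t x else 0) \<partial>lborel)"
    by (intro nn_integral_cong) (auto simp: cens_zero cens_add[OF f] h add.commute)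
  finally show ?A .
  have "(\<integral>\<^sup>+t. (if 0 \<le> t then cens (cens f h) t x else 0) \<partial>lborel) = (\<integral>\<^sup>+t. (if 0 \<le> t then cens f (t + h) x else 0) \<partial>lborel)"
    by (intro nn_integral_cong) (auto simp: cens_add[OF f] h)
  also have "\<dots> = (\<integral>\<^sup>+t. (if h \<le> t then cens f t x else 0) \<partial>lborel)"
    by (subst nn_integral_real_affine[where t = "- h" and c = 1]) (auto intro!: nn_integral_cong)
  finally have "(\<integral>\<^sup>+t. (if 0 \<le> t then cens (cens f h) t x else 0) \<partial>lborel) + (\<integral>\<^sup>+t. (if 0 \<le> t \<and> t < h then cens f t x else 0) \<partial>lborel)
    = (\<integral>\<^sup>+t. (if h \<le> t then cens f t x else 0) + (if 0 \<le> t \<and> t < h then cens f t x else 0) \<partial>lborel)"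
    by (subst nn_integral_add) auto
  also have "\<dots> = (\<integral>\<^sup>+t. (if 0 \<le> t then cens f t x else 0) \<partial>lborel)"
    using h by (intro nn_integral_cong) auto
  finally show ?B .
qed

end

section \<open>Paths of the censored process\<close>

text \<open>The position after n restarts; \<open>tim\<close> below is the time of the n-th one. The
  passage from n to n + 1 is driven by path number n + 1.\<close>

primrec pos :: "real \<Rightarrow> (nat \<Rightarrow> real \<Rightarrow> real) \<Rightarrow> nat \<Rightarrow> real" where
  "pos x y 0 = x"
| "pos x y (Suc n) = pos x y n - undershoot (y (Suc n)) (pos x y n)"

primrec tim :: "real \<Rightarrow> (nat \<Rightarrow> real \<Rightarrow> real) \<Rightarrow> nat \<Rightarrow> real" where
  "tim x y 0 = 0"
| "tim x y (Suc n) = tim x y n + passage (y (Suc n)) (pos x y n)"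

context
  fixes p y :: "nat \<Rightarrow> real \<Rightarrow> real" and x :: real
  assumes reg: "\<And>j. regular_path (y (Suc j))"
    and eq: "\<And>j t. 0 \<le> t \<Longrightarrow> p (Suc j) t = - y (Suc j) t"
    and pos: "\<And>n. 0 < pos x y n"
begin

lemma tim_less_Suc: "tim x y n < tim x y (Suc n)"
  using passage_pos[OF reg pos] by simp

lemma tim_mono: "m \<le> n \<Longrightarrow> tim x y m \<le> tim x y n"
  using lift_Suc_mono_le[of "tim x y"] tim_less_Suc less_imp_le by blast

text \<open>The two claims must be proved together: a passage time is read off the current path, and
  the next path starts from the left limit at that time. Positivity of all \<open>pos\<close>
  excludes restarts at 0, so the sequence of times is strictly increasing.\<close>

lemma tau_S_tilde:
  "tau p x n = ereal (tim x y n) \<and>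
    (\<forall>t\<ge>tim x y n. S_tilde p x (Suc n) t = pos x y n - y (Suc n) (t - tim x y n))"
proof (induction n)
  case 0
  then show ?case using eq[of _ 0] by simp
next
  case (Suc n)
  let ?\<tau> = "tim x y (Suc n)"
  \<comment> \<open>The passage over a positive level takes positive time, so the strict bound s >
    \<open>tau p x n\<close> in the definition is automatic for s \<ge>
    \<open>?\<tau>\<close>.\<close>
  have "{ereal s |s. tau p x n < ereal s \<and> S_tilde p x (Suc n) s \<le> 0} = {ereal s |s. ?\<tau> \<le> s}"
  proof (intro Collect_cong ex_cong1 conj_cong refl)
    fix s
    show "tau p x n < ereal s \<and> S_tilde p x (Suc n) s \<le> 0 \<longleftrightarrow> ?\<tau> \<le> s"
      using Suc tim_less_Suc[of n] passage_le_iff[OF reg pos, of n n "s - tim x y n"]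
      by (cases "tim x y n < s") auto
  qed
  then have tau: "tau p x (Suc n) = Inf {ereal s |s. ?\<tau> \<le> s}" by simp
  also have "\<dots> = ereal ?\<tau>"
    by (rule antisym) (auto intro!: Inf_lower Inf_greatest)
  finally have tau: "tau p x (Suc n) = ereal ?\<tau>" .
  have "((\<lambda>s. pos x y n - y (Suc n) (s - tim x y n)) \<longlongrightarrow> pos x y n - undershoot (y (Suc n)) (pos x y n)) (at_left ?\<tau>)"
  proof (intro tendsto_diff tendsto_const)
    have "filterlim (\<lambda>s. s - tim x y n) (at_left (passage (y (Suc n)) (pos x y n))) (at_left ?\<tau>)"
      unfolding filterlim_at by (auto intro!: tendsto_eq_intros simp: eventually_at_filter)
    then show "((\<lambda>s. y (Suc n) (s - tim x y n)) \<longlongrightarrow> undershoot (y (Suc n)) (pos x y n)) (at_left ?\<tau>)"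
      by (rule filterlim_compose[OF tendsto_undershoot[OF reg pos]])
  qed
  moreover have "\<forall>\<^sub>F s in at_left ?\<tau>. pos x y n - y (Suc n) (s - tim x y n) = S_tilde p x (Suc n) s"
    using tim_less_Suc[of n] Suc by (intro eventually_at_leftI[of "tim x y n"]) auto
  ultimately have "(S_tilde p x (Suc n) \<longlongrightarrow> pos x y (Suc n)) (at_left ?\<tau>)"
    by (auto intro: Lim_transform_eventually)
  then have "Lim (at_left ?\<tau>) (S_tilde p x (Suc n)) = pos x y (Suc n)"
    by (intro tendsto_Lim) auto
  then show ?case
    using tau eq[of _ "Suc n"] by (simp del: tim.simps pos.simps tau.simps)
qed

text \<open>At most one summand survives: earlier pieces have already crossed 0, where f vanishes,
  and later ones have not begun. If infinitely many restarts occur by time t, all summands vanish,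
  in agreement with the cemetery state; so finite and infinite lifetimes are covered by one
  formula.\<close>

lemma extend_cemetery_censored_path:
  fixes f :: "real \<Rightarrow> real"
  assumes f: "\<And>z. z \<le> 0 \<Longrightarrow> f z = 0" and t: "0 \<le> t"
  shows "ennreal (extend_cemetery f (censored_path p x t))
    = (\<Sum>n. if tim x y n \<le> t then ennreal (f (pos x y n - y (Suc n) (t - tim x y n))) else 0)"
proof -
  note ts = tau_S_tilde[THEN conjunct1] tau_S_tilde[THEN conjunct2, rule_format]
  have x: "x \<noteq> 0" using pos[of 0] by simp
  have zero: "f (pos x y m - y (Suc m) (t - tim x y m)) = 0" if "tim x y (Suc m) \<le> t" for m
    using that passage_le_iff[OF reg pos, of m m "t - tim x y m"] by (intro f) auto
  have inf: "ereal t < tau_inf p x \<longleftrightarrow> (\<exists>j. t < tim x y j)"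
  proof -
    have "incseq (\<lambda>j. ereal (tim x y j))" using tim_mono by (auto simp: incseq_def)
    from limI[OF LIMSEQ_SUP[OF this]] have "tau_inf p x = (SUP j. ereal (tim x y j))"
      unfolding tau_inf_def ts(1) .
    then show ?thesis by (simp add: less_SUP_iff)
  qed
  show ?thesis
  proof (cases "\<exists>j. t < tim x y j")
    case True
    define j where "j = (LEAST j. t < tim x y j)"
    have j: "t < tim x y j" using True unfolding j_def by (rule LeastI_ex)
    then have "j \<noteq> 0" using t by (cases j) auto
    then obtain n where n: "j = Suc n" by (cases j) auto
    have low: "tim x y n \<le> t" using not_less_Least[of n "\<lambda>j. t < tim x y j"] n j_def by simp
    have "(LEAST j. 1 \<le> j \<and> tau p x (j - 1) \<le> ereal t \<and> ereal t < tau p x j) = Suc n"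
    proof (rule Least_equality)
      show "1 \<le> Suc n \<and> tau p x (Suc n - 1) \<le> ereal t \<and> ereal t < tau p x (Suc n)"
        using low j by (simp add: ts(1) n del: tim.simps tau.simps)
      fix i assume "1 \<le> i \<and> tau p x (i - 1) \<le> ereal t \<and> ereal t < tau p x i"
      then have "t < tim x y i" by (simp add: ts(1) del: tim.simps tau.simps)
      then show "Suc n \<le> i" unfolding n[symmetric] j_def by (rule Least_le)
    qed
    then have "censored_path p x t = Some (pos x y n - y (Suc n) (t - tim x y n))"
      unfolding censored_path_def using x inf True ts(2)[OF low] by (simp del: S_tilde.simps)
    moreover have "(\<Sum>m. if tim x y m \<le> t then ennreal (f (pos x y m - y (Suc m) (t - tim x y m))) else 0)
       = (\<Sum>m\<in>{n}. if tim x y m \<le> t then ennreal (f (pos x y m - y (Suc m) (t - tim x y m))) else 0)"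
    proof (rule suminf_finite)
      fix m assume "m \<notin> {n}"
      then consider "Suc m \<le> n" | "Suc n \<le> m" by force
      then show "(if tim x y m \<le> t then ennreal (f (pos x y m - y (Suc m) (t - tim x y m))) else 0) = 0"
      proof cases
        case 1
        then have "tim x y (Suc m) \<le> t" using tim_mono[of "Suc m" n] low by linarith
        then show ?thesis using zero by simp
      next
        case 2
        then have "t < tim x y m" using tim_mono[OF 2] j[unfolded n] by linarith
        then show ?thesis by simp
      qed
    qed simp
    ultimately show ?thesis using low by (simp add: extend_cemetery_def)
  next
    case False
    then have le: "tim x y m \<le> t" for m by (simp add: not_less)
    have "censored_path p x t = None" unfolding censored_path_def using x inf False by simp
    then show ?thesis using zero[OF le] le by (simp add: extend_cemetery_def)
  qed
qed

end

section \<open>Regular versions as measurable functions of raw paths\<close>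

abbreviation Raw :: "(real \<Rightarrow> real) measure" where
  "Raw \<equiv> PiM {0..} (\<lambda>_. borel)"

text \<open>The increasing, right-continuous path that extends \<open>- p\<close> from the rationals; paths for which
  this fails are replaced by the identity.\<close>

definition good_skeleton :: "(real \<Rightarrow> real) \<Rightarrow> bool" where
  "good_skeleton p \<longleftrightarrow>
     (\<forall>q r::rat. 0 \<le> q \<and> q \<le> r \<longrightarrow> 0 \<le> - p (of_rat q) \<and> - p (of_rat q) \<le> - p (of_rat r)) \<and>
     (\<forall>n::nat. \<exists>q::rat. 0 < q \<and> - p (of_rat q) < 1 / real (Suc n)) \<and>
     (\<forall>n::nat. \<exists>q::rat. 0 \<le> q \<and> real n \<le> - p (of_rat q))"

definition reg_path :: "(real \<Rightarrow> real) \<Rightarrow> real \<Rightarrow> real" where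
  "reg_path p t = (if good_skeleton p then if t < 0 then 0 else INF q\<in>{q::rat. t < of_rat q}. - p (of_rat q)
     else max t 0)"

lemma le_reg_path_iff:
  assumes "good_skeleton p" "0 \<le> t"
  shows "c \<le> reg_path p t \<longleftrightarrow> (\<forall>q::rat. t < of_rat q \<longrightarrow> c \<le> - p (of_rat q))"
proof -
  obtain q :: rat where "t < of_rat q" using of_rat_dense[of t "t + 1"] by auto
  then have ne: "{q::rat. t < of_rat q} \<noteq> {}" by blast
  have bdd: "bdd_below ((\<lambda>q. - p (of_rat q)) ` {q::rat. t < of_rat q})"
  proof (rule bdd_belowI2[where m = 0])
    fix q :: rat assume "q \<in> {q. t < of_rat q}"
    then have "(0::real) \<le> of_rat q" using assms(2) by (auto simp del: zero_le_of_rat_iff)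
    then have "0 \<le> q" by simp
    then show "0 \<le> - p (of_rat q)" using assms(1) unfolding good_skeleton_def by blast
  qed
  show ?thesis
    using assms le_cINF_iff[OF ne bdd, of c] by (simp add: reg_path_def)
qed

text \<open>Regularity for every p, not only for almost every one, is the purpose of the
  construction. As only rational coordinates of p are consulted, the result depends measurably on p
  in the product space.\<close>

lemma regular_reg_path: "regular_path (reg_path p)"
proof (cases "good_skeleton p")
  case False
  have "(\<lambda>t. reg_path p t) = (\<lambda>t. max t 0)" using False by (simp add: reg_path_def)
  moreover have "continuous (at_right t) (\<lambda>t::real. max t 0)" for t by (intro continuous_intros)
  moreover have "\<exists>t. a \<le> max t 0" for a :: real by (rule exI[of _ a]) simp
  ultimately show ?thesis by (simp add: regular_path_def monoI)
next
  case good: True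
  note le = le_reg_path_iff[OF good]
  have skel: "0 \<le> - p (of_rat q)" "q \<le> r \<Longrightarrow> - p (of_rat q) \<le> - p (of_rat r)" if "0 \<le> q" for q r :: rat
    using good that unfolding good_skeleton_def by blast+
  have neg: "reg_path p t = 0" if "t < 0" for t using good that by (simp add: reg_path_def)
  have ge0: "0 \<le> reg_path p t" if "0 \<le> t" for t
    unfolding le[OF that]
  proof (intro allI impI)
    fix q :: rat assume "t < of_rat q"
    with that have "(0::real) \<le> of_rat q" by linarith
    then show "0 \<le> - p (of_rat q)" by (intro skel(1)) simp
  qed
  have zero: "reg_path p 0 = 0"
  proof (rule antisym[OF _ ge0])
    show "reg_path p 0 \<le> 0"
    proof (rule field_le_epsilon)
      fix e :: real assume "0 < e"
      then obtain n where n: "1 / real (Suc n) < e" using reals_Archimedean[of e] by (auto simp: inverse_eq_divide)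
      obtain q :: rat where q: "0 < q" "- p (of_rat q) < 1 / real (Suc n)" using good unfolding good_skeleton_def by blast
      have "reg_path p 0 \<le> - p (of_rat q)" using le[of 0 "reg_path p 0"] q by auto
      then show "reg_path p 0 \<le> 0 + e" using n q by simp
    qed
  qed simp
  have mono: "reg_path p s \<le> reg_path p t" if "s \<le> t" for s t
  proof (cases "0 \<le> s")
    case True
    then show ?thesis using le[of t "reg_path p s"] le[of s "reg_path p s"] that by auto
  next
    case False
    then show ?thesis using neg[of s] neg[of t] ge0[of t] by (cases "0 \<le> t") auto
  qed
  show ?thesis
    unfolding regular_path_def
  proof (intro conjI allI impI)
    show "mono (reg_path p)" using mono by (rule monoI)
    show "reg_path p t = 0" if "t \<le> 0" for t using that neg zero by (cases "t = 0") auto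
    show "\<exists>t. a \<le> reg_path p t" for a
    proof -
      obtain n :: nat where n: "a \<le> real n" using real_arch_simple by blast
      obtain q :: rat where q: "0 \<le> q" "real n \<le> - p (of_rat q)" using good unfolding good_skeleton_def by blast
      have "real n \<le> reg_path p (of_rat q)"
        using q skel(2)[of q] by (subst le) (auto simp: of_rat_less intro: order_trans less_imp_le)
      then show ?thesis using n order_trans by blast
    qed
    show "continuous (at_right t) (reg_path p)" for t
      unfolding continuous_within
    proof (rule order_tendstoI)
      fix a assume "a < reg_path p t"
      then show "\<forall>\<^sub>F s in at_right t. a < reg_path p s"
        unfolding eventually_at_right_field
        using mono by (intro exI[of _ "t + 1"]) (auto intro: less_le_trans)
    next
      fix a assume a: "reg_path p t < a"
      show "\<forall>\<^sub>F s in at_right t. reg_path p s < a"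
      proof (cases "0 \<le> t")
        case True
        then obtain q :: rat where q: "t < of_rat q" "- p (of_rat q) < a"
          using le[of t a] a by (auto simp: not_le)
        have "reg_path p s < a" if "t < s" "s < of_rat q" for s
          using le[of s "reg_path p s"] that q True by force
        then show ?thesis using q by (auto simp: eventually_at_right_field)
      next
        case False
        then show ?thesis using a neg by (auto simp: eventually_at_right_field intro!: exI[of _ 0])
      qed
    qed
  qed
qed

lemma reg_path_eq:
  assumes y: "regular_path (\<lambda>t. if t < 0 then 0 else - p t)" and t: "0 \<le> t"
  shows "reg_path p t = - p t"
proof -
  let ?y = "\<lambda>t. if t < 0 then 0 else - p t"
  note D = regular_pathD[OF y]
  have mono: "- p r \<le> - p s" if "0 \<le> r" "r \<le> s" for r s using D(1)[of r s] that by auto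
  have right: "\<exists>q::rat. s < of_rat q \<and> - p (of_rat q) < c" if "- p s < c" "0 \<le> s" for s c
  proof -
    have "?y s < c" using that by simp
    then obtain q where q: "q \<in> \<rat>" "s < q" "?y q < c" using regular_path_less_right[OF y] by blast
    then obtain r :: rat where r: "q = of_rat r" by (auto elim: Rats_cases)
    have "\<not> q < 0" using q that by simp
    then show ?thesis using q r by (intro exI[of _ r]) (simp del: of_rat_less_0_iff)
  qed
  have good: "good_skeleton p"
    unfolding good_skeleton_def
  proof (intro conjI allI impI)
    fix q r :: rat assume "0 \<le> q \<and> q \<le> r"
    then show "- p (of_rat q) \<le> - p (of_rat r)" by (intro mono) (auto simp: of_rat_less_eq)
    show "0 \<le> - p (of_rat q)" using D(3)[of "of_rat q"] \<open>0 \<le> q \<and> q \<le> r\<close> by (simp add: of_rat_less split: if_splits)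
  next
    fix n :: nat
    show "\<exists>q::rat. 0 < q \<and> - p (of_rat q) < 1 / real (Suc n)"
      using right[of 0 "1 / real (Suc n)"] D(2)[of 0] by auto
    obtain s where s: "real n \<le> ?y s" using D(4) by blast
    obtain q :: rat where q: "max s 0 < of_rat q" using of_rat_dense[of "max s 0" "max s 0 + 1"] by auto
    have "real n \<le> - p (of_rat q)" using s D(1)[of s "of_rat q"] q by (auto split: if_splits)
    moreover have "(0::real) \<le> of_rat q" using max.cobounded2[of 0 s] q by linarith
    then have "0 \<le> q" by simp
    ultimately show "\<exists>q::rat. 0 \<le> q \<and> real n \<le> - p (of_rat q)" by blast
  qed
  show ?thesis
  proof (rule antisym)
    show "- p t \<le> reg_path p t" unfolding le_reg_path_iff[OF good t] using mono t by auto
    show "reg_path p t \<le> - p t"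
    proof (rule ccontr)
      assume "\<not> reg_path p t \<le> - p t"
      then obtain q :: rat where q: "t < of_rat q" "- p (of_rat q) < reg_path p t" using right[of t "reg_path p t"] t by auto
      then show False using le_reg_path_iff[OF good t, of "reg_path p t"] by force
    qed
  qed
qed

lemma measurable_Raw_apply: "(\<lambda>p. p i) \<in> borel_measurable Raw"
proof (cases "0 \<le> i")
  case True
  then show ?thesis by (intro measurable_component_singleton) simp
next
  case False
  \<comment> \<open>Elements of the product space are extensional, so a coordinate at a negative
    time is a constant function of p.\<close>
  then have "p i = undefined" if "p \<in> space Raw" for p
    using that by (auto simp: space_PiM PiE_def extensional_def)
  then show ?thesis by (subst measurable_cong[where g = "\<lambda>_. undefined"]) auto
qed

lemma measurable_good_skeleton [measurable]: "Measurable.pred Raw good_skeleton"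
proof -
  note [measurable] = measurable_Raw_apply
  have [measurable]: "Measurable.pred Raw (\<lambda>p. - p a \<le> - p b)" for a b
    unfolding pred_def by (intro borel_measurable_le borel_measurable_uminus measurable_Raw_apply)
  show ?thesis unfolding good_skeleton_def[abs_def] by measurable
qed

lemma measurable_reg_path: "(\<lambda>p. reg_path p t) \<in> borel_measurable Raw"
proof (subst borel_measurable_iff_ge, intro allI)
  note [measurable] = measurable_Raw_apply
  fix c :: real
  have "{p \<in> space Raw. c \<le> reg_path p t} = {p \<in> space Raw. if good_skeleton p
      then if t < 0 then c \<le> 0 else (\<forall>q::rat. t < of_rat q \<longrightarrow> c \<le> - p (of_rat q)) else c \<le> max t 0}"
  proof (intro Collect_cong conj_cong refl)
    fix p
    show "c \<le> reg_path p t \<longleftrightarrow> (if good_skeleton p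
      then if t < 0 then c \<le> 0 else (\<forall>q::rat. t < of_rat q \<longrightarrow> c \<le> - p (of_rat q)) else c \<le> max t 0)"
      by (cases "t < 0") (simp_all add: le_reg_path_iff not_less, simp_all add: reg_path_def)
  qed
  also have "\<dots> \<in> sets Raw" by measurable
  finally show "{p \<in> space Raw. c \<le> reg_path p t} \<in> sets Raw" .
qed

lemma measurable_reg_path_raw [measurable (raw)]:
  assumes "f \<in> borel_measurable N" "g \<in> N \<rightarrow>\<^sub>M Raw"
  shows "(\<lambda>x. reg_path (g x) (f x)) \<in> borel_measurable N"
    "(\<lambda>x. passage (reg_path (g x)) (f x)) \<in> borel_measurable N"
    "(\<lambda>x. undershoot (reg_path (g x)) (f x)) \<in> borel_measurable N"
  using measurable_compose[OF measurable_Pair[OF assms] measurable_regular_path[OF measurable_reg_path regular_reg_path]]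
    measurable_compose[OF measurable_Pair[OF assms] measurable_passage[OF measurable_reg_path regular_reg_path]]
    measurable_compose[OF measurable_Pair[OF assms] measurable_undershoot[OF measurable_reg_path regular_reg_path]]
  by simp_all

section \<open>Regularisation of stable subordinators\<close>

context
  fixes M :: "'a measure" and X :: "real \<Rightarrow> 'a \<Rightarrow> real" and \<beta> :: real
  assumes st: "stable_subordinator M \<beta> X" and \<beta>: "0 < \<beta>" "\<beta> < 1"
begin

interpretation prob_space M
  using st by (simp add: stable_subordinator_def levy_process_def)

lemma stable_measurable: "0 \<le> t \<Longrightarrow> X t \<in> borel_measurable M"
  using st by (simp add: stable_subordinator_def levy_process_def)

text \<open>Integrability follows from the stated value: a non-integrable function would have
  integral 0 by convention, but the exponential on the right is positive.\<close>

lemma stable_laplace: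
  assumes "0 < k" "0 < s"
  shows "integrable M (\<lambda>\<omega>. exp (- k * X s \<omega>))" "expectation (\<lambda>\<omega>. exp (- k * X s \<omega>)) = exp (- s * k powr \<beta>)"
proof -
  show e: "expectation (\<lambda>\<omega>. exp (- k * X s \<omega>)) = exp (- s * k powr \<beta>)"
    using st assms unfolding stable_subordinator_def by blast
  show "integrable M (\<lambda>\<omega>. exp (- k * X s \<omega>))"
  proof (rule ccontr)
    assume "\<not> integrable M (\<lambda>\<omega>. exp (- k * X s \<omega>))"
    then show False using e not_integrable_integral_eq[of M "\<lambda>\<omega>. exp (- k * X s \<omega>)"] by simp
  qed
qed

text \<open>A Chernoff bound with two uses: with a < 0 and k tending to infinity it gives
  nonnegative values, with k = 1 and s tending to infinity it gives unbounded paths.\<close>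

lemma stable_exp_bound:
  assumes k: "0 < k" and s: "0 < s"
  shows "exp (- k * a) * prob {\<omega>\<in>space M. X s \<omega> \<le> a} \<le> exp (- s * k powr \<beta>)"
proof -
  note [measurable] = stable_measurable[OF less_imp_le[OF s]]
  have "exp (- k * a) * prob {\<omega>\<in>space M. X s \<omega> \<le> a} = expectation (\<lambda>\<omega>. exp (- k * a) * indicator {\<omega>\<in>space M. X s \<omega> \<le> a} \<omega>)"
    using s by simp
  also have "\<dots> \<le> expectation (\<lambda>\<omega>. exp (- k * X s \<omega>))"
  proof (rule integral_mono)
    show "integrable M (\<lambda>\<omega>. exp (- k * a) * indicator {\<omega>\<in>space M. X s \<omega> \<le> a} \<omega>)"
      by (intro integrable_mult_right integrable_real_indicator) (auto simp: less_top[symmetric])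
  qed (use k stable_laplace(1)[OF k s] in \<open>auto simp: indicator_def\<close>)
  finally show ?thesis using stable_laplace(2)[OF k s] by simp
qed

lemma stable_zero: "AE \<omega> in M. X 0 \<omega> = 0"
  using st unfolding stable_subordinator_def levy_process_def by blast

lemma stable_nonneg:
  assumes "0 \<le> t"
  shows "AE \<omega> in M. 0 \<le> X t \<omega>"
proof (cases "t = 0")
  case True
  then show ?thesis using stable_zero by auto
next
  case False
  then have t: "0 < t" using assms by simp
  note [measurable] = stable_measurable[OF assms]
  have "prob {\<omega>\<in>space M. X t \<omega> \<le> - (1 / real (Suc n))} = 0" for n
  proof -
    let ?p = "prob {\<omega>\<in>space M. X t \<omega> \<le> - (1 / real (Suc n))}"
    have "?p \<le> exp (- (1 / real (Suc n) * k))" if "0 < k" for k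
    proof -
      have "exp (1 / real (Suc n) * k) * ?p \<le> exp (- t * k powr \<beta>)"
        using stable_exp_bound[OF that t, of "- (1 / real (Suc n))"] by (simp add: mult.commute)
      also have "\<dots> \<le> 1" using t by simp
      finally show ?thesis by (simp add: exp_minus field_simps)
    qed
    moreover have "((\<lambda>k. exp (- (1 / real (Suc n) * k))) \<longlongrightarrow> 0) at_top"
      by (intro filterlim_compose[OF exp_at_bot] filterlim_compose[OF filterlim_uminus_at_bot_at_top]
        filterlim_tendsto_pos_mult_at_top[OF tendsto_const] filterlim_ident) simp
    moreover have "\<forall>\<^sub>F k in at_top. ?p \<le> exp (- (1 / real (Suc n) * k))"
      using eventually_gt_at_top[of 0] by eventually_elim (rule calculation(1))
    ultimately have "?p \<le> 0" by (intro tendsto_lowerbound[where F = at_top]) auto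
    then show ?thesis using measure_nonneg[of M] by (simp add: antisym)
  qed
  then have "AE \<omega> in M. \<forall>n. \<not> X t \<omega> \<le> - (1 / real (Suc n))"
  proof (subst AE_all_countable, intro allI)
    fix n
    assume "\<And>n. prob {\<omega>\<in>space M. X t \<omega> \<le> - (1 / real (Suc n))} = 0"
    then have "AE \<omega> in M. \<omega> \<notin> {\<omega>\<in>space M. X t \<omega> \<le> - (1 / real (Suc n))}"
      by (subst prob_eq_0[symmetric]) auto
    then show "AE \<omega> in M. \<not> X t \<omega> \<le> - (1 / real (Suc n))"
      using AE_space by eventually_elim auto
  qed
  then show ?thesis
  proof eventually_elim
    case (elim \<omega>)
    show ?case
    proof (rule ccontr)
      assume "\<not> 0 \<le> X t \<omega>"
      then obtain n where "inverse (real (Suc n)) < - X t \<omega>" using reals_Archimedean[of "- X t \<omega>"] by auto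
      then show False using elim[rule_format, of n] by (simp add: inverse_eq_divide)
    qed
  qed
qed

lemma stable_increment: "0 \<le> s \<Longrightarrow> 0 \<le> t \<Longrightarrow> distr M borel (\<lambda>\<omega>. X (s + t) \<omega> - X s \<omega>) = distr M borel (X t)"
  using st unfolding stable_subordinator_def levy_process_def by blast

lemma stable_mono:
  assumes "0 \<le> s" "s \<le> t"
  shows "AE \<omega> in M. X s \<omega> \<le> X t \<omega>"
proof -
  note [measurable] = stable_measurable
  have t: "0 \<le> t - s" "0 \<le> t" using assms by auto
  have eq: "distr M borel (\<lambda>\<omega>. X t \<omega> - X s \<omega>) = distr M borel (X (t - s))"
    using stable_increment[of s "t - s"] assms by simp
  have "AE z in distr M borel (X (t - s)). 0 \<le> z"
    using stable_nonneg[OF t(1)] t by (subst AE_distr_iff) auto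
  then have "AE z in distr M borel (\<lambda>\<omega>. X t \<omega> - X s \<omega>). 0 \<le> z"
    unfolding eq .
  then show ?thesis using assms t by (subst (asm) AE_distr_iff) auto
qed

lemma stable_unbounded: "AE \<omega> in M. \<forall>n::nat. \<exists>m::nat. real n < X (real (Suc m)) \<omega>"
proof (subst AE_all_countable, intro allI)
  fix n :: nat
  note [measurable] = stable_measurable
  let ?A = "{\<omega>\<in>space M. \<forall>m::nat. X (real (Suc m)) \<omega> \<le> real n}"
  have A: "?A \<in> events"
    by (rule sets.sets_Collect_countable_All) (use stable_measurable in measurable)
  have "prob ?A \<le> exp (real n) * exp (- real (Suc m))" for m
  proof -
    have "prob ?A \<le> prob {\<omega>\<in>space M. X (real (Suc m)) \<omega> \<le> real n}"
      by (rule finite_measure_mono) (auto simp del: of_nat_Suc)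
    then have "exp (- real n) * prob ?A \<le> exp (- real n) * prob {\<omega>\<in>space M. X (real (Suc m)) \<omega> \<le> real n}"
      by (intro mult_left_mono) auto
    also have "\<dots> \<le> exp (- real (Suc m))"
      using stable_exp_bound[of 1 "real (Suc m)" "real n"] by (simp del: of_nat_Suc)
    finally have "exp (- real n) * prob ?A \<le> exp (- real (Suc m))" .
    then show ?thesis by (simp add: exp_minus field_simps)
  qed
  moreover have "(\<lambda>m. exp (real n) * exp (- real (Suc m))) \<longlonglongrightarrow> exp (real n) * 0"
    by (intro tendsto_intros filterlim_compose[OF exp_at_bot] filterlim_compose[OF filterlim_uminus_at_bot_at_top]
        filterlim_compose[OF filterlim_real_sequentially] filterlim_Suc)
  ultimately have "prob ?A \<le> exp (real n) * 0" using LIMSEQ_le_const by blast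
  then have "prob ?A = 0" using measure_nonneg[of M ?A] by linarith
  then have "AE \<omega> in M. \<omega> \<notin> ?A" using prob_eq_0[OF A] by simp
  then show "AE \<omega> in M. \<exists>m::nat. real n < X (real (Suc m)) \<omega>"
    using AE_space by eventually_elim (auto simp: not_le)
qed

text \<open>Monotonicity holds almost surely for all pairs of rational times at once. A violation at
  real times s < t would persist, by right continuity, at rational times just after s and t.\<close>

lemma stable_regular: "AE \<omega> in M. regular_path (\<lambda>t. if t < 0 then 0 else X t \<omega>)"
proof -
  have "AE \<omega> in M. \<forall>q r::rat. 0 \<le> q \<longrightarrow> q \<le> r \<longrightarrow> X (of_rat q) \<omega> \<le> X (of_rat r) \<omega>"
  proof (subst AE_all_countable, intro allI, subst AE_all_countable, intro allI)
    fix q r :: rat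
    show "AE \<omega> in M. 0 \<le> q \<longrightarrow> q \<le> r \<longrightarrow> X (of_rat q) \<omega> \<le> X (of_rat r) \<omega>"
      using stable_mono[of "of_rat q" "of_rat r"] by (cases "0 \<le> q \<and> q \<le> r") (auto simp: of_rat_less_eq)
  qed
  moreover have "AE \<omega> in M. \<forall>t\<ge>0. continuous (at_right t) (\<lambda>s. X s \<omega>)"
    using st unfolding stable_subordinator_def levy_process_def by auto
  ultimately show ?thesis
    using stable_zero stable_unbounded
  proof eventually_elim
    case (elim \<omega>)
    let ?y = "\<lambda>t. if t < 0 then 0 else X t \<omega>"
    have mono: "X s \<omega> \<le> X t \<omega>" if st: "0 \<le> s" "s \<le> t" for s t
    proof (cases "s = t")
      case False
      have lim: "((\<lambda>s. X s \<omega>) \<longlongrightarrow> X r \<omega>) (at_right r)" if "0 \<le> r" for r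
        using elim(2) that by (simp add: continuous_within)
      show ?thesis
      proof (rule ccontr)
        assume "\<not> X s \<omega> \<le> X t \<omega>"
        then obtain c where c: "X t \<omega> < c" "c < X s \<omega>" using dense[of "X t \<omega>" "X s \<omega>"] by auto
        obtain b where b: "t < b" "\<And>r. t < r \<Longrightarrow> r < b \<Longrightarrow> X r \<omega> < c"
          using order_tendstoD(2)[OF lim[OF order_trans[OF st]] c(1)] unfolding eventually_at_right_field by blast
        obtain a where a: "s < a" "\<And>r. s < r \<Longrightarrow> r < a \<Longrightarrow> c < X r \<omega>"
          using order_tendstoD(1)[OF lim[OF st(1)] c(2)] unfolding eventually_at_right_field by blast
        obtain q :: rat where q: "s < of_rat q" "of_rat q < min a t"
          using of_rat_dense[of s "min a t"] a(1) st False by auto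
        obtain r :: rat where r: "t < of_rat r" "of_rat r < b" using of_rat_dense[OF b(1)] by blast
        have "(0::real) \<le> of_rat q" "(of_rat q :: real) \<le> of_rat r" using q r st by linarith+
        then have "0 \<le> q" "q \<le> r" by (simp_all add: of_rat_less_eq)
        then have "X (of_rat q) \<omega> \<le> X (of_rat r) \<omega>" using elim(1) by blast
        moreover have "c < X (of_rat q) \<omega>" using q by (intro a(2)) auto
        moreover have "X (of_rat r) \<omega> < c" using r by (intro b(2)) auto
        ultimately show False by simp
      qed
    qed simp
    show ?case
      unfolding regular_path_def
    proof (intro conjI allI impI monoI)
      fix s t :: real assume "s \<le> t"
      then show "?y s \<le> ?y t" using mono[of s t] mono[of 0 t] elim(3) by auto
    next
      fix t :: real assume "t \<le> 0"
      then show "?y t = 0" using elim(3) by (cases "t = 0") auto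
    next
      fix a :: real
      obtain n :: nat where n: "a \<le> real n" using real_arch_simple by blast
      obtain m :: nat where "real n < X (real (Suc m)) \<omega>" using elim(4) by blast
      then show "\<exists>t. a \<le> ?y t" using n by (intro exI[of _ "real (Suc m)"]) auto
    next
      fix t :: real
      show "continuous (at_right t) ?y"
      proof (cases "t < 0")
        case True
        have "((\<lambda>s. 0) \<longlongrightarrow> ?y t) (at_right t)" using True by simp
        moreover have "\<forall>\<^sub>F s in at_right t. 0 = ?y s"
          using True by (auto simp: eventually_at_right_field intro!: exI[of _ 0])
        ultimately show ?thesis unfolding continuous_within by (rule Lim_transform_eventually)
      next
        case False
        then have "((\<lambda>s. X s \<omega>) \<longlongrightarrow> ?y t) (at_right t)"
          using elim(2) by (simp add: continuous_within)
        moreover have "\<forall>\<^sub>F s in at_right t. X s \<omega> = ?y s"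
          using False by (auto simp: eventually_at_right_field intro!: exI[of _ "t + 1"])
        ultimately show ?thesis unfolding continuous_within by (rule Lim_transform_eventually)
      qed
    qed
  qed
qed

lemma stable_indep:
  assumes "0 < s" "s < t"
  shows "indep_var borel (\<lambda>\<omega>. X s \<omega> - X 0 \<omega>) borel (\<lambda>\<omega>. X t \<omega> - X s \<omega>)"
proof -
  define tt :: "nat \<Rightarrow> real" where "tt = (\<lambda>i. if i = 0 then 0 else if i = 1 then s else t)"
  have "indep_vars (\<lambda>_. borel) (\<lambda>i \<omega>. X (tt (Suc i)) \<omega> - X (tt i) \<omega>) {..<2}"
  proof -
    have "\<forall>(n::nat) t. 0 \<le> t 0 \<longrightarrow> (\<forall>i<n. t i < t (Suc i)) \<longrightarrow>
        indep_vars (\<lambda>_. borel) (\<lambda>i \<omega>. X (t (Suc i)) \<omega> - X (t i) \<omega>) {..<n}"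
      using st unfolding stable_subordinator_def levy_process_def by blast
    moreover have "0 \<le> tt 0" "\<forall>i<2. tt i < tt (Suc i)" using assms by (auto simp: tt_def less_2_cases_iff)
    ultimately show ?thesis by blast
  qed
  from indep_var_restrict[OF this, of "{0}" "{1}"]
  have "indep_var (PiM {0} (\<lambda>_. borel)) (\<lambda>\<omega>. \<lambda>i\<in>{0}. X (tt (Suc i)) \<omega> - X (tt i) \<omega>)
      (PiM {1} (\<lambda>_. borel)) (\<lambda>\<omega>. \<lambda>i\<in>{1}. X (tt (Suc i)) \<omega> - X (tt i) \<omega>)" by simp
  from indep_var_compose[OF this, of "\<lambda>f. f 0" borel "\<lambda>f. f 1" borel]
  show ?thesis by (simp add: o_def tt_def)
qed

text \<open>Independence of increments is given only over strictly increasing times, so s = 0 and s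
  = t are treated separately. As the path starts at 0 only almost surely, X s is exchanged for the
  increment X s - X 0 up to null sets.\<close>

lemma stable_increments:
  assumes st: "0 \<le> s" "s \<le> t" and [measurable]: "H \<in> borel_measurable (borel \<Otimes>\<^sub>M borel)"
  shows "(\<integral>\<^sup>+\<omega>. H (X s \<omega>, X t \<omega> - X s \<omega>) \<partial>M) = (\<integral>\<^sup>+\<omega>. \<integral>\<^sup>+\<omega>'. H (X s \<omega>, X (t - s) \<omega>') \<partial>M \<partial>M)"
proof -
  have "0 \<le> t" "0 \<le> t - s" using st by auto
  note [measurable] = stable_measurable[OF st(1)] stable_measurable[OF \<open>0 \<le> t\<close>] stable_measurable[OF \<open>0 \<le> t - s\<close>]
    stable_measurable[of 0, simplified]
  consider "s = 0" | "s = t" | "0 < s" "s < t" using st by linarith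
  then show ?thesis
  proof cases
    case 1
    have "(\<integral>\<^sup>+\<omega>. H (X s \<omega>, X t \<omega> - X s \<omega>) \<partial>M) = (\<integral>\<^sup>+\<omega>. H (0, X t \<omega>) \<partial>M)"
      using stable_zero 1 by (intro nn_integral_cong_AE) auto
    moreover have "(\<integral>\<^sup>+\<omega>. \<integral>\<^sup>+\<omega>'. H (X s \<omega>, X (t - s) \<omega>') \<partial>M \<partial>M) = (\<integral>\<^sup>+\<omega>. \<integral>\<^sup>+\<omega>'. H (0, X t \<omega>') \<partial>M \<partial>M)"
      using stable_zero 1 by (intro nn_integral_cong_AE) auto
    ultimately show ?thesis by (simp add: emeasure_space_1)
  next
    case 2
    have "(\<integral>\<^sup>+\<omega>'. H (X s \<omega>, X (t - s) \<omega>') \<partial>M) = (\<integral>\<^sup>+\<omega>'. H (X s \<omega>, 0) \<partial>M)" for \<omega>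
      using stable_zero 2 by (intro nn_integral_cong_AE) auto
    then show ?thesis using 2 by (simp add: emeasure_space_1)
  next
    case 3
    have ind: "distr M borel (\<lambda>\<omega>. X s \<omega> - X 0 \<omega>) \<Otimes>\<^sub>M distr M borel (\<lambda>\<omega>. X t \<omega> - X s \<omega>)
       = distr M (borel \<Otimes>\<^sub>M borel) (\<lambda>\<omega>. (X s \<omega> - X 0 \<omega>, X t \<omega> - X s \<omega>))"
      using stable_indep[OF 3] unfolding indep_var_distribution_eq by blast
    have dV: "distr M borel (\<lambda>\<omega>. X t \<omega> - X s \<omega>) = distr M borel (X (t - s))"
      using stable_increment[of s "t - s"] st by simp
    interpret V: prob_space "distr M borel (X (t - s))" by (rule prob_space_distr) simp
    have "(\<integral>\<^sup>+\<omega>. H (X s \<omega>, X t \<omega> - X s \<omega>) \<partial>M) = (\<integral>\<^sup>+\<omega>. H (X s \<omega> - X 0 \<omega>, X t \<omega> - X s \<omega>) \<partial>M)"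
      using stable_zero by (intro nn_integral_cong_AE) auto
    also have "\<dots> = (\<integral>\<^sup>+q. H q \<partial>(distr M borel (\<lambda>\<omega>. X s \<omega> - X 0 \<omega>) \<Otimes>\<^sub>M distr M borel (X (t - s))))"
      unfolding dV[symmetric] ind by (subst nn_integral_distr) auto
    also have "\<dots> = (\<integral>\<^sup>+u. \<integral>\<^sup>+v. H (u, v) \<partial>distr M borel (X (t - s)) \<partial>distr M borel (\<lambda>\<omega>. X s \<omega> - X 0 \<omega>))"
      by (rule V.nn_integral_fst[symmetric]) simp
    also have "\<dots> = (\<integral>\<^sup>+\<omega>. \<integral>\<^sup>+\<omega>'. H (X s \<omega> - X 0 \<omega>, X (t - s) \<omega>') \<partial>M \<partial>M)"
      by (simp add: nn_integral_distr)
    also have "\<dots> = (\<integral>\<^sup>+\<omega>. \<integral>\<^sup>+\<omega>'. H (X s \<omega>, X (t - s) \<omega>') \<partial>M \<partial>M)"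
      using stable_zero by (intro nn_integral_cong_AE) auto
    finally show ?thesis .
  qed
qed

lemma stable_reg_path:
  assumes W: "\<And>\<omega> t. 0 \<le> t \<Longrightarrow> W \<omega> t = - X t \<omega>"
  shows "AE \<omega> in M. \<forall>t\<ge>0. reg_path (W \<omega>) t = X t \<omega>"
  using stable_regular
proof eventually_elim
  case (elim \<omega>)
  have "(\<lambda>t. if t < 0 then 0 else - W \<omega> t) = (\<lambda>t. if t < 0 then 0 else X t \<omega>)"
    using W by (auto simp: fun_eq_iff)
  then have "regular_path (\<lambda>t. if t < 0 then 0 else - W \<omega> t)" using elim by simp
  then show ?case using reg_path_eq W by simp
qed

lemma regular_subordinator_reg_path:
  assumes W: "\<And>\<omega> t. 0 \<le> t \<Longrightarrow> W \<omega> t = - X t \<omega>" and [measurable]: "W \<in> M \<rightarrow>\<^sub>M Raw"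
  shows "regular_subordinator M (\<lambda>\<omega>. reg_path (W \<omega>)) \<beta>"
proof unfold_locales
  have "AE \<omega> in M. \<forall>t\<ge>0. reg_path (W \<omega>) t = X t \<omega>" by (rule stable_reg_path) (rule W)
  then have eq: "AE \<omega> in M. reg_path (W \<omega>) t = X t \<omega>" if "0 \<le> t" for t
    by eventually_elim (use that in auto)
  show "0 < \<beta>" "\<beta> < 1" by (rule \<beta>)+
  show "(\<lambda>\<omega>. reg_path (W \<omega>) t) \<in> borel_measurable M" for t by measurable
  show "regular_path (reg_path (W \<omega>))" for \<omega> by (rule regular_reg_path)
  show "(\<integral>\<^sup>+\<omega>. ennreal (exp (- (k * reg_path (W \<omega>) t))) \<partial>M) = ennreal (exp (- (t * k powr \<beta>)))"
    if "0 < k" "0 \<le> t" for k t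
  proof (cases "t = 0")
    case True
    then show ?thesis using regular_pathD(2)[OF regular_reg_path, of 0] by (simp add: emeasure_space_1)
  next
    case False
    then have "0 < t" using that by simp
    have "(\<integral>\<^sup>+\<omega>. ennreal (exp (- (k * reg_path (W \<omega>) t))) \<partial>M) = (\<integral>\<^sup>+\<omega>. ennreal (exp (- k * X t \<omega>)) \<partial>M)"
      using eq[OF that(2)] by (intro nn_integral_cong_AE) auto
    also have "\<dots> = ennreal (exp (- t * k powr \<beta>))"
      using stable_laplace[OF \<open>0 < k\<close> \<open>0 < t\<close>] by (subst nn_integral_eq_integral) auto
    finally show ?thesis by simp
  qed
  fix s t :: real and H :: "real \<times> real \<Rightarrow> ennreal"
  assume st: "0 \<le> s" "s \<le> t" and H: "H \<in> borel_measurable (borel \<Otimes>\<^sub>M borel)"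
  have t: "0 \<le> t" "0 \<le> t - s" using st by auto
  have "(\<integral>\<^sup>+\<omega>. H (reg_path (W \<omega>) s, reg_path (W \<omega>) t - reg_path (W \<omega>) s) \<partial>M) = (\<integral>\<^sup>+\<omega>. H (X s \<omega>, X t \<omega> - X s \<omega>) \<partial>M)"
    using eq[OF st(1)] eq[OF t(1)] by (intro nn_integral_cong_AE) auto
  also have "\<dots> = (\<integral>\<^sup>+\<omega>. \<integral>\<^sup>+\<omega>'. H (X s \<omega>, X (t - s) \<omega>') \<partial>M \<partial>M)"
    by (rule stable_increments[OF st H])
  also have "\<dots> = (\<integral>\<^sup>+\<omega>. \<integral>\<^sup>+\<omega>'. H (X s \<omega>, reg_path (W \<omega>') (t - s)) \<partial>M \<partial>M)"
    using eq[OF t(2)] by (intro nn_integral_cong nn_integral_cong_AE) auto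
  also have "\<dots> = (\<integral>\<^sup>+\<omega>. \<integral>\<^sup>+\<omega>'. H (reg_path (W \<omega>) s, reg_path (W \<omega>') (t - s)) \<partial>M \<partial>M)"
    using eq[OF st(1)] by (intro nn_integral_cong_AE) auto
  finally show "(\<integral>\<^sup>+\<omega>. H (reg_path (W \<omega>) s, reg_path (W \<omega>) t - reg_path (W \<omega>) s) \<partial>M)
     = (\<integral>\<^sup>+\<omega>. \<integral>\<^sup>+\<omega>'. H (reg_path (W \<omega>) s, reg_path (W \<omega>') (t - s)) \<partial>M \<partial>M)" .
qed

end

section \<open>The law of the censored process\<close>

text \<open>Applied to the censored process, which coincides with a measurable function only outside
  a null set; this is why its expectation is taken over the completion.\<close>

lemma measurable_completion_AE:
  assumes g: "g \<in> M \<rightarrow>\<^sub>M N" and ae: "AE x in M. f x = g x" and f: "f \<in> space M \<rightarrow> space N"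
  shows "f \<in> completion M \<rightarrow>\<^sub>M N"
proof (rule measurableI)
  fix A assume A: "A \<in> sets N"
  show "f -` A \<inter> space (completion M) \<in> sets (completion M)"
  proof (rule completion.in_sets_AE)
    show "g -` A \<inter> space (completion M) \<in> sets (completion M)"
      using measurable_completion[OF g] A by (rule measurable_sets)
    have "AE x in completion M. f x = g x" using ae by (rule AE_completion)
    then show "AE x in completion M. x \<in> g -` A \<inter> space (completion M) \<longleftrightarrow> x \<in> f -` A \<inter> space (completion M)"
      using AE_space by eventually_elim auto
  qed auto
qed (use f in auto)

locale censored_setup = prob_space M for M :: "'a measure" +
  fixes S :: "nat \<Rightarrow> real \<Rightarrow> 'a \<Rightarrow> real" and \<beta> :: real
  assumes \<beta>01: "0 < \<beta>" "\<beta> < 1" and iid: "iid_neg_stable_subordinators M \<beta> S"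
begin

abbreviation W :: "nat \<Rightarrow> 'a \<Rightarrow> real \<Rightarrow> real" where
  "W j \<equiv> process_path (S j)"

lemma W_nonneg: "0 \<le> t \<Longrightarrow> W j \<omega> t = S j t \<omega>"
  by (simp add: process_path_def)

lemma stable: "1 \<le> j \<Longrightarrow> stable_subordinator M \<beta> (\<lambda>t \<omega>. - S j t \<omega>)"
  using iid unfolding iid_neg_stable_subordinators_def by blast

lemma W_indep: "indep_vars (\<lambda>_. Raw) W {1..}"
  using iid unfolding iid_neg_stable_subordinators_def by blast

lemma W_measurable:
  assumes "1 \<le> j"
  shows "W j \<in> M \<rightarrow>\<^sub>M Raw"
proof -
  have "\<forall>j\<in>{1..}. random_variable Raw (W j)"
    using W_indep unfolding indep_vars_def2 by (rule conjunct1)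
  then show ?thesis by (rule bspec) (use assms in auto)
qed

lemma W_Suc_measurable [measurable]: "W (Suc n) \<in> M \<rightarrow>\<^sub>M Raw"
  by (rule W_measurable) auto

lemma W_distr: "distr M Raw (W (Suc n)) = distr M Raw (W (Suc 0))"
proof -
  have "1 \<le> Suc n" by simp
  then show ?thesis using iid unfolding iid_neg_stable_subordinators_def One_nat_def by blast
qed

sublocale regular_subordinator M "\<lambda>\<omega>. reg_path (W (Suc 0) \<omega>)" \<beta>
proof (rule regular_subordinator_reg_path[OF stable \<beta>01])
  show "1 \<le> Suc 0" by simp
qed (simp add: W_nonneg, rule W_Suc_measurable)

lemma AE_reg_path: "AE \<omega> in M. \<forall>j. \<forall>t\<ge>0. S (Suc j) t \<omega> = - reg_path (W (Suc j) \<omega>) t"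
proof (subst AE_all_countable, intro allI)
  fix j
  have "AE \<omega> in M. \<forall>t\<ge>0. reg_path (W (Suc j) \<omega>) t = - S (Suc j) t \<omega>"
    by (rule stable_reg_path[OF stable \<beta>01]) (simp_all add: W_nonneg)
  then show "AE \<omega> in M. \<forall>t\<ge>0. S (Suc j) t \<omega> = - reg_path (W (Suc j) \<omega>) t"
    by eventually_elim auto
qed

abbreviation paths :: "'a \<Rightarrow> nat \<Rightarrow> real \<Rightarrow> real" where
  "paths \<omega> \<equiv> \<lambda>j. reg_path (W j \<omega>)"

text \<open>The index set is any J containing 1, ..., n, because the induction views the first n
  steps as functions on the larger product.\<close>

lemma measurable_pos_tim_PiM:
  assumes "{Suc 0..n} \<subseteq> J"
  shows "(\<lambda>w. pos x (\<lambda>j. reg_path (w j)) n) \<in> borel_measurable (PiM J (\<lambda>_. Raw))"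
    "(\<lambda>w. tim x (\<lambda>j. reg_path (w j)) n) \<in> borel_measurable (PiM J (\<lambda>_. Raw))"
proof -
  have "(\<lambda>w. pos x (\<lambda>j. reg_path (w j)) n) \<in> borel_measurable (PiM J (\<lambda>_. Raw)) \<and>
    (\<lambda>w. tim x (\<lambda>j. reg_path (w j)) n) \<in> borel_measurable (PiM J (\<lambda>_. Raw))"
    using assms
  proof (induction n)
    case (Suc n)
    then have "Suc n \<in> J" by auto
    then have [measurable]: "(\<lambda>w. w (Suc n)) \<in> PiM J (\<lambda>_. Raw) \<rightarrow>\<^sub>M Raw"
      by (rule measurable_component_singleton)
    have "{Suc 0..n} \<subseteq> J" using Suc.prems by auto
    note [measurable] = Suc.IH[OF this, THEN conjunct1] Suc.IH[OF this, THEN conjunct2]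
    show ?case unfolding pos.simps tim.simps by measurable
  qed simp
  then show "(\<lambda>w. pos x (\<lambda>j. reg_path (w j)) n) \<in> borel_measurable (PiM J (\<lambda>_. Raw))"
    "(\<lambda>w. tim x (\<lambda>j. reg_path (w j)) n) \<in> borel_measurable (PiM J (\<lambda>_. Raw))" by auto
qed

lemma pos_tim_restrict:
  "n \<le> k \<Longrightarrow> pos x (\<lambda>j. reg_path (restrict w {Suc 0..k} j)) n = pos x (\<lambda>j. reg_path (w j)) n \<and>
    tim x (\<lambda>j. reg_path (restrict w {Suc 0..k} j)) n = tim x (\<lambda>j. reg_path (w j)) n"
  by (induction n) auto

lemma measurable_pos_tim [measurable]:
  "(\<lambda>\<omega>. pos x (paths \<omega>) n) \<in> borel_measurable M" "(\<lambda>\<omega>. tim x (paths \<omega>) n) \<in> borel_measurable M"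
proof -
  have A: "(\<lambda>\<omega>. \<lambda>i\<in>{Suc 0..n}. W i \<omega>) \<in> M \<rightarrow>\<^sub>M PiM {Suc 0..n} (\<lambda>_. Raw)"
    using W_measurable by (intro measurable_restrict) auto
  show "(\<lambda>\<omega>. pos x (paths \<omega>) n) \<in> borel_measurable M" "(\<lambda>\<omega>. tim x (paths \<omega>) n) \<in> borel_measurable M"
    using measurable_compose[OF A measurable_pos_tim_PiM(1)[OF subset_refl, of x]]
      measurable_compose[OF A measurable_pos_tim_PiM(2)[OF subset_refl, of x]]
    unfolding pos_tim_restrict[OF order_refl, THEN conjunct1] pos_tim_restrict[OF order_refl, THEN conjunct2] .
qed

text \<open>The Markov property at restarts. Position and time of the n-th restart depend only on
  paths 1, ..., n; path n + 1 is independent of these and has the law of path 1, so it may be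
  replaced by an independent copy of the latter.\<close>

lemma nn_integral_next_path:
  assumes [measurable]: "H \<in> borel_measurable ((borel \<Otimes>\<^sub>M borel) \<Otimes>\<^sub>M Raw)"
  shows "(\<integral>\<^sup>+\<omega>. H ((pos x (paths \<omega>) n, tim x (paths \<omega>) n), W (Suc n) \<omega>) \<partial>M)
    = (\<integral>\<^sup>+\<omega>. \<integral>\<^sup>+\<omega>'. H ((pos x (paths \<omega>) n, tim x (paths \<omega>) n), W (Suc 0) \<omega>') \<partial>M \<partial>M)"
proof -
  let ?P = "PiM {Suc 0..n} (\<lambda>_. Raw)" and ?R = "PiM {Suc n} (\<lambda>_. Raw)"
  let ?A = "\<lambda>\<omega>. \<lambda>i\<in>{Suc 0..n}. W i \<omega>" and ?B = "\<lambda>\<omega>. \<lambda>i\<in>{Suc n}. W i \<omega>"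
  \<comment> \<open>\<open>H\<close> rewritten as a function of the two disjoint blocks of paths,
    the form to which independence of restricted families applies.\<close>
  define G where "G = (\<lambda>(a, b). H ((pos x (\<lambda>j. reg_path (a j)) n, tim x (\<lambda>j. reg_path (a j)) n), b (Suc n)))"
  note [measurable] = measurable_pos_tim_PiM[OF subset_refl, of x n]
  have [measurable]: "(\<lambda>w. w (Suc n)) \<in> ?R \<rightarrow>\<^sub>M Raw"
    by (rule measurable_component_singleton) simp
  have G [measurable]: "G \<in> borel_measurable (?P \<Otimes>\<^sub>M ?R)" unfolding G_def by measurable
  have GA: "G (?A \<omega>, ?B \<omega>') = H ((pos x (paths \<omega>) n, tim x (paths \<omega>) n), W (Suc n) \<omega>')" for \<omega> \<omega>'
    unfolding G_def prod.case pos_tim_restrict[OF order_refl, THEN conjunct1] pos_tim_restrict[OF order_refl, THEN conjunct2]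
    by simp
  have "indep_var ?P ?A ?R ?B"
    by (rule indep_var_restrict[OF W_indep]) auto
  then have [measurable]: "?A \<in> M \<rightarrow>\<^sub>M ?P" "?B \<in> M \<rightarrow>\<^sub>M ?R"
    and ind: "distr M ?P ?A \<Otimes>\<^sub>M distr M ?R ?B = distr M (?P \<Otimes>\<^sub>M ?R) (\<lambda>\<omega>. (?A \<omega>, ?B \<omega>))"
    unfolding indep_var_distribution_eq by blast+
  interpret V: prob_space "distr M ?R ?B" by (rule prob_space_distr) simp
  have "(\<integral>\<^sup>+\<omega>. H ((pos x (paths \<omega>) n, tim x (paths \<omega>) n), W (Suc n) \<omega>) \<partial>M) = (\<integral>\<^sup>+\<omega>. G (?A \<omega>, ?B \<omega>) \<partial>M)"
    unfolding GA ..
  also have "\<dots> = (\<integral>\<^sup>+q. G q \<partial>(distr M ?P ?A \<Otimes>\<^sub>M distr M ?R ?B))"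
    unfolding ind by (subst nn_integral_distr) auto
  also have "\<dots> = (\<integral>\<^sup>+u. \<integral>\<^sup>+v. G (u, v) \<partial>distr M ?R ?B \<partial>distr M ?P ?A)"
    by (rule V.nn_integral_fst[symmetric]) simp
  also have "\<dots> = (\<integral>\<^sup>+\<omega>. \<integral>\<^sup>+\<omega>'. G (?A \<omega>, ?B \<omega>') \<partial>M \<partial>M)"
  proof (subst nn_integral_distr[of ?A M ?P])
    show "(\<lambda>u. \<integral>\<^sup>+v. G (u, v) \<partial>distr M ?R ?B) \<in> borel_measurable (distr M ?P ?A)"
      using V.borel_measurable_nn_integral_fst[of G ?P] G by simp
    show "(\<integral>\<^sup>+\<omega>. \<integral>\<^sup>+v. G (?A \<omega>, v) \<partial>distr M ?R ?B \<partial>M) = (\<integral>\<^sup>+\<omega>. \<integral>\<^sup>+\<omega>'. G (?A \<omega>, ?B \<omega>') \<partial>M \<partial>M)"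
    proof (intro nn_integral_cong nn_integral_distr)
      fix \<omega> assume "\<omega> \<in> space M"
      then have "?A \<omega> \<in> space ?P" by (rule measurable_space[rotated]) measurable
      then show "(\<lambda>v. G (?A \<omega>, v)) \<in> borel_measurable (distr M ?R ?B)" using measurable_Pair2[OF G] by simp
    qed measurable
  qed measurable
  also have "\<dots> = (\<integral>\<^sup>+\<omega>. \<integral>\<^sup>+p. H ((pos x (paths \<omega>) n, tim x (paths \<omega>) n), p) \<partial>distr M Raw (W (Suc n)) \<partial>M)"
    unfolding GA by (simp add: nn_integral_distr)
  also have "\<dots> = (\<integral>\<^sup>+\<omega>. \<integral>\<^sup>+\<omega>'. H ((pos x (paths \<omega>) n, tim x (paths \<omega>) n), W (Suc 0) \<omega>') \<partial>M \<partial>M)"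
    unfolding W_distr[of n] by (simp add: nn_integral_distr)
  finally show ?thesis .
qed

text \<open>There is no creeping: by \<open>passage_law\<close> the probability that the undershoot is strict is
  $\int_0^x \frac{(x-r)^{\beta-1} r^{-\beta}}{\Gamma(\beta)\Gamma(1-\beta)}\,dr = 1$.\<close>

lemma AE_undershoot_less:
  assumes x: "0 < x"
  shows "AE \<omega> in M. undershoot (reg_path (W (Suc 0) \<omega>)) x < x"
proof -
  have "emeasure M {\<omega>\<in>space M. undershoot (reg_path (W (Suc 0) \<omega>)) x < x}
     = (\<integral>\<^sup>+\<omega>. indicator {\<omega>\<in>space M. undershoot (reg_path (W (Suc 0) \<omega>)) x < x} \<omega> \<partial>M)"
    by (rule nn_integral_indicator[symmetric]) measurable
  also have "\<dots> = (\<integral>\<^sup>+\<omega>. (if undershoot (reg_path (W (Suc 0) \<omega>)) x < x then 1 else 0) \<partial>M)"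
    by (intro nn_integral_cong) (auto simp: indicator_def)
  also have "\<dots> = (\<integral>\<^sup>+s. \<integral>\<^sup>+\<omega>. (if 0 \<le> s then pw (1 - \<beta>) (x - reg_path (W (Suc 0) \<omega>) s) else 0) \<partial>M \<partial>lborel)"
    using passage_law[OF x, of "\<lambda>_. 1"] by (simp cong: if_cong)
  also have "\<dots> = (\<integral>\<^sup>+r. pw \<beta> (x - r) * pw (1 - \<beta>) r \<partial>lborel)"
    by (rule potential_conv) simp
  also have "\<dots> = 1"
    using \<beta>01 x by (subst nn_integral_pw_conv) (auto simp: pw_def)
  finally have "emeasure M {\<omega>\<in>space M. undershoot (reg_path (W (Suc 0) \<omega>)) x < x} = 1" .
  then have "prob {\<omega>\<in>space M. undershoot (reg_path (W (Suc 0) \<omega>)) x < x} = 1"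
    by (simp add: measure_def)
  then have "AE \<omega> in M. \<omega> \<in> {\<omega>\<in>space M. undershoot (reg_path (W (Suc 0) \<omega>)) x < x}"
    by (rule AE_prob_1)
  then show ?thesis by eventually_elim auto
qed

text \<open>\<open>AE_undershoot_less\<close> treats a fixed level.
  \<open>nn_integral_next_path\<close> transfers it to the random level
  \<open>pos x (paths \<omega>) n\<close>, which is independent of the next path.\<close>

lemma AE_pos:
  assumes x: "0 < x"
  shows "AE \<omega> in M. 0 < pos x (paths \<omega>) n"
proof (induction n)
  case (Suc n)
  let ?H = "\<lambda>q::(real \<times> real) \<times> (real \<Rightarrow> real). if 0 < fst (fst q) \<and> fst (fst q) \<le> undershoot (reg_path (snd q)) (fst (fst q)) then 1 else (0::ennreal)"
  have H: "?H \<in> borel_measurable ((borel \<Otimes>\<^sub>M borel) \<Otimes>\<^sub>M Raw)" by measurable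
  have "(\<integral>\<^sup>+\<omega>'. ?H ((u, s), W (Suc 0) \<omega>') \<partial>M) = 0" for u s
  proof (cases "0 < u")
    case True
    from AE_undershoot_less[OF this] have "AE \<omega>' in M. ?H ((u, s), W (Suc 0) \<omega>') = 0"
      by eventually_elim auto
    then show ?thesis by (subst nn_integral_0_iff_AE) auto
  qed simp
  then have "(\<integral>\<^sup>+\<omega>. ?H ((pos x (paths \<omega>) n, tim x (paths \<omega>) n), W (Suc n) \<omega>) \<partial>M) = 0"
    by (subst nn_integral_next_path[OF H]) simp
  then have "AE \<omega> in M. ?H ((pos x (paths \<omega>) n, tim x (paths \<omega>) n), W (Suc n) \<omega>) = 0"
    by (subst (asm) nn_integral_0_iff_AE) auto
  then show ?case using Suc.IH by eventually_elim (auto split: if_splits)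
qed (use x in simp)

text \<open>The last restart is integrated out first, which replaces h by \<open>restart h\<close>;
  hence the induction must range over all h.\<close>

lemma nn_integral_pos_tim:
  assumes x: "0 < x" and "case_prod h \<in> borel_measurable (borel \<Otimes>\<^sub>M borel)"
  shows "(\<integral>\<^sup>+\<omega>. (if 0 < pos x (paths \<omega>) n \<and> tim x (paths \<omega>) n \<le> t then h (t - tim x (paths \<omega>) n) (pos x (paths \<omega>) n) else 0) \<partial>M)
    = (if 0 \<le> t then (restart ^^ n) h t x else 0)"
  using assms(2)
proof (induction n arbitrary: h)
  case 0
  then show ?case using x by (simp add: emeasure_space_1)
next
  case (Suc n)
  note [measurable (raw)] = measurable_curried[OF Suc.prems]
  let ?H = "\<lambda>q. if 0 < fst (fst q) - undershoot (reg_path (snd q)) (fst (fst q)) \<and> snd (fst q) + passage (reg_path (snd q)) (fst (fst q)) \<le> t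
    then h (t - (snd (fst q) + passage (reg_path (snd q)) (fst (fst q)))) (fst (fst q) - undershoot (reg_path (snd q)) (fst (fst q))) else 0"
  have H: "?H \<in> borel_measurable ((borel \<Otimes>\<^sub>M borel) \<Otimes>\<^sub>M Raw)" by measurable
  have inner: "(\<integral>\<^sup>+\<omega>'. ?H ((u, s), W (Suc 0) \<omega>') \<partial>M) = (if 0 < u \<and> s \<le> t then restart h (t - s) u else 0)" for u s
  proof (cases "0 < u")
    case True
    have "(\<integral>\<^sup>+\<omega>'. ?H ((u, s), W (Suc 0) \<omega>') \<partial>M) = restart h (t - s) u"
      unfolding restart_eq_passage[OF True Suc.prems]
      by (intro nn_integral_cong) (auto simp: algebra_simps)
    moreover have "restart h (t - s) u = 0" if "\<not> s \<le> t"
      unfolding restart_def using that by (auto intro!: nn_integral_zero' simp: not_le)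
    ultimately show ?thesis using True by auto
  qed simp
  have "(\<integral>\<^sup>+\<omega>. (if 0 < pos x (paths \<omega>) (Suc n) \<and> tim x (paths \<omega>) (Suc n) \<le> t then h (t - tim x (paths \<omega>) (Suc n)) (pos x (paths \<omega>) (Suc n)) else 0) \<partial>M)
    = (\<integral>\<^sup>+\<omega>. ?H ((pos x (paths \<omega>) n, tim x (paths \<omega>) n), W (Suc n) \<omega>) \<partial>M)"
    by (intro nn_integral_cong) simp
  also have "\<dots> = (\<integral>\<^sup>+\<omega>. (if 0 < pos x (paths \<omega>) n \<and> tim x (paths \<omega>) n \<le> t then restart h (t - tim x (paths \<omega>) n) (pos x (paths \<omega>) n) else 0) \<partial>M)"
    unfolding nn_integral_next_path[OF H] inner ..
  also have "\<dots> = (if 0 \<le> t then (restart ^^ n) (restart h) t x else 0)"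
    by (rule Suc.IH[OF measurable_restart2[OF Suc.prems]])
  finally show ?case by (simp add: funpow_swap1)
qed

text \<open>A version of f at the censored process that is measurable for \<open>M\<close> itself
  and whose n-th summand is the contribution of exactly n restarts.\<close>

definition alive_sum :: "(real \<Rightarrow> real) \<Rightarrow> real \<Rightarrow> real \<Rightarrow> 'a \<Rightarrow> ennreal" where
  "alive_sum f x t \<omega> = (\<Sum>n. if tim x (paths \<omega>) n \<le> t
     then ennreal (f (pos x (paths \<omega>) n - reg_path (W (Suc n) \<omega>) (t - tim x (paths \<omega>) n))) else 0)"

lemma measurable_alive_sum [measurable]:
  assumes [measurable]: "f \<in> borel_measurable borel"
  shows "alive_sum f x t \<in> borel_measurable M"
proof -
  show ?thesis unfolding alive_sum_def by measurable
qed

lemma nn_integral_alive_sum: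
  assumes x: "0 < x" and t: "0 \<le> t" and [measurable]: "f \<in> borel_measurable borel"
    and f0: "\<And>z. z \<le> 0 \<Longrightarrow> f z = 0"
  shows "(\<integral>\<^sup>+\<omega>. alive_sum f x t \<omega> \<partial>M) = cens (\<lambda>y. ennreal (f y)) t x"
proof -
  have km: "case_prod (\<lambda>r. kill_op r (\<lambda>y. ennreal (f y))) \<in> borel_measurable (borel \<Otimes>\<^sub>M borel)"
    unfolding kill_op_def by measurable
  have "(\<integral>\<^sup>+\<omega>. alive_sum f x t \<omega> \<partial>M) = (\<Sum>n. \<integral>\<^sup>+\<omega>. (if tim x (paths \<omega>) n \<le> t
     then ennreal (f (pos x (paths \<omega>) n - reg_path (W (Suc n) \<omega>) (t - tim x (paths \<omega>) n))) else 0) \<partial>M)"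
    unfolding alive_sum_def by (rule nn_integral_suminf) measurable
  also have "\<dots> = (\<Sum>n. dyson (\<lambda>y. ennreal (f y)) n t x)"
  proof (rule suminf_cong)
    fix n
    let ?H = "\<lambda>q. if 0 < fst (fst q) \<and> snd (fst q) \<le> t then ennreal (f (fst (fst q) - reg_path (snd q) (t - snd (fst q)))) else 0"
    have H: "?H \<in> borel_measurable ((borel \<Otimes>\<^sub>M borel) \<Otimes>\<^sub>M Raw)" by measurable
    have "(\<integral>\<^sup>+\<omega>. (if tim x (paths \<omega>) n \<le> t
       then ennreal (f (pos x (paths \<omega>) n - reg_path (W (Suc n) \<omega>) (t - tim x (paths \<omega>) n))) else 0) \<partial>M)
      = (\<integral>\<^sup>+\<omega>. ?H ((pos x (paths \<omega>) n, tim x (paths \<omega>) n), W (Suc n) \<omega>) \<partial>M)"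
      using AE_pos[OF x, of n] by (intro nn_integral_cong_AE) auto
    also have "\<dots> = (\<integral>\<^sup>+\<omega>. (if 0 < pos x (paths \<omega>) n \<and> tim x (paths \<omega>) n \<le> t
       then kill_op (t - tim x (paths \<omega>) n) (\<lambda>y. ennreal (f y)) (pos x (paths \<omega>) n) else 0) \<partial>M)"
      unfolding nn_integral_next_path[OF H] kill_op_def by (intro nn_integral_cong) auto
    also have "\<dots> = dyson (\<lambda>y. ennreal (f y)) n t x"
      unfolding nn_integral_pos_tim[OF x km] dyson_def using t by simp
    finally show "(\<integral>\<^sup>+\<omega>. (if tim x (paths \<omega>) n \<le> t
       then ennreal (f (pos x (paths \<omega>) n - reg_path (W (Suc n) \<omega>) (t - tim x (paths \<omega>) n))) else 0) \<partial>M) = dyson (\<lambda>y. ennreal (f y)) n t x" .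
  qed
  finally show ?thesis by (simp add: cens_def)
qed

lemma AE_censored_process:
  assumes x: "0 < x" and t: "0 \<le> t" and f0: "\<And>z. z \<le> 0 \<Longrightarrow> f z = 0"
  shows "AE \<omega> in M. ennreal (extend_cemetery f (censored_process S x t \<omega>)) = alive_sum f x t \<omega>"
proof -
  have "AE \<omega> in M. \<forall>n. 0 < pos x (paths \<omega>) n"
    using AE_pos[OF x] by (subst AE_all_countable) auto
  then show ?thesis
    using AE_reg_path
  proof eventually_elim
    case (elim \<omega>)
    show ?case unfolding censored_process_def alive_sum_def
      by (rule extend_cemetery_censored_path) (use elim f0 t regular_reg_path in auto)
  qed
qed

lemma censored_process_nonneg:
  assumes x: "0 < x" and t: "0 \<le> t" and fm: "f \<in> borel_measurable borel" and f0: "\<And>z. z \<le> 0 \<Longrightarrow> f z = 0"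
    and f: "\<And>z. 0 \<le> f z" "\<And>z. f z \<le> B"
  shows "integrable (completion M) (\<lambda>\<omega>. extend_cemetery f (censored_process S x t \<omega>))"
    and "ennreal (LINT \<omega>|completion M. extend_cemetery f (censored_process S x t \<omega>)) = cens (\<lambda>y. ennreal (f y)) t x"
proof -
  let ?E = "\<lambda>\<omega>. extend_cemetery f (censored_process S x t \<omega>)"
  have ae: "AE \<omega> in M. ennreal (?E \<omega>) = alive_sum f x t \<omega>"
    by (rule AE_censored_process[OF x t]) (rule f0)
  have E0: "0 \<le> ?E \<omega>" for \<omega> using f by (simp add: extend_cemetery_def split: option.split)
  have EB: "?E \<omega> \<le> B" for \<omega> using f order_trans[OF f(1) f(2)] by (simp add: extend_cemetery_def split: option.split)
  have "(\<lambda>\<omega>. enn2real (alive_sum f x t \<omega>)) \<in> borel_measurable M" using fm by measurable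
  moreover have "AE \<omega> in M. ?E \<omega> = enn2real (alive_sum f x t \<omega>)"
    using ae
  proof eventually_elim
    case (elim \<omega>)
    show ?case unfolding elim[symmetric] using E0 by simp
  qed
  ultimately have m: "?E \<in> borel_measurable (completion M)"
    by (rule measurable_completion_AE) simp
  interpret c: prob_space "completion M" by (rule prob_space_completion)
  show int: "integrable (completion M) ?E"
    by (rule c.integrable_const_bound[where B = B]) (use m E0 EB in auto)
  have "ennreal (LINT \<omega>|completion M. ?E \<omega>) = (\<integral>\<^sup>+\<omega>. ennreal (?E \<omega>) \<partial>completion M)"
    using int E0 by (subst nn_integral_eq_integral) auto
  also have "\<dots> = (\<integral>\<^sup>+\<omega>. alive_sum f x t \<omega> \<partial>M)"
    unfolding nn_integral_completion using ae by (rule nn_integral_cong_AE)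
  also have "\<dots> = cens (\<lambda>y. ennreal (f y)) t x"
    using x t fm f0 by (rule nn_integral_alive_sum)
  finally show "ennreal (LINT \<omega>|completion M. ?E \<omega>) = cens (\<lambda>y. ennreal (f y)) t x" .
qed

end

section \<open>The Feller property\<close>

lemma C_infD:
  assumes "f \<in> C_inf T"
  shows "continuous_on {0..T} f" "f 0 = 0" "x \<notin> {0..T} \<Longrightarrow> f x = 0" "x \<le> 0 \<Longrightarrow> f x = 0"
proof -
  show "continuous_on {0..T} f" "f 0 = 0" "x \<notin> {0..T} \<Longrightarrow> f x = 0"
    using assms by (simp_all add: C_inf_def)
  then show "x \<le> 0 \<Longrightarrow> f x = 0" using assms by (cases "x = 0") (auto simp: C_inf_def)
qed

lemma C_infI:
  "continuous_on {0..T} f \<Longrightarrow> f 0 = 0 \<Longrightarrow> (\<And>x. x \<notin> {0..T} \<Longrightarrow> f x = 0) \<Longrightarrow> f \<in> C_inf T"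
  by (simp add: C_inf_def)

lemma C_inf_eqI:
  assumes "f \<in> C_inf T" "g \<in> C_inf T" "\<And>x. x \<in> {0..T} \<Longrightarrow> f x = g x"
  shows "f = g"
proof
  fix x
  show "f x = g x"
    using C_infD(3)[OF assms(1), of x] C_infD(3)[OF assms(2), of x] assms(3)[of x] by (cases "x \<in> {0..T}") auto
qed

lemma C_inf_measurable:
  assumes f: "f \<in> C_inf T"
  shows "f \<in> borel_measurable borel"
proof -
  have "(\<lambda>x. indicator {0..T} x *\<^sub>R f x) \<in> borel_measurable borel"
    by (rule borel_measurable_continuous_on_indicator[OF _ C_infD(1)[OF f]]) simp
  moreover have "(\<lambda>x. indicator {0..T} x *\<^sub>R f x) = f"
  proof
    show "indicator {0..T} x *\<^sub>R f x = f x" for x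
      using C_infD(3)[OF f, of x] by (cases "x \<in> {0..T}") auto
  qed
  ultimately show ?thesis by (simp only:)
qed

lemma C_inf_bounded:
  assumes f: "f \<in> C_inf T"
  obtains B where "0 \<le> B" "\<And>x. \<bar>f x\<bar> \<le> B"
proof -
  have "bounded (f ` {0..T})"
    by (intro compact_imp_bounded compact_continuous_image C_infD(1)[OF f]) simp
  then obtain B where B: "\<forall>x\<in>{0..T}. \<bar>f x\<bar> \<le> B" unfolding bounded_iff by auto
  have "\<bar>f x\<bar> \<le> \<bar>B\<bar>" for x
    using bspec[OF B, of x] C_infD(3)[OF f, of x] by (cases "x \<in> {0..T}") auto
  then show ?thesis using that[of "\<bar>B\<bar>"] by simp
qed

lemma C_inf_lincomb:
  assumes "f \<in> C_inf T" "g \<in> C_inf T"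
  shows "(\<lambda>x. a * f x + b * g x) \<in> C_inf T"
  using assms by (auto simp: C_inf_def intro!: continuous_intros)

lemma C_inf_diff: "f \<in> C_inf T \<Longrightarrow> g \<in> C_inf T \<Longrightarrow> (\<lambda>x. f x - g x) \<in> C_inf T"
  using C_inf_lincomb[of f T g 1 "- 1"] by simp

lemma C_inf_max0: "f \<in> C_inf T \<Longrightarrow> (\<lambda>x. max 0 (f x)) \<in> C_inf T"
  by (auto simp: C_inf_def intro!: continuous_intros)

text \<open>Positive and negative part. It transfers identities between [0,\<infinity>]-valued
  integrals to signed functions by linearity; the last clause keeps sup bounds.\<close>

lemma C_inf_split:
  assumes f: "f \<in> C_inf T"
  obtains g h where "g \<in> C_inf T" "h \<in> C_inf T" "\<And>x. 0 \<le> g x" "\<And>x. 0 \<le> h x" "f = (\<lambda>x. g x - h x)"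
    "\<forall>B. (\<forall>x. \<bar>f x\<bar> \<le> B) \<longrightarrow> (\<forall>x. g x \<le> B \<and> h x \<le> B)"
proof -
  have "(\<lambda>x. - f x) \<in> C_inf T" using C_inf_lincomb[OF f f, of "- 1" 0] by simp
  show ?thesis
  proof (rule that[OF C_inf_max0[OF f] C_inf_max0[OF \<open>(\<lambda>x. - f x) \<in> C_inf T\<close>]])
    show "\<forall>B. (\<forall>x. \<bar>f x\<bar> \<le> B) \<longrightarrow> (\<forall>x. max 0 (f x) \<le> B \<and> max 0 (- f x) \<le> B)"
      by (auto simp: abs_le_iff intro: order_trans[OF abs_ge_zero])
  qed (auto simp: max_def)
qed

text \<open>An element of \<open>C_inf T\<close> jumps to 0 just beyond T unless f T = 0, so it may
  fail to be continuous on the line. Freezing it at f T restores uniform continuity, and by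
  \<open>cens_cong\<close> the change is invisible from starting points up to T.\<close>

definition cut_above :: "real \<Rightarrow> (real \<Rightarrow> real) \<Rightarrow> real \<Rightarrow> real" where
  "cut_above T f y = f (min y T)"

lemma test_fun_cut_above:
  assumes T: "0 < T" and f: "f \<in> C_inf T" "\<And>x. 0 \<le> f x"
  shows "test_fun (cut_above T f)"
  unfolding test_fun_def
proof (intro conjI allI impI)
  show "0 \<le> cut_above T f y" for y using f(2) by (simp add: cut_above_def)
  show "cut_above T f y = 0" if "y \<le> 0" for y
    using that T C_infD(4)[OF f(1)] by (simp add: cut_above_def)
  obtain B where "\<And>x. \<bar>f x\<bar> \<le> B" using C_inf_bounded[OF f(1)] by blast
  then show "\<exists>B. \<forall>y. cut_above T f y \<le> B" by (auto simp: cut_above_def abs_le_iff intro!: exI[of _ B])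
  have u: "uniformly_continuous_on {0..T} f"
    by (intro compact_uniformly_continuous C_infD(1)[OF f(1)]) simp
  have eq: "cut_above T f y = f (max 0 (min y T))" for y
    using T C_infD(4)[OF f(1), of y] C_infD(2)[OF f(1)] by (auto simp: cut_above_def max_def min_def)
  show "uniformly_continuous_on UNIV (cut_above T f)"
    unfolding uniformly_continuous_on_def
  proof (intro allI impI)
    fix e :: real assume "0 < e"
    then obtain d where d: "0 < d" "\<And>x x'. x \<in> {0..T} \<Longrightarrow> x' \<in> {0..T} \<Longrightarrow> dist x' x < d \<Longrightarrow> dist (f x') (f x) < e"
      using u unfolding uniformly_continuous_on_def by blast
    have "dist (cut_above T f x') (cut_above T f x) < e" if "dist x' x < d" for x x'
      unfolding eq by (rule d(2)) (use T that in \<open>auto simp: dist_real_def\<close>)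
    then show "\<exists>d>0. \<forall>x\<in>UNIV. \<forall>x'\<in>UNIV. dist x' x < d \<longrightarrow> dist (cut_above T f x') (cut_above T f x) < e"
      using d(1) by blast
  qed
qed

context regular_subordinator
begin

lemma cens_0:
  assumes f: "f \<in> borel_measurable borel"
  shows "cens f 0 x = f x"
proof -
  have "restart h 0 x = 0" for h
  proof -
    have "restart h 0 x = (\<integral>\<^sup>+(s::real). 0 \<partial>lborel)"
      unfolding restart_def
    proof (rule nn_integral_cong_AE)
      show "AE s in lborel. (\<integral>\<^sup>+\<omega>. (if 0 \<le> s \<and> s \<le> 0 then pw (1 - \<beta>) (x - Y \<omega> s) * h (0 - s) (x - Y \<omega> s) else 0) \<partial>M) = 0"
        using AE_lborel_singleton[of 0]
      proof eventually_elim
        case (elim s)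
        then have "\<not> (0 \<le> s \<and> s \<le> 0)" by auto
        then show ?case unfolding if_not_P[OF \<open>\<not> (0 \<le> s \<and> s \<le> 0)\<close>] by simp
      qed
    qed
    then show ?thesis by simp
  qed
  moreover have "kill_op 0 f x = (\<integral>\<^sup>+\<omega>. f x \<partial>M)"
    unfolding kill_op_def using regular_pathD(2)[OF reg, of _ 0] by (intro nn_integral_cong) simp
  ultimately show ?thesis using cens_eq_kill_op_restart[OF f, of 0 x] by (simp add: emeasure_space_1)
qed

end

section \<open>The semigroup on functions on the interval\<close>

locale censored_interval = censored_setup M S \<beta> for M :: "'a measure" and S \<beta> +
  fixes T :: real
  assumes T: "0 < T"
begin

abbreviation P :: "real \<Rightarrow> (real \<Rightarrow> real) \<Rightarrow> real \<Rightarrow> real" where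
  "P \<equiv> censored_semigroup M S T"

abbreviation P0 :: "(real \<Rightarrow> real) \<Rightarrow> real \<Rightarrow> real \<Rightarrow> ennreal" where
  "P0 f \<equiv> cens (\<lambda>y. ennreal (cut_above T f y))"

lemma P_outside: "x \<notin> {0..T} \<Longrightarrow> P t f x = 0"
  by (simp only: censored_semigroup_def if_False)

lemma process_at_0: "f 0 = 0 \<Longrightarrow> extend_cemetery f (censored_process S 0 t \<omega>) = 0"
  by (simp add: extend_cemetery_def censored_process_def censored_path_def)

lemma P_nonneg_aux:
  assumes f: "f \<in> C_inf T" "\<And>x. 0 \<le> f x" and t: "0 \<le> t" and x: "x \<in> {0..T}"
  shows "integrable (completion M) (\<lambda>\<omega>. extend_cemetery f (censored_process S x t \<omega>))"
    and "ennreal (P t f x) = P0 f t x"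
proof -
  obtain B where B: "\<And>x. \<bar>f x\<bar> \<le> B" using C_inf_bounded[OF f(1)] by blast
  have P: "P t f x = (LINT \<omega>|completion M. extend_cemetery f (censored_process S x t \<omega>))"
    using x by (simp only: censored_semigroup_def if_True)
  have "integrable (completion M) (\<lambda>\<omega>. extend_cemetery f (censored_process S x t \<omega>)) \<and> ennreal (P t f x) = P0 f t x"
  proof (cases "x = 0")
    case True
    have "P0 f t x = 0"
      using True test_funD(4)[OF test_fun_cut_above[OF T f]] by (intro cens_nonpos) auto
    moreover have "P t f x = 0" unfolding P using True process_at_0[of f, OF C_infD(2)[OF f(1)]] by simp
    ultimately show ?thesis unfolding True using process_at_0[of f, OF C_infD(2)[OF f(1)]] by (simp only: integrable_zero) simp
  next
    case False
    then have x0: "0 < x" using x by simp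
    have f': "f z \<le> B" for z using B[of z] by simp
    note E = censored_process_nonneg[where f = f, OF x0 t C_inf_measurable[OF f(1)] C_infD(4)[OF f(1)] f(2) f']
    have "P0 f t x = cens (\<lambda>y. ennreal (f y)) t x"
      using x by (intro cens_cong) (simp add: cut_above_def min_absorb1)
    then show ?thesis using E unfolding P by simp
  qed
  then show "integrable (completion M) (\<lambda>\<omega>. extend_cemetery f (censored_process S x t \<omega>))"
    and "ennreal (P t f x) = P0 f t x" by auto
qed

lemma integrable_process:
  assumes f: "f \<in> C_inf T" and t: "0 \<le> t" and x: "x \<in> {0..T}"
  shows "integrable (completion M) (\<lambda>\<omega>. extend_cemetery f (censored_process S x t \<omega>))"
proof -
  obtain g h where gh: "g \<in> C_inf T" "h \<in> C_inf T" "\<And>x. 0 \<le> g x" "\<And>x. 0 \<le> h x" "f = (\<lambda>x. g x - h x)"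
    using C_inf_split[OF f] by metis
  have "(\<lambda>\<omega>. extend_cemetery f (censored_process S x t \<omega>)) = (\<lambda>\<omega>. extend_cemetery g (censored_process S x t \<omega>) - extend_cemetery h (censored_process S x t \<omega>))"
    unfolding gh(5) by (auto simp: extend_cemetery_def split: option.split)
  then show ?thesis
    using P_nonneg_aux(1)[OF gh(1,3) t x] P_nonneg_aux(1)[OF gh(2,4) t x] by simp
qed

lemma P_lincomb:
  assumes f: "f \<in> C_inf T" and g: "g \<in> C_inf T" and t: "0 \<le> t"
  shows "P t (\<lambda>x. a * f x + b * g x) = (\<lambda>x. a * P t f x + b * P t g x)"
proof
  fix x
  show "P t (\<lambda>x. a * f x + b * g x) x = a * P t f x + b * P t g x"
  proof (cases "x \<in> {0..T}")
    case True
    have "extend_cemetery (\<lambda>x. a * f x + b * g x) y = a * extend_cemetery f y + b * extend_cemetery g y" for y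
      by (auto simp: extend_cemetery_def split: option.split)
    then show ?thesis
      using integrable_process[OF f t True] integrable_process[OF g t True] True
      by (simp add: censored_semigroup_def)
  qed (simp add: P_outside)
qed

lemma P_diff:
  assumes "f \<in> C_inf T" "g \<in> C_inf T" "0 \<le> t"
  shows "P t (\<lambda>x. f x - g x) = (\<lambda>x. P t f x - P t g x)"
  using P_lincomb[OF assms, of 1 "- 1"] by simp

lemma P_abs_le:
  assumes f: "f \<in> C_inf T" and t: "0 \<le> t" and x: "x \<in> {0..T}" and B: "\<And>x. x \<in> {0..T} \<Longrightarrow> \<bar>f x\<bar> \<le> B"
  shows "\<bar>P t f x\<bar> \<le> B"
proof -
  interpret c: prob_space "completion M" by (rule prob_space_completion)
  have B0: "0 \<le> B" using B[of 0] T by simp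
  have "\<bar>f z\<bar> \<le> B" for z using B[of z] C_infD(3)[OF f, of z] B0 by (cases "z \<in> {0..T}") auto
  then have E: "\<bar>extend_cemetery f y\<bar> \<le> B" for y using B0 by (auto simp: extend_cemetery_def split: option.split)
  have "\<bar>P t f x\<bar> \<le> (LINT \<omega>|completion M. \<bar>extend_cemetery f (censored_process S x t \<omega>)\<bar>)"
    using x by (simp add: censored_semigroup_def)
  also have "\<dots> \<le> (LINT \<omega>|completion M. B)"
    using E integrable_process[OF f t x] by (intro integral_mono) auto
  finally show ?thesis by (simp add: prob_space)
qed

lemma P_nonneg: "(\<And>x. x \<in> {0..T} \<Longrightarrow> 0 \<le> f x) \<Longrightarrow> f \<in> C_inf T \<Longrightarrow> 0 \<le> P t f x"
proof (cases "x \<in> {0..T}")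
  case True
  assume "\<And>x. x \<in> {0..T} \<Longrightarrow> 0 \<le> f x" "f \<in> C_inf T"
  then have "0 \<le> f z" for z using C_infD(3)[of f T z] by (cases "z \<in> {0..T}") auto
  then show ?thesis using True
    by (auto simp: censored_semigroup_def extend_cemetery_def intro!: Bochner_Integration.integral_nonneg split: option.split)
qed (simp add: P_outside)

lemma P_eq: "f \<in> C_inf T \<Longrightarrow> (\<And>x. 0 \<le> f x) \<Longrightarrow> 0 \<le> t \<Longrightarrow> x \<in> {0..T} \<Longrightarrow> P t f x = enn2real (P0 f t x)"
  using P_nonneg_aux(2)[of f t x] P_nonneg[of f t x] by (metis enn2real_ennreal)

lemma P_C_inf_nonneg:
  assumes f: "f \<in> C_inf T" "\<And>x. 0 \<le> f x" and t: "0 \<le> t"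
  shows "P t f \<in> C_inf T"
proof (rule C_infI)
  show "continuous_on {0..T} (P t f)"
    using continuous_cens[OF test_fun_cut_above[OF T f] t] by (rule continuous_on_eq) (simp add: P_eq[OF f t])
  have "P0 f t 0 = 0" using test_funD(4)[OF test_fun_cut_above[OF T f]] by (intro cens_nonpos) auto
  then show "P t f 0 = 0" using P_eq[OF f t, of 0] T by simp
qed (rule P_outside)

lemma P_C_inf:
  assumes f: "f \<in> C_inf T" and t: "0 \<le> t"
  shows "P t f \<in> C_inf T"
proof -
  obtain g h where gh: "g \<in> C_inf T" "h \<in> C_inf T" "\<And>x. 0 \<le> g x" "\<And>x. 0 \<le> h x" "f = (\<lambda>x. g x - h x)"
    using C_inf_split[OF f] by metis
  show ?thesis unfolding gh(5) P_diff[OF gh(1,2) t]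
    by (intro C_inf_diff P_C_inf_nonneg gh t)
qed

lemma P0_P:
  assumes f: "f \<in> C_inf T" "\<And>x. 0 \<le> f x" and t: "0 \<le> t" and x: "x \<in> {0..T}"
  shows "P0 (P t f) s x = cens (P0 f t) s x"
proof (rule cens_cong)
  fix y assume "y \<le> x"
  then have y: "min y T = y" "y \<le> T" using x by auto
  show "ennreal (cut_above T (P t f) y) = P0 f t y"
  proof (cases "0 \<le> y")
    case True
    then show ?thesis using y P_nonneg_aux(2)[OF f t, of y] by (simp add: cut_above_def)
  next
    case False
    have "P0 f t y = 0" using False test_funD(4)[OF test_fun_cut_above[OF T f]] by (intro cens_nonpos) auto
    then show ?thesis using False y by (simp add: cut_above_def P_outside)
  qed
qed

lemma P_add_nonneg:
  assumes f: "f \<in> C_inf T" "\<And>x. 0 \<le> f x" and s: "0 \<le> s" and t: "0 \<le> t"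
  shows "P s (P t f) = P (s + t) f"
proof (rule C_inf_eqI[of _ T])
  have Pt: "P t f \<in> C_inf T" "\<And>x. 0 \<le> P t f x" using f t by (auto intro: P_C_inf_nonneg P_nonneg)
  show "P s (P t f) \<in> C_inf T" by (rule P_C_inf_nonneg[OF Pt s])
  show "P (s + t) f \<in> C_inf T" using s t by (intro P_C_inf_nonneg[OF f]) simp
  fix x assume x: "x \<in> {0..T}"
  have m: "(\<lambda>y. ennreal (cut_above T f y)) \<in> borel_measurable borel" by (rule test_funD(7)[OF test_fun_cut_above[OF T f]])
  show "P s (P t f) x = P (s + t) f x"
    using s t x by (simp add: P_eq[OF Pt s] P_eq[OF f] P0_P[OF f t x] cens_add[OF m])
qed

lemma P_add:
  assumes f: "f \<in> C_inf T" and s: "0 \<le> s" and t: "0 \<le> t"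
  shows "P s (P t f) = P (s + t) f"
proof -
  obtain g h where gh: "g \<in> C_inf T" "h \<in> C_inf T" "\<And>x. 0 \<le> g x" "\<And>x. 0 \<le> h x" "f = (\<lambda>x. g x - h x)"
    using C_inf_split[OF f] by metis
  have "P s (P t f) = (\<lambda>x. P s (P t g) x - P s (P t h) x)"
    unfolding gh(5) P_diff[OF gh(1,2) t] by (rule P_diff[OF P_C_inf[OF gh(1) t] P_C_inf[OF gh(2) t] s])
  also have "\<dots> = (\<lambda>x. P (s + t) g x - P (s + t) h x)"
    by (simp add: P_add_nonneg[OF gh(1,3) s t] P_add_nonneg[OF gh(2,4) s t])
  also have "\<dots> = P (s + t) f" unfolding gh(5) using s t by (intro P_diff[OF gh(1,2), symmetric]) simp
  finally show ?thesis .
qed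

lemma P_zero_nonneg:
  assumes f: "f \<in> C_inf T" "\<And>x. 0 \<le> f x"
  shows "P 0 f = f"
proof (rule C_inf_eqI[of _ T])
  show "P 0 f \<in> C_inf T" by (rule P_C_inf_nonneg[OF f]) simp
  fix x assume x: "x \<in> {0..T}"
  have m: "(\<lambda>y. ennreal (cut_above T f y)) \<in> borel_measurable borel" by (rule test_funD(7)[OF test_fun_cut_above[OF T f]])
  show "P 0 f x = f x"
    unfolding P_eq[OF f order_refl x] cens_0[OF m] using x f(2)[of x] by (simp add: cut_above_def min_absorb1)
qed (rule f(1))

lemma P_zero:
  assumes f: "f \<in> C_inf T"
  shows "P 0 f = f"
proof -
  obtain g h where gh: "g \<in> C_inf T" "h \<in> C_inf T" "\<And>x. 0 \<le> g x" "\<And>x. 0 \<le> h x" "f = (\<lambda>x. g x - h x)"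
    using C_inf_split[OF f] by metis
  show ?thesis unfolding gh(5) P_diff[OF gh(1,2) order_refl]
    by (simp add: P_zero_nonneg[OF gh(1,3)] P_zero_nonneg[OF gh(2,4)])
qed

lemma P_strongly_continuous:
  assumes f: "f \<in> C_inf T"
  shows "uniform_limit {0..T} (\<lambda>s. P s f) f (at_right 0)"
proof -
  have nonneg: "uniform_limit {0..T} (\<lambda>s. P s g) g (at_right 0)" if g: "g \<in> C_inf T" "\<And>x. 0 \<le> g x" for g
  proof -
    have "\<forall>\<^sub>F t in at_right (0::real). \<forall>x\<in>{0..T}. enn2real (P0 g t x) = P t g x"
      using eventually_at_right_less[of 0] by eventually_elim (simp add: P_eq[OF g])
    moreover have "cut_above T g x = g x" if "x \<in> {0..T}" for x using that by (simp add: cut_above_def min_absorb1)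
    ultimately show ?thesis
      using strongly_continuous_cens[OF test_fun_cut_above[OF T g], of T] by (subst (asm) uniform_limit_cong)
  qed
  obtain g h where gh: "g \<in> C_inf T" "h \<in> C_inf T" "\<And>x. 0 \<le> g x" "\<And>x. 0 \<le> h x" "f = (\<lambda>x. g x - h x)"
    using C_inf_split[OF f] by metis
  have "uniform_limit {0..T} (\<lambda>s x. P s g x - P s h x) (\<lambda>x. g x - h x) (at_right 0)"
    by (intro uniform_limit_minus nonneg gh)
  moreover have "\<forall>\<^sub>F s in at_right (0::real). \<forall>x\<in>{0..T}. P s g x - P s h x = P s f x"
    using eventually_at_right_less[of 0] by eventually_elim (simp add: gh(5) P_diff[OF gh(1,2)])
  moreover have "g x - h x = f x" for x by (simp add: gh(5))
  ultimately show ?thesis by (subst (asm) uniform_limit_cong)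
qed

lemma sup_norm_ge:
  assumes f: "f \<in> C_inf T" and x: "x \<in> {0..T}"
  shows "\<bar>f x\<bar> \<le> sup_norm T f"
proof -
  obtain B where "\<And>x. \<bar>f x\<bar> \<le> B" using C_inf_bounded[OF f] by blast
  then show ?thesis unfolding sup_norm_def using x by (intro cSUP_upper) (auto intro!: bdd_aboveI[of _ B])
qed

lemma feller_P: "feller_semigroup T P"
  unfolding feller_semigroup_def semigroup_on_def
proof (intro conjI allI impI ballI)
  fix s :: real assume s: "0 \<le> s"
  show "bounded_linear_op T (P s)"
    unfolding bounded_linear_op_def
  proof (intro conjI ballI allI)
    fix f g and c :: real assume f: "f \<in> C_inf T"
    show "P s f \<in> C_inf T" by (rule P_C_inf[OF f s])
    show "P s (\<lambda>x. c * f x) = (\<lambda>x. c * P s f x)" using P_lincomb[OF f f s, of c 0] by simp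
    assume g: "g \<in> C_inf T"
    show "P s (\<lambda>x. f x + g x) = (\<lambda>x. P s f x + P s g x)" using P_lincomb[OF f g s, of 1 1] by simp
  next
    have "sup_norm T (P s f) \<le> 1 * sup_norm T f" if f: "f \<in> C_inf T" for f
    proof -
      have "sup_norm T (P s f) \<le> sup_norm T f"
        unfolding sup_norm_def[of T "P s f"]
        using T P_abs_le[OF f s _ sup_norm_ge[OF f]] by (intro cSUP_least) auto
      then show ?thesis by simp
    qed
    then show "\<exists>B. \<forall>f\<in>C_inf T. sup_norm T (P s f) \<le> B * sup_norm T f" by blast
  qed
next
  fix s t :: real and f assume "0 \<le> s" "0 \<le> t" "f \<in> C_inf T"
  then show "P s (P t f) = P (s + t) f" by (intro P_add)
next
  fix s f x assume s: "0 < (s::real)" and f: "f \<in> C_inf T" and b: "\<forall>x\<in>{0..T}. 0 \<le> f x \<and> f x \<le> 1" and x: "x \<in> {0..T}"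
  show "0 \<le> P s f x" using b f by (intro P_nonneg) auto
  have "\<bar>P s f x\<bar> \<le> 1" using s f x b by (intro P_abs_le) auto
  then show "P s f x \<le> 1" by simp
qed (simp_all add: P_zero P_strongly_continuous)

end

section \<open>Fractional operators as mixtures of dilations\<close>

text \<open>After the substitution \<open>r = x * s\<close> the operators \<open>frac_int\<close> and \<open>K_op\<close> become mixtures of
  dilations, from which linearity and continuity are immediate.\<close>

definition dil :: "(real \<Rightarrow> real) \<Rightarrow> (real \<Rightarrow> real) \<Rightarrow> real \<Rightarrow> real" where
  "dil k f x = (LINT s|lborel. k s * f (x * s))"

definition frac_ker :: "real \<Rightarrow> real \<Rightarrow> real" where
  "frac_ker \<gamma> s = indicator {0<..<1} s * ((1 - s) powr (\<gamma> - 1) / Gamma \<gamma>)"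

definition K_ker :: "real \<Rightarrow> real \<Rightarrow> real" where
  "K_ker \<beta> s = indicator {0<..<1} s * ((1 - s) powr (\<beta> - 1) * s powr (- \<beta>) / (Gamma \<beta> * Gamma (1 - \<beta>)))"

lemma integrable_frac_ker:
  assumes "0 < \<gamma>"
  shows "integrable lborel (frac_ker \<gamma>)"
proof (rule integrableI_nonneg)
  have G: "0 < Gamma \<gamma>" using assms by (rule Gamma_real_pos)
  show "AE s in lborel. 0 \<le> frac_ker \<gamma> s" using G by (simp add: frac_ker_def)
  have "(\<integral>\<^sup>+s. ennreal (frac_ker \<gamma> s) \<partial>lborel) = (\<integral>\<^sup>+s. pw \<gamma> (1 - s) * pw 1 s \<partial>lborel)"
    using G by (intro nn_integral_cong) (auto simp: frac_ker_def pw_def indicator_def ennreal_mult[symmetric])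
  also have "\<dots> < \<infinity>" using assms by (subst nn_integral_pw_conv) (auto simp: pw_def)
  finally show "(\<integral>\<^sup>+s. ennreal (frac_ker \<gamma> s) \<partial>lborel) < \<infinity>" .
qed (simp add: frac_ker_def[abs_def])

lemma integrable_K_ker:
  assumes "0 < \<beta>" "\<beta> < 1"
  shows "integrable lborel (K_ker \<beta>)"
proof (rule integrableI_nonneg)
  have G: "0 < Gamma \<beta>" "0 < Gamma (1 - \<beta>)" using assms by (auto intro!: Gamma_real_pos)
  show "AE s in lborel. 0 \<le> K_ker \<beta> s" using G by (simp add: K_ker_def)
  have "(\<integral>\<^sup>+s. ennreal (K_ker \<beta> s) \<partial>lborel) = (\<integral>\<^sup>+s. pw \<beta> (1 - s) * pw (1 - \<beta>) s \<partial>lborel)"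
    using G by (intro nn_integral_cong) (auto simp: K_ker_def pw_def indicator_def ennreal_mult[symmetric])
  also have "\<dots> < \<infinity>" using assms by (subst nn_integral_pw_conv) (auto simp: pw_def)
  finally show "(\<integral>\<^sup>+s. ennreal (K_ker \<beta> s) \<partial>lborel) < \<infinity>" .
qed (simp add: K_ker_def[abs_def])

lemma integrable_dil:
  assumes k: "integrable lborel k" and f: "f \<in> C_inf T"
  shows "integrable lborel (\<lambda>s. k s * f (x * s))"
proof -
  note [measurable] = borel_measurable_integrable[OF k] C_inf_measurable[OF f]
  obtain B where B: "0 \<le> B" "\<And>x. \<bar>f x\<bar> \<le> B" using C_inf_bounded[OF f] by blast
  show ?thesis
  proof (rule Bochner_Integration.integrable_bound)
    show "integrable lborel (\<lambda>s. B * k s)" using k by simp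
    show "AE s in lborel. norm (k s * f (x * s)) \<le> norm (B * k s)"
      using B mult_right_mono[OF B(2) abs_ge_zero] by (auto simp: abs_mult mult.commute)
  qed measurable
qed

lemma dil_lincomb:
  assumes "integrable lborel k" "f \<in> C_inf T" "g \<in> C_inf T"
  shows "dil k (\<lambda>x. a * f x + b * g x) x = a * dil k f x + b * dil k g x"
proof -
  have "dil k (\<lambda>x. a * f x + b * g x) x = (LINT s|lborel. a * (k s * f (x * s)) + b * (k s * g (x * s)))"
    unfolding dil_def by (intro Bochner_Integration.integral_cong) (auto simp: algebra_simps)
  also have "\<dots> = a * dil k f x + b * dil k g x"
    unfolding dil_def using integrable_dil[OF assms(1,2)] integrable_dil[OF assms(1,3)]
    by (subst Bochner_Integration.integral_add) auto
  finally show ?thesis .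
qed

lemma continuous_dil:
  assumes k: "integrable lborel k" "\<And>s. s \<notin> {0<..<1} \<Longrightarrow> k s = 0" and f: "f \<in> C_inf T"
  shows "continuous_on {0..T} (dil k f)"
  unfolding continuous_on_sequentially
proof (intro allI impI ballI)
  note [measurable] = borel_measurable_integrable[OF k(1)] C_inf_measurable[OF f]
  fix X :: "nat \<Rightarrow> real" and x assume x: "x \<in> {0..T}" and "(\<forall>n. X n \<in> {0..T}) \<and> X \<longlonglongrightarrow> x"
  then have X: "\<And>n. X n \<in> {0..T}" "X \<longlonglongrightarrow> x" by auto
  obtain B where B: "0 \<le> B" "\<And>x. \<bar>f x\<bar> \<le> B" using C_inf_bounded[OF f] by blast
  have "(\<lambda>i. dil k f (X i)) \<longlonglongrightarrow> dil k f x"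
    unfolding dil_def
  proof (rule integral_dominated_convergence[where w = "\<lambda>s. norm (B * k s)"])
    show "AE s in lborel. norm (k s * f (X i * s)) \<le> norm (B * k s)" for i
      using B mult_right_mono[OF B(2) abs_ge_zero] by (auto simp: abs_mult mult.commute)
    have "(\<lambda>i. k s * f (X i * s)) \<longlonglongrightarrow> k s * f (x * s)" for s
    proof (cases "s \<in> {0<..<1}")
      case True
      have in01: "y * s \<in> {0..T}" if "y \<in> {0..T}" for y
        using that True mult_left_le[of s y] by auto
      show ?thesis
        using x X in01 by (intro tendsto_intros continuous_on_tendsto_compose[OF C_infD(1)[OF f]]) auto
    qed (simp add: k(2))
    then show "AE s in lborel. (\<lambda>i. k s * f (X i * s)) \<longlonglongrightarrow> k s * f (x * s)" by simp
  qed (use k in auto)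
  then show "(dil k f \<circ> X) \<longlonglongrightarrow> dil k f x" by (simp add: o_def)
qed

lemma set_integral_scale:
  fixes g :: "real \<Rightarrow> real"
  assumes "0 < x"
  shows "(LBINT r:{0<..<x}. g r) = (LINT s|lborel. indicator {0<..<1} s * (x * g (x * s)))"
proof -
  have "(LBINT r:{0<..<x}. g r) = x * (LINT s|lborel. indicator {0<..<x} (x * s) * g (x * s))"
    unfolding set_lebesgue_integral_def using assms
    by (subst lborel_integral_real_affine[where c = x and t = 0]) auto
  also have "\<dots> = (LINT s|lborel. indicator {0<..<1} s * (x * g (x * s)))"
    unfolding integral_mult_right_zero[symmetric] using assms
    by (intro Bochner_Integration.integral_cong) (auto simp: indicator_def zero_less_mult_iff)
  finally show ?thesis .
qed

lemma frac_int_eq_dil: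
  assumes "0 < \<gamma>" "x \<in> {0..T}"
  shows "frac_int T \<gamma> f x = x powr \<gamma> * dil (frac_ker \<gamma>) f x"
proof (cases "x = 0")
  case False
  then have x: "0 < x" using assms by simp
  have "frac_int T \<gamma> f x = (LINT s|lborel. indicator {0<..<1} s * (x * ((x - x * s) powr (\<gamma> - 1) / Gamma \<gamma> * f (x * s))))"
    using assms x by (simp add: frac_int_def set_integral_scale)
  also have "\<dots> = (LINT s|lborel. x powr \<gamma> * (frac_ker \<gamma> s * f (x * s)))"
  proof (intro Bochner_Integration.integral_cong refl)
    fix s
    show "indicator {0<..<1} s * (x * ((x - x * s) powr (\<gamma> - 1) / Gamma \<gamma> * f (x * s))) = x powr \<gamma> * (frac_ker \<gamma> s * f (x * s))"
    proof (cases "s \<in> {0<..<1}")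
      case True
      have "x - x * s = x * (1 - s)" by (simp add: algebra_simps)
      moreover have "x * x powr (\<gamma> - 1) = x powr \<gamma>" using x powr_add[of x 1 "\<gamma> - 1"] by simp
      ultimately show ?thesis using True x by (simp add: frac_ker_def powr_mult)
    qed (simp add: frac_ker_def)
  qed
  finally show ?thesis by (simp add: dil_def)
qed (use assms in \<open>simp add: frac_int_def\<close>)

text \<open>The powers of x cancel, so \<open>K_op\<close> commutes with dilations. Unlike
  \<open>frac_int\<close> it therefore gains no factor that is small near 0.\<close>

lemma K_op_eq_dil:
  assumes \<beta>: "0 < \<beta>" "\<beta> < 1" and x: "x \<in> {0..T}" and f: "f \<in> C_inf T"
  shows "K_op T \<beta> f x = dil (K_ker \<beta>) f x"
proof (cases "x = 0")
  case True
  then show ?thesis using C_infD(2)[OF f] by (simp add: K_op_def dil_def)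
next
  case False
  then have x0: "0 < x" using x by simp
  have "K_op T \<beta> f x = (LINT s|lborel. indicator {0<..<1} s *
      (x * ((x - x * s) powr (\<beta> - 1) * (x * s) powr (- \<beta>) / (Gamma \<beta> * Gamma (1 - \<beta>)) * f (x * s))))"
    using x x0 False by (simp add: K_op_def set_integral_scale)
  also have "\<dots> = dil (K_ker \<beta>) f x"
    unfolding dil_def
  proof (intro Bochner_Integration.integral_cong refl)
    fix s
    show "indicator {0<..<1} s * (x * ((x - x * s) powr (\<beta> - 1) * (x * s) powr (- \<beta>) / (Gamma \<beta> * Gamma (1 - \<beta>)) * f (x * s)))
      = K_ker \<beta> s * f (x * s)"
    proof (cases "s \<in> {0<..<1}")
      case True
      have "x - x * s = x * (1 - s)" by (simp add: algebra_simps)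
      then have "x * ((x - x * s) powr (\<beta> - 1) * (x * s) powr (- \<beta>))
          = x * (x powr (\<beta> - 1) * x powr (- \<beta>)) * ((1 - s) powr (\<beta> - 1) * s powr (- \<beta>))"
        using True x0 by (simp add: powr_mult mult_ac)
      also have "x * (x powr (\<beta> - 1) * x powr (- \<beta>)) = x * x powr (- 1)"
        by (simp add: powr_add[symmetric])
      also have "\<dots> = 1" using x0 by (simp add: powr_minus)
      finally have "x * ((x - x * s) powr (\<beta> - 1) * (x * s) powr (- \<beta>)) = (1 - s) powr (\<beta> - 1) * s powr (- \<beta>)"
        by simp
      then show ?thesis using True by (simp add: K_ker_def mult.assoc[symmetric])
    qed (simp add: K_ker_def)
  qed
  finally show ?thesis .
qed

lemma frac_int_outside: "x \<notin> {0..T} \<Longrightarrow> frac_int T \<gamma> f x = 0"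
  by (auto simp: frac_int_def)

lemma K_op_outside: "0 < T \<Longrightarrow> x \<notin> {0..T} \<Longrightarrow> K_op T \<beta> f x = 0"
  by (auto simp: K_op_def)

lemma frac_int_C_inf:
  assumes "0 < \<gamma>" and f: "f \<in> C_inf T"
  shows "frac_int T \<gamma> f \<in> C_inf T"
proof (rule C_infI)
  have "continuous_on {0..T} (\<lambda>x. x powr \<gamma> * dil (frac_ker \<gamma>) f x)"
    using assms by (intro continuous_intros continuous_on_powr' continuous_dil integrable_frac_ker) (auto simp: frac_ker_def)
  then show "continuous_on {0..T} (frac_int T \<gamma> f)"
    by (rule continuous_on_eq) (simp add: frac_int_eq_dil[OF assms(1)])
qed (auto simp: frac_int_def)

lemma K_op_C_inf:
  assumes "0 < \<beta>" "\<beta> < 1" "0 < T" and f: "f \<in> C_inf T"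
  shows "K_op T \<beta> f \<in> C_inf T"
proof (rule C_infI)
  have "continuous_on {0..T} (dil (K_ker \<beta>) f)"
    using assms by (intro continuous_dil integrable_K_ker) (auto simp: K_ker_def)
  then show "continuous_on {0..T} (K_op T \<beta> f)"
    by (rule continuous_on_eq) (simp add: K_op_eq_dil[OF assms(1,2) _ f])
  show "K_op T \<beta> f 0 = 0" using C_infD(2)[OF f] by (simp add: K_op_def)
qed (use assms in \<open>simp add: K_op_outside\<close>)

lemma frac_int_lincomb:
  assumes "0 < \<gamma>" "f \<in> C_inf T" "g \<in> C_inf T"
  shows "frac_int T \<gamma> (\<lambda>x. a * f x + b * g x) = (\<lambda>x. a * frac_int T \<gamma> f x + b * frac_int T \<gamma> g x)"
proof
  fix x
  show "frac_int T \<gamma> (\<lambda>x. a * f x + b * g x) x = a * frac_int T \<gamma> f x + b * frac_int T \<gamma> g x"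
  proof (cases "x \<in> {0..T}")
    case True
    then show ?thesis unfolding frac_int_eq_dil[OF assms(1) True]
      by (subst dil_lincomb[OF integrable_frac_ker[OF assms(1)] assms(2,3)]) (simp add: algebra_simps)
  qed (simp add: frac_int_outside)
qed

lemma K_op_lincomb:
  assumes "0 < \<beta>" "\<beta> < 1" "0 < T" "f \<in> C_inf T" "g \<in> C_inf T"
  shows "K_op T \<beta> (\<lambda>x. a * f x + b * g x) = (\<lambda>x. a * K_op T \<beta> f x + b * K_op T \<beta> g x)"
proof
  fix x
  show "K_op T \<beta> (\<lambda>x. a * f x + b * g x) x = a * K_op T \<beta> f x + b * K_op T \<beta> g x"
  proof (cases "x \<in> {0..T}")
    case True
    show ?thesis
      unfolding K_op_eq_dil[OF assms(1,2) True assms(4)] K_op_eq_dil[OF assms(1,2) True assms(5)]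
        K_op_eq_dil[OF assms(1,2) True C_inf_lincomb[OF assms(4,5)]]
      by (rule dil_lincomb[OF integrable_K_ker[OF assms(1,2)] assms(4,5)])
  qed (simp add: K_op_outside[OF assms(3)])
qed

lemma ennreal_frac_int:
  assumes \<gamma>: "0 < \<gamma>" and f: "f \<in> C_inf T" "\<And>x. 0 \<le> f x" and x: "x \<in> {0..T}"
  shows "ennreal (frac_int T \<gamma> f x) = (\<integral>\<^sup>+r. pw \<gamma> (x - r) * ennreal (f r) \<partial>lborel)"
proof (cases "x = 0")
  case True
  have "pw \<gamma> (x - r) * ennreal (f r) = 0" for r
    using C_infD(4)[OF f(1), of r] True by (cases "0 < r") auto
  then show ?thesis using True by (simp add: frac_int_def del: mult_eq_0_iff)
next
  case False
  note [measurable] = C_inf_measurable[OF f(1)]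
  have x0: "0 < x" using False x by simp
  have G: "0 < Gamma \<gamma>" using \<gamma> by (rule Gamma_real_pos)
  obtain B where B: "0 \<le> B" "\<And>x. \<bar>f x\<bar> \<le> B" using C_inf_bounded[OF f(1)] by blast
  let ?h = "\<lambda>r. indicator {0<..<x} r * ((x - r) powr (\<gamma> - 1) / Gamma \<gamma> * f r)"
  have eq: "ennreal (?h r) = pw \<gamma> (x - r) * ennreal (f r)" for r
  proof (cases "r \<in> {0<..<x}")
    case True
    then show ?thesis using G f(2)[of r] by (simp add: pw_def ennreal_mult[symmetric])
  next
    case False
    then show ?thesis using C_infD(4)[OF f(1), of r] by auto
  qed
  have "(\<integral>\<^sup>+r. ennreal (?h r) \<partial>lborel) \<le> (\<integral>\<^sup>+r. ennreal B * (pw \<gamma> (x - r) * pw 1 r) \<partial>lborel)"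
    unfolding eq
  proof (rule nn_integral_mono)
    fix r
    show "pw \<gamma> (x - r) * ennreal (f r) \<le> ennreal B * (pw \<gamma> (x - r) * pw 1 r)"
    proof (cases "0 < r")
      case True
      then have "pw 1 r = 1" by (simp add: pw_def)
      then show ?thesis using B(2)[of r] by (auto simp: mult.commute intro!: mult_right_mono ennreal_leI)
    next
      case False
      then show ?thesis using C_infD(4)[OF f(1), of r] by simp
    qed
  qed
  also have "\<dots> = ennreal B * pw (\<gamma> + 1) x" using \<gamma> by (simp add: nn_integral_cmult nn_integral_pw_conv)
  also have "\<dots> < \<infinity>" by (simp add: pw_def ennreal_mult_less_top)
  finally have fin: "(\<integral>\<^sup>+r. ennreal (?h r) \<partial>lborel) < \<infinity>" .
  have "frac_int T \<gamma> f x = (LINT r|lborel. ?h r)"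
    using x x0 by (simp add: frac_int_def set_lebesgue_integral_def)
  then have "ennreal (frac_int T \<gamma> f x) = (\<integral>\<^sup>+r. ennreal (?h r) \<partial>lborel)"
    using fin G f(2) by (subst nn_integral_eq_integral) (auto intro!: integrableI_nonneg)
  then show ?thesis by (simp only: eq)
qed

lemma ennreal_K_op:
  assumes \<beta>: "0 < \<beta>" "\<beta> < 1" and f: "f \<in> C_inf T" "\<And>x. 0 \<le> f x" and x: "x \<in> {0..T}"
  shows "ennreal (K_op T \<beta> f x) = (\<integral>\<^sup>+r. pw \<beta> (x - r) * (pw (1 - \<beta>) r * ennreal (f r)) \<partial>lborel)"
proof (cases "x = 0")
  case True
  have "pw \<beta> (x - r) * (pw (1 - \<beta>) r * ennreal (f r)) = 0" for r
    using True by (cases "0 < r") auto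
  then show ?thesis using True C_infD(2)[OF f(1)] by (simp add: K_op_def del: mult_eq_0_iff)
next
  case False
  note [measurable] = C_inf_measurable[OF f(1)]
  have x0: "0 < x" using False x by simp
  have G: "0 < Gamma \<beta>" "0 < Gamma (1 - \<beta>)" using \<beta> by (auto intro!: Gamma_real_pos)
  obtain B where B: "0 \<le> B" "\<And>x. \<bar>f x\<bar> \<le> B" using C_inf_bounded[OF f(1)] by blast
  let ?h = "\<lambda>r. indicator {0<..<x} r * ((x - r) powr (\<beta> - 1) * r powr (- \<beta>) / (Gamma \<beta> * Gamma (1 - \<beta>)) * f r)"
  have eq: "ennreal (?h r) = pw \<beta> (x - r) * (pw (1 - \<beta>) r * ennreal (f r))" for r
  proof (cases "r \<in> {0<..<x}")
    case True
    then show ?thesis using G f(2)[of r] by (simp add: pw_def ennreal_mult[symmetric])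
  next
    case False
    then show ?thesis by auto
  qed
  have "(\<integral>\<^sup>+r. ennreal (?h r) \<partial>lborel) \<le> (\<integral>\<^sup>+r. ennreal B * (pw \<beta> (x - r) * pw (1 - \<beta>) r) \<partial>lborel)"
    unfolding eq
  proof (rule nn_integral_mono)
    fix r
    have "ennreal (f r) \<le> ennreal B" using B(2)[of r] by (intro ennreal_leI) auto
    from mult_left_mono[OF this, of "pw \<beta> (x - r) * pw (1 - \<beta>) r"]
    show "pw \<beta> (x - r) * (pw (1 - \<beta>) r * ennreal (f r)) \<le> ennreal B * (pw \<beta> (x - r) * pw (1 - \<beta>) r)"
      by (simp add: mult_ac)
  qed
  also have "\<dots> = ennreal B * pw 1 x" using \<beta> by (simp add: nn_integral_cmult nn_integral_pw_conv)
  also have "\<dots> < \<infinity>" by (simp add: pw_def ennreal_mult_less_top)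
  finally have fin: "(\<integral>\<^sup>+r. ennreal (?h r) \<partial>lborel) < \<infinity>" .
  have "K_op T \<beta> f x = (LINT r|lborel. ?h r)"
    using x x0 False by (simp add: K_op_def set_lebesgue_integral_def)
  then have "ennreal (K_op T \<beta> f x) = (\<integral>\<^sup>+r. ennreal (?h r) \<partial>lborel)"
    using fin G f(2) by (subst nn_integral_eq_integral) (auto intro!: integrableI_nonneg)
  then show ?thesis by (simp only: eq)
qed

lemma frac_int_nonneg:
  assumes "0 < \<gamma>" "\<And>x. 0 \<le> f x"
  shows "0 \<le> frac_int T \<gamma> f x"
  using assms Gamma_real_pos[of \<gamma>]
  by (auto simp: frac_int_def set_lebesgue_integral_def intro!: Bochner_Integration.integral_nonneg)

lemma K_op_nonneg:
  assumes "0 < \<beta>" "\<beta> < 1" "\<And>x. 0 \<le> f x"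
  shows "0 \<le> K_op T \<beta> f x"
  using assms Gamma_real_pos[of \<beta>] Gamma_real_pos[of "1 - \<beta>"]
  by (auto simp: K_op_def set_lebesgue_integral_def intro!: Bochner_Integration.integral_nonneg)

text \<open>At x = 1 the kernel of \<open>K_op\<close> is a probability density with mean 1 -
  \<beta>, and the constant is its \<beta>-th moment. Jensen's inequality for the concave power
  \<beta> bounds this by (1 - \<beta>)^\<beta> < 1.\<close>

lemma mixing_constant_less_1:
  fixes \<beta> :: real
  assumes \<beta>: "0 < \<beta>" "\<beta> < 1"
  shows "1 / (Gamma (1 - \<beta>) * Gamma (1 + \<beta>)) < 1"
proof -
  let ?c = "1 / (Gamma (1 - \<beta>) * Gamma (1 + \<beta>))" and ?\<theta> = "1 - \<beta>"
  have G: "0 < Gamma \<beta>" "0 < Gamma (1 - \<beta>)" "0 < Gamma (1 + \<beta>)" "0 < Gamma (2 - \<beta>)" using \<beta> by (auto intro!: Gamma_real_pos)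
  have "1 - \<beta> \<notin> \<int>\<^sub>\<le>\<^sub>0" using \<beta> by (auto elim!: nonpos_Ints_cases)
  from Gamma_plus1[OF this] have G2: "Gamma (2 - \<beta>) = (1 - \<beta>) * Gamma (1 - \<beta>)" by simp
  \<comment> \<open>Common factor of the tangent line at the mean \<open>?\<theta>\<close>; the
    Gamma factor is the normalisation of \<open>pw (1 + \<beta>)\<close>, which carries the power
    r^\<beta>.\<close>
  let ?D = "?\<theta> powr (\<beta> - 1) / Gamma (1 + \<beta>)"
  text \<open>The tangent of \<open>r \<mapsto> r powr \<beta>\<close> at \<open>1 - \<beta>\<close> lies above the graph.\<close>
  have tangent: "pw (1 - \<beta>) r * pw (1 + \<beta>) r \<le> ennreal ?D * (ennreal \<beta> * (ennreal (1 - \<beta>) * pw (2 - \<beta>) r) + ennreal (?\<theta> * ?\<theta>) * pw (1 - \<beta>) r)" for r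
  proof (cases "0 < r")
    case True
    have "r powr \<beta> * ?\<theta> powr (1 - \<beta>) \<le> \<beta> * r + (1 - \<beta>) * ?\<theta>"
      using \<beta> True by (intro Youngs_inequality_0) auto
    then have "?\<theta> powr (\<beta> - 1) * (r powr \<beta> * ?\<theta> powr (1 - \<beta>)) \<le> ?\<theta> powr (\<beta> - 1) * (\<beta> * r + ?\<theta> * ?\<theta>)"
      by (rule mult_left_mono) simp
    moreover have "?\<theta> powr (\<beta> - 1) * ?\<theta> powr (1 - \<beta>) = 1"
      using \<beta> by (simp add: powr_add[symmetric])
    ultimately have "r powr \<beta> \<le> ?\<theta> powr (\<beta> - 1) * (\<beta> * r + ?\<theta> * ?\<theta>)"
      by (metis mult.left_commute mult.right_neutral)
    then have "r powr (- \<beta>) / Gamma (1 - \<beta>) * (r powr \<beta> / Gamma (1 + \<beta>))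
       \<le> r powr (- \<beta>) / Gamma (1 - \<beta>) * (?\<theta> powr (\<beta> - 1) * (\<beta> * r + ?\<theta> * ?\<theta>) / Gamma (1 + \<beta>))"
      using G by (intro mult_left_mono divide_right_mono) auto
    also have "\<dots> = ?D * (\<beta> * (r * r powr (- \<beta>) / Gamma (1 - \<beta>)) + ?\<theta> * ?\<theta> * (r powr (- \<beta>) / Gamma (1 - \<beta>)))"
      by (simp only: divide_inverse distrib_left mult_ac)
    also have "r * r powr (- \<beta>) / Gamma (1 - \<beta>) = (1 - \<beta>) * (r powr (1 - \<beta>) / Gamma (2 - \<beta>))"
      using True \<beta> powr_add[of r 1 "- \<beta>"] unfolding G2 by simp
    finally have le: "r powr (- \<beta>) / Gamma (1 - \<beta>) * (r powr \<beta> / Gamma (1 + \<beta>))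
      \<le> ?D * (\<beta> * ((1 - \<beta>) * (r powr (1 - \<beta>) / Gamma (2 - \<beta>))) + ?\<theta> * ?\<theta> * (r powr (- \<beta>) / Gamma (1 - \<beta>)))" .
    have lhs: "pw (1 - \<beta>) r * pw (1 + \<beta>) r = ennreal (r powr (- \<beta>) / Gamma (1 - \<beta>) * (r powr \<beta> / Gamma (1 + \<beta>)))"
      using True G by (simp add: pw_def ennreal_mult[symmetric])
    have rhs: "ennreal ?D * (ennreal \<beta> * (ennreal (1 - \<beta>) * pw (2 - \<beta>) r) + ennreal (?\<theta> * ?\<theta>) * pw (1 - \<beta>) r)
      = ennreal (?D * (\<beta> * ((1 - \<beta>) * (r powr (1 - \<beta>) / Gamma (2 - \<beta>))) + ?\<theta> * ?\<theta> * (r powr (- \<beta>) / Gamma (1 - \<beta>))))"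
      using True G \<beta> by (simp add: pw_def ennreal_mult[symmetric] ennreal_plus[symmetric] del: ennreal_plus)
    show ?thesis unfolding lhs rhs using le by (rule ennreal_leI)
  qed simp
  have "ennreal (?c / Gamma (1 + \<beta>)) = ennreal ?c * pw (1 + \<beta>) 1"
    using G by (simp add: pw_def ennreal_mult[symmetric])
  also have "\<dots> = (\<integral>\<^sup>+r. ennreal ?c * (pw \<beta> (1 - r) * pw 1 r) \<partial>lborel)"
    using \<beta> by (simp add: nn_integral_cmult nn_integral_pw_conv add.commute)
  also have "\<dots> = (\<integral>\<^sup>+r. pw \<beta> (1 - r) * (pw (1 - \<beta>) r * pw (1 + \<beta>) r) \<partial>lborel)"
    using \<beta> by (subst pw_mult_self) (auto simp: mult_ac)
  also have "\<dots> \<le> (\<integral>\<^sup>+r. pw \<beta> (1 - r) * (ennreal ?D * (ennreal \<beta> * (ennreal (1 - \<beta>) * pw (2 - \<beta>) r) + ennreal (?\<theta> * ?\<theta>) * pw (1 - \<beta>) r)) \<partial>lborel)"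
    by (intro nn_integral_mono mult_left_mono tangent) auto
  also have "\<dots> = (\<integral>\<^sup>+r. ennreal (?D * \<beta> * (1 - \<beta>)) * (pw \<beta> (1 - r) * pw (2 - \<beta>) r) + ennreal (?D * (?\<theta> * ?\<theta>)) * (pw \<beta> (1 - r) * pw (1 - \<beta>) r) \<partial>lborel)"
  proof -
    have D: "0 \<le> ?D" using G by simp
    have e: "ennreal (?D * \<beta> * (1 - \<beta>)) = ennreal ?D * (ennreal \<beta> * ennreal (1 - \<beta>))"
      "ennreal (?D * (?\<theta> * ?\<theta>)) = ennreal ?D * ennreal (?\<theta> * ?\<theta>)"
      using D \<beta> by (simp_all only: ennreal_mult mult_nonneg_nonneg less_imp_le diff_ge_0_iff_ge mult.assoc)
    show ?thesis unfolding e by (intro nn_integral_cong) (simp only: distrib_left mult_ac)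
  qed
  also have "\<dots> = ennreal (?D * \<beta> * (1 - \<beta>)) * pw 2 1 + ennreal (?D * (?\<theta> * ?\<theta>)) * pw 1 1"
    using \<beta> by (simp add: nn_integral_add nn_integral_cmult nn_integral_pw_conv)
  also have "\<dots> = ennreal (?D * \<beta> * (1 - \<beta>) + ?D * (?\<theta> * ?\<theta>))"
    using \<beta> G Gamma_fact[of 1, where 'a = real] by (simp add: pw_def ennreal_plus[symmetric] del: ennreal_plus)
  also have "?D * \<beta> * (1 - \<beta>) + ?D * (?\<theta> * ?\<theta>) = ?\<theta> powr (\<beta> - 1) * ?\<theta> / Gamma (1 + \<beta>)"
    by (simp add: algebra_simps add_divide_distrib[symmetric] diff_divide_distrib[symmetric])
  finally have "?c / Gamma (1 + \<beta>) \<le> ?\<theta> powr (\<beta> - 1) * ?\<theta> / Gamma (1 + \<beta>)"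
    using \<beta> G by (subst (asm) ennreal_le_iff) auto
  then have "?c \<le> ?\<theta> powr (\<beta> - 1) * ?\<theta>" using G(3) unfolding divide_le_cancel by blast
  also have "\<dots> = ?\<theta> powr \<beta>" using \<beta> powr_add[of ?\<theta> "\<beta> - 1" 1] by simp
  also have "\<dots> < 1" using \<beta> powr_less_mono2[of \<beta> "1 - \<beta>" 1] by simp
  finally show ?thesis .
qed

section \<open>The operator \<open>I_op\<close>\<close>

context
  fixes \<beta> T :: real
  assumes \<beta>: "0 < \<beta>" "\<beta> < 1" and T: "0 < T"
begin

definition psi :: "nat \<Rightarrow> (real \<Rightarrow> real) \<Rightarrow> real \<Rightarrow> real" where
  "psi n f = (K_op T \<beta> ^^ n) (frac_int T \<beta> f)"

lemma psi_simps: "psi 0 f = frac_int T \<beta> f" "psi (Suc n) f = K_op T \<beta> (psi n f)"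
  by (simp_all add: psi_def)

lemma psi_C_inf: "f \<in> C_inf T \<Longrightarrow> psi n f \<in> C_inf T"
  by (induction n) (simp_all add: psi_simps frac_int_C_inf K_op_C_inf \<beta> T)

lemma psi_lincomb:
  assumes "f \<in> C_inf T" "g \<in> C_inf T"
  shows "psi n (\<lambda>x. a * f x + b * g x) = (\<lambda>x. a * psi n f x + b * psi n g x)"
  by (induction n) (simp_all add: psi_simps frac_int_lincomb K_op_lincomb \<beta> T assms psi_C_inf)

lemma psi_nonneg: "(\<And>x. 0 \<le> f x) \<Longrightarrow> 0 \<le> psi n f x"
  by (induction n arbitrary: x) (simp_all add: psi_simps frac_int_nonneg K_op_nonneg \<beta>)

abbreviation mix :: real where
  "mix \<equiv> 1 / (Gamma (1 - \<beta>) * Gamma (1 + \<beta>))"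

lemma mix: "0 \<le> mix" "mix < 1"
  using mixing_constant_less_1[OF \<beta>] \<beta> by (auto intro!: divide_nonneg_nonneg mult_nonneg_nonneg less_imp_le[OF Gamma_real_pos])

text \<open>\<open>pw (1 + \<beta>)\<close> dominates \<open>frac_int\<close> of bounded functions
  and is an eigenfunction of \<open>K_op\<close>: multiplication by \<open>pw (1 - \<beta>)\<close>
  gives \<open>mix\<close> times \<open>pw 1\<close>, and convolution with \<open>pw \<beta>\<close>
  returns \<open>pw (1 + \<beta>)\<close>.\<close>

lemma psi_bound_ennreal:
  assumes f: "f \<in> C_inf T" "\<And>x. 0 \<le> f x" "\<And>x. f x \<le> B" and x: "x \<in> {0..T}"
  shows "ennreal (psi n f x) \<le> ennreal (B * mix ^ n) * pw (1 + \<beta>) x"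
  using x
proof (induction n arbitrary: x)
  case 0
  have B: "0 \<le> B" using f(2)[of 0] f(3)[of 0] by simp
  have "ennreal (psi 0 f x) = (\<integral>\<^sup>+r. pw \<beta> (x - r) * ennreal (f r) \<partial>lborel)"
    unfolding psi_simps using 0 by (intro ennreal_frac_int \<beta> f)
  also have "\<dots> \<le> (\<integral>\<^sup>+r. ennreal B * (pw \<beta> (x - r) * pw 1 r) \<partial>lborel)"
  proof (rule nn_integral_mono)
    fix r
    show "pw \<beta> (x - r) * ennreal (f r) \<le> ennreal B * (pw \<beta> (x - r) * pw 1 r)"
    proof (cases "0 < r")
      case True
      then have "pw 1 r = 1" by (simp add: pw_def)
      then show ?thesis using f(3)[of r] by (auto simp: mult.commute intro!: mult_right_mono ennreal_leI)
    qed (use C_infD(4)[OF f(1), of r] in simp)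
  qed
  also have "\<dots> = ennreal B * pw (1 + \<beta>) x" using \<beta> by (simp add: nn_integral_cmult nn_integral_pw_conv add.commute)
  finally show ?case by simp
next
  case (Suc n)
  have B: "0 \<le> B" using f(2)[of 0] f(3)[of 0] by simp
  have "ennreal (psi (Suc n) f x) = (\<integral>\<^sup>+r. pw \<beta> (x - r) * (pw (1 - \<beta>) r * ennreal (psi n f r)) \<partial>lborel)"
    unfolding psi_simps using Suc.prems by (intro ennreal_K_op \<beta> psi_C_inf psi_nonneg f)
  also have "\<dots> \<le> (\<integral>\<^sup>+r. ennreal (B * mix ^ Suc n) * (pw \<beta> (x - r) * pw 1 r) \<partial>lborel)"
  proof (rule nn_integral_mono)
    fix r
    show "pw \<beta> (x - r) * (pw (1 - \<beta>) r * ennreal (psi n f r)) \<le> ennreal (B * mix ^ Suc n) * (pw \<beta> (x - r) * pw 1 r)"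
    proof (cases "0 < r \<and> r < x")
      case True
      then have "ennreal (psi n f r) \<le> ennreal (B * mix ^ n) * pw (1 + \<beta>) r" using Suc.prems by (intro Suc.IH) auto
      then have "pw (1 - \<beta>) r * ennreal (psi n f r) \<le> ennreal (B * mix ^ n) * (pw (1 - \<beta>) r * pw (1 + \<beta>) r)"
        using mult_left_mono[of _ _ "pw (1 - \<beta>) r"] by (simp add: mult.left_commute)
      also have "\<dots> = ennreal (B * mix ^ n) * (ennreal mix * pw 1 r)"
        using \<beta> by (subst pw_mult_self) auto
      also have "\<dots> = ennreal (B * mix ^ Suc n) * pw 1 r"
        unfolding mult.assoc[symmetric] using B mix(1) by (subst ennreal_mult[symmetric]) (auto simp: mult_ac)
      finally show ?thesis using mult_left_mono[of _ _ "pw \<beta> (x - r)"] by (simp add: mult.left_commute)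
    qed auto
  qed
  also have "\<dots> = ennreal (B * mix ^ Suc n) * pw (1 + \<beta>) x"
    using \<beta> by (simp add: nn_integral_cmult nn_integral_pw_conv add.commute)
  finally show ?case .
qed

text \<open>The value at T, and thus the maximum over [0, T], of the eigenfunction
  \<open>pw (1 + \<beta>)\<close>.\<close>

definition bd :: real where "bd = T powr \<beta> / Gamma (1 + \<beta>)"

lemma bd_nonneg: "0 \<le> bd"
  using \<beta> by (auto simp: bd_def intro!: divide_nonneg_nonneg less_imp_le[OF Gamma_real_pos])

lemma psi_bound_nonneg:
  assumes f: "f \<in> C_inf T" "\<And>x. 0 \<le> f x" "\<And>x. f x \<le> B" and x: "x \<in> {0..T}"
  shows "psi n f x \<le> B * bd * mix ^ n"
proof -
  have B: "0 \<le> B" using f(2)[of 0] f(3)[of 0] by simp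
  have G: "0 < Gamma (1 + \<beta>)" using \<beta> by (intro Gamma_real_pos) simp
  have "ennreal (psi n f x) \<le> ennreal (B * mix ^ n) * pw (1 + \<beta>) x" by (rule psi_bound_ennreal[OF f x])
  also have "pw (1 + \<beta>) x \<le> ennreal bd"
    using x \<beta> G by (auto simp: pw_def bd_def intro!: ennreal_leI divide_right_mono powr_mono2)
  then have "ennreal (B * mix ^ n) * pw (1 + \<beta>) x \<le> ennreal (B * mix ^ n) * ennreal bd" by (rule mult_left_mono) simp
  also have "\<dots> = ennreal (B * bd * mix ^ n)"
    using B mix(1) bd_nonneg by (subst ennreal_mult[symmetric]) (auto simp: mult_ac)
  finally show ?thesis using B mix(1) bd_nonneg by (subst (asm) ennreal_le_iff) auto
qed

lemma psi_bound:
  assumes f: "f \<in> C_inf T" and B: "\<And>x. \<bar>f x\<bar> \<le> B" and x: "x \<in> {0..T}"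
  shows "\<bar>psi n f x\<bar> \<le> 2 * B * bd * mix ^ n"
proof -
  obtain g h where gh: "g \<in> C_inf T" "h \<in> C_inf T" "\<And>x. 0 \<le> g x" "\<And>x. 0 \<le> h x" "f = (\<lambda>x. g x - h x)"
    and le: "\<forall>B. (\<forall>x. \<bar>f x\<bar> \<le> B) \<longrightarrow> (\<forall>x. g x \<le> B \<and> h x \<le> B)"
    by (metis C_inf_split[OF f])
  have "psi n f x = psi n g x - psi n h x"
    unfolding gh(5) using psi_lincomb[OF gh(1,2), of n 1 "- 1"] by simp
  moreover have "psi n g x \<le> B * bd * mix ^ n" "psi n h x \<le> B * bd * mix ^ n"
    using le B by (auto intro!: psi_bound_nonneg gh x)
  moreover have "0 \<le> psi n g x" "0 \<le> psi n h x" by (auto intro!: psi_nonneg gh)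
  ultimately show ?thesis by linarith
qed

lemma psi_outside: "x \<notin> {0..T} \<Longrightarrow> psi n f x = 0"
  by (cases n) (simp_all add: psi_simps frac_int_outside K_op_outside[OF T])

lemma summable_bound: "summable (\<lambda>n. B * mix ^ n)"
  using mix by (intro summable_mult summable_geometric) auto

lemma I_op_eq: "I_op T \<beta> f x = (\<Sum>n. psi n f x)"
  by (simp add: I_op_def psi_def)

lemma summable_psi:
  assumes f: "f \<in> C_inf T"
  shows "summable (\<lambda>n. psi n f x)"
proof (cases "x \<in> {0..T}")
  case True
  obtain B where B: "\<And>x. \<bar>f x\<bar> \<le> B" using C_inf_bounded[OF f] by blast
  show ?thesis
    by (rule summable_comparison_test'[OF summable_bound[of "2 * B * bd"]]) (use psi_bound[OF f B True] in simp)
qed (simp add: psi_outside)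

lemma I_op_C_inf:
  assumes f: "f \<in> C_inf T"
  shows "I_op T \<beta> f \<in> C_inf T"
proof (rule C_infI)
  obtain B where B: "\<And>x. \<bar>f x\<bar> \<le> B" using C_inf_bounded[OF f] by blast
  have "uniform_limit {0..T} (\<lambda>n x. \<Sum>i<n. psi i f x) (\<lambda>x. \<Sum>i. psi i f x) sequentially"
    by (rule Weierstrass_m_test[OF _ summable_bound[of "2 * B * bd"]]) (use psi_bound[OF f B] in simp)
  moreover have "\<forall>\<^sub>F n in sequentially. continuous_on {0..T} (\<lambda>x. \<Sum>i<n. psi i f x)"
    by (intro always_eventually allI continuous_on_sum C_infD(1) psi_C_inf f)
  ultimately show "continuous_on {0..T} (I_op T \<beta> f)"
    unfolding I_op_eq[abs_def] by (intro uniform_limit_theorem) auto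
  show "I_op T \<beta> f 0 = 0" by (simp add: I_op_eq C_infD(2)[OF psi_C_inf[OF f]])
qed (simp add: I_op_eq psi_outside)

lemma I_op_lincomb:
  assumes f: "f \<in> C_inf T" and g: "g \<in> C_inf T"
  shows "I_op T \<beta> (\<lambda>x. a * f x + b * g x) = (\<lambda>x. a * I_op T \<beta> f x + b * I_op T \<beta> g x)"
proof
  fix x
  show "I_op T \<beta> (\<lambda>x. a * f x + b * g x) x = a * I_op T \<beta> f x + b * I_op T \<beta> g x"
    unfolding I_op_eq psi_lincomb[OF f g] using summable_psi[OF f, of x] summable_psi[OF g, of x]
    by (simp add: suminf_add[symmetric] suminf_mult summable_mult)
qed

lemma I_op_diff:
  assumes "f \<in> C_inf T" "g \<in> C_inf T"
  shows "I_op T \<beta> (\<lambda>x. f x - g x) = (\<lambda>x. I_op T \<beta> f x - I_op T \<beta> g x)"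
  using I_op_lincomb[OF assms, of 1 "- 1"] by simp

lemma I_op_nonneg: "f \<in> C_inf T \<Longrightarrow> (\<And>x. 0 \<le> f x) \<Longrightarrow> 0 \<le> I_op T \<beta> f x"
  unfolding I_op_eq by (intro suminf_nonneg summable_psi psi_nonneg)

lemma ennreal_I_op:
  assumes "f \<in> C_inf T" "\<And>x. 0 \<le> f x"
  shows "ennreal (I_op T \<beta> f x) = (\<Sum>n. ennreal (psi n f x))"
  unfolding I_op_eq by (intro suminf_ennreal2[symmetric] psi_nonneg summable_psi assms)

lemma I_op_abs_le:
  assumes f: "f \<in> C_inf T" and B: "\<And>x. \<bar>f x\<bar> \<le> B" and x: "x \<in> {0..T}"
  shows "\<bar>I_op T \<beta> f x\<bar> \<le> B * (2 * bd / (1 - mix))"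
proof -
  have "\<bar>I_op T \<beta> f x\<bar> \<le> (\<Sum>n. 2 * B * bd * mix ^ n)"
    unfolding I_op_eq using psi_bound[OF f B x] summable_bound[of "2 * B * bd"]
    by (intro order_trans[OF summable_rabs] suminf_le) (auto intro: summable_rabs_comparison_test[of _ "\<lambda>n. 2 * B * bd * mix ^ n"])
  also have "\<dots> = 2 * B * bd * (1 / (1 - mix))"
    using mix by (subst suminf_mult) (auto intro!: summable_geometric simp: suminf_geometric)
  finally show ?thesis by (simp add: mult_ac)
qed

text \<open>The function \<open>u = I_op f\<close> solves \<open>u = frac_int (f + x^{-\<beta>} u / Gamma (1 - \<beta>))\<close>, and the fractional
  integral of order \<open>1 - \<beta>\<close> turns this into a primitive.\<close>

lemma I_op_fixed_point:
  assumes f: "f \<in> C_inf T" "\<And>x. 0 \<le> f x" and x: "x \<in> {0..T}"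
  shows "ennreal (I_op T \<beta> f x) = (\<integral>\<^sup>+r. pw \<beta> (x - r) * (ennreal (f r) + pw (1 - \<beta>) r * ennreal (I_op T \<beta> f r)) \<partial>lborel)"
proof -
  note [measurable] = C_inf_measurable[OF f(1)] C_inf_measurable[OF psi_C_inf[OF f(1)]] C_inf_measurable[OF I_op_C_inf[OF f(1)]]
  have "ennreal (I_op T \<beta> f x) = (\<Sum>n. ennreal (psi (Suc n) f x)) + ennreal (psi 0 f x)"
    unfolding ennreal_I_op[OF f] by (subst suminf_offset[of _ 1]) auto
  also have "(\<Sum>n. ennreal (psi (Suc n) f x)) = (\<Sum>n. \<integral>\<^sup>+r. pw \<beta> (x - r) * (pw (1 - \<beta>) r * ennreal (psi n f r)) \<partial>lborel)"
    unfolding psi_simps by (intro suminf_cong ennreal_K_op \<beta> psi_C_inf psi_nonneg f x)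
  also have "\<dots> = (\<integral>\<^sup>+r. (\<Sum>n. pw \<beta> (x - r) * (pw (1 - \<beta>) r * ennreal (psi n f r))) \<partial>lborel)"
    by (rule nn_integral_suminf[symmetric]) measurable
  also have "\<dots> = (\<integral>\<^sup>+r. pw \<beta> (x - r) * (pw (1 - \<beta>) r * ennreal (I_op T \<beta> f r)) \<partial>lborel)"
    unfolding ennreal_I_op[OF f] by simp
  also have "ennreal (psi 0 f x) = (\<integral>\<^sup>+r. pw \<beta> (x - r) * ennreal (f r) \<partial>lborel)"
    unfolding psi_simps by (intro ennreal_frac_int \<beta> f x)
  also have "(\<integral>\<^sup>+r. pw \<beta> (x - r) * (pw (1 - \<beta>) r * ennreal (I_op T \<beta> f r)) \<partial>lborel) + (\<integral>\<^sup>+r. pw \<beta> (x - r) * ennreal (f r) \<partial>lborel)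
    = (\<integral>\<^sup>+r. pw \<beta> (x - r) * (ennreal (f r) + pw (1 - \<beta>) r * ennreal (I_op T \<beta> f r)) \<partial>lborel)"
    by (subst nn_integral_add[symmetric]) (auto simp: distrib_left add.commute)
  finally show ?thesis .
qed

text \<open>The function whose fractional integral of order \<beta> is I f. It is also the
  derivative of the integral of I f of order 1 - \<beta>; subtracting the censoring term leaves
  f.\<close>

definition source :: "(real \<Rightarrow> real) \<Rightarrow> real \<Rightarrow> real" where
  "source f q = f q + q powr (- \<beta>) / Gamma (1 - \<beta>) * I_op T \<beta> f q"

text \<open>Fractional integrals of orders \<beta> and 1 - \<beta> compose to an ordinary integral:
  after Tonelli the two kernels convolve to \<open>pw 1\<close>, the indicator of the positive axis.
  Integrability of the source, which may be singular at 0, follows since the left-hand side is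
  finite.\<close>

lemma frac_int_I_op:
  assumes f: "f \<in> C_inf T" "\<And>x. 0 \<le> f x" and x: "x \<in> {0..T}"
  shows "integrable lborel (\<lambda>q. indicator {..<x} q * source f q)"
    and "frac_int T (1 - \<beta>) (I_op T \<beta> f) x = (LINT q|lborel. indicator {..<x} q * source f q)"
proof -
  let ?u = "I_op T \<beta> f"
  have G: "0 < Gamma (1 - \<beta>)" using \<beta> by (intro Gamma_real_pos) simp
  have u: "?u \<in> C_inf T" "\<And>x. 0 \<le> ?u x" using f by (auto intro: I_op_C_inf I_op_nonneg)
  note [measurable] = C_inf_measurable[OF f(1)] C_inf_measurable[OF u(1)]
  have s0: "0 \<le> source f q" for q using f(2)[of q] u(2)[of q] G by (simp add: source_def)
  have W: "ennreal (f q) + pw (1 - \<beta>) q * ennreal (?u q) = ennreal (source f q)" for q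
  proof (cases "0 < q")
    case True
    then show ?thesis using f(2)[of q] u(2)[of q] G
      by (simp add: pw_def source_def ennreal_mult[symmetric] ennreal_plus[symmetric] del: ennreal_plus)
  next
    case False
    then show ?thesis using C_infD(4)[OF f(1), of q] C_infD(4)[OF u(1), of q] by (simp add: source_def)
  qed
  have [measurable]: "source f \<in> borel_measurable borel" unfolding source_def[abs_def] by measurable
  have "ennreal (frac_int T (1 - \<beta>) ?u x) = (\<integral>\<^sup>+r. pw (1 - \<beta>) (x - r) * ennreal (?u r) \<partial>lborel)"
    using \<beta> by (intro ennreal_frac_int u x) simp
  also have "\<dots> = (\<integral>\<^sup>+r. \<integral>\<^sup>+q. pw (1 - \<beta>) (x - r) * (pw \<beta> (r - q) * ennreal (source f q)) \<partial>lborel \<partial>lborel)"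
  proof (rule nn_integral_cong)
    fix r
    show "pw (1 - \<beta>) (x - r) * ennreal (?u r) = (\<integral>\<^sup>+q. pw (1 - \<beta>) (x - r) * (pw \<beta> (r - q) * ennreal (source f q)) \<partial>lborel)"
    proof (cases "r < x")
      case True
      have "ennreal (?u r) = (\<integral>\<^sup>+q. pw \<beta> (r - q) * ennreal (source f q) \<partial>lborel)"
      proof (cases "0 \<le> r")
        case nn: True
        show ?thesis unfolding W[symmetric] using nn True x by (intro I_op_fixed_point f) auto
      next
        case False
        have "pw \<beta> (r - q) * ennreal (source f q) = 0" for q
          using False C_infD(4)[OF f(1), of q] C_infD(4)[OF u(1), of q] by (cases "q < r") (auto simp: source_def)
        then show ?thesis using False C_infD(4)[OF u(1), of r] by (simp del: mult_eq_0_iff)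
      qed
      then show ?thesis by (simp add: nn_integral_cmult)
    qed simp
  qed
  also have "\<dots> = (\<integral>\<^sup>+q. \<integral>\<^sup>+r. pw (1 - \<beta>) (x - r) * (pw \<beta> (r - q) * ennreal (source f q)) \<partial>lborel \<partial>lborel)"
    by (rule lborel_pair.Fubini') measurable
  also have "\<dots> = (\<integral>\<^sup>+q. ennreal (indicator {..<x} q * source f q) \<partial>lborel)"
  proof (rule nn_integral_cong)
    fix q
    have "(\<integral>\<^sup>+r. pw (1 - \<beta>) (x - r) * (pw \<beta> (r - q) * ennreal (source f q)) \<partial>lborel)
      = (\<integral>\<^sup>+r. (pw (1 - \<beta>) (x - r) * pw \<beta> (r - q)) * ennreal (source f q) \<partial>lborel)"
      by (simp add: mult.assoc)
    also have "\<dots> = (\<integral>\<^sup>+r. pw (1 - \<beta>) (x - r) * pw \<beta> (r - q) \<partial>lborel) * ennreal (source f q)"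
      by (rule nn_integral_multc) measurable
    also have "(\<integral>\<^sup>+r. pw (1 - \<beta>) (x - r) * pw \<beta> (r - q) \<partial>lborel) = (\<integral>\<^sup>+r. pw (1 - \<beta>) ((x - q) - r) * pw \<beta> r \<partial>lborel)"
      by (subst nn_integral_real_affine[where t = q and c = 1]) (auto simp: algebra_simps)
    also have "\<dots> = pw 1 (x - q)" using \<beta> by (subst nn_integral_pw_conv) auto
    also have "pw 1 (x - q) * ennreal (source f q) = ennreal (indicator {..<x} q * source f q)"
      by (auto simp: pw_def indicator_def)
    finally show "(\<integral>\<^sup>+r. pw (1 - \<beta>) (x - r) * (pw \<beta> (r - q) * ennreal (source f q)) \<partial>lborel) = ennreal (indicator {..<x} q * source f q)" .
  qed
  finally have eq: "ennreal (frac_int T (1 - \<beta>) ?u x) = (\<integral>\<^sup>+q. ennreal (indicator {..<x} q * source f q) \<partial>lborel)" .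
  show int: "integrable lborel (\<lambda>q. indicator {..<x} q * source f q)"
    by (rule integrableI_nonneg) (auto simp: s0 eq[symmetric])
  have "0 \<le> frac_int T (1 - \<beta>) ?u x" using \<beta> by (intro frac_int_nonneg u) simp
  then show "frac_int T (1 - \<beta>) ?u x = (LINT q|lborel. indicator {..<x} q * source f q)"
    using eq nn_integral_eq_integral[OF int] s0
    by (subst (asm) nn_integral_eq_integral[OF int]) (auto simp: Bochner_Integration.integral_nonneg)
qed

lemma continuous_source:
  assumes f: "f \<in> C_inf T"
  shows "continuous_on {0<..T} (source f)"
proof -
  have G: "0 < Gamma (1 - \<beta>)" using \<beta> by (intro Gamma_real_pos) simp
  have "continuous_on {0<..T} f" "continuous_on {0<..T} (I_op T \<beta> f)"
    using C_infD(1)[OF f] C_infD(1)[OF I_op_C_inf[OF f]] by (auto elim!: continuous_on_subset)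
  then show ?thesis unfolding source_def[abs_def] using G by (intro continuous_intros) auto
qed

lemma has_derivative_frac_int_I_op_nonneg:
  assumes f: "f \<in> C_inf T" "\<And>x. 0 \<le> f x" and x: "x \<in> {0<..T}"
  shows "(frac_int T (1 - \<beta>) (I_op T \<beta> f) has_real_derivative source f x) (at x within {0<..T})"
proof -
  \<comment> \<open>The source is continuous only away from 0, so the fundamental theorem of
    calculus is applied on [a, T]; the integral over (0, a) enters as a constant.\<close>
  define a where "a = x / 2"
  have a: "0 < a" "a < x" "a \<le> T" using x by (auto simp: a_def)
  let ?J = "frac_int T (1 - \<beta>) (I_op T \<beta> f)"
  note [measurable] = C_inf_measurable[OF f(1)] C_inf_measurable[OF I_op_C_inf[OF f(1)]]
  have [measurable]: "source f \<in> borel_measurable borel" unfolding source_def[abs_def] by measurable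
  have J: "?J y = ?J a + integral {a..y} (source f)" if y: "y \<in> {a..T}" for y
  proof -
    have "set_integrable lborel {a..y} (source f)"
      by (intro borel_integrable_atLeastAtMost' continuous_on_subset[OF continuous_source[OF f(1)]])
        (use a that in auto)
    then have int: "(LBINT q:{a..y}. source f q) = integral {a..y} (source f)" by (rule set_borel_integral_eq_integral)
    have "?J y - ?J a = (LINT q|lborel. indicator {..<y} q * source f q - indicator {..<a} q * source f q)"
      using frac_int_I_op[OF f, of y] frac_int_I_op[OF f, of a] a that by simp
    also have "\<dots> = (LBINT q:{a..y}. source f q)"
      unfolding set_lebesgue_integral_def
    proof (rule integral_cong_AE)
      show "AE q in lborel. indicator {..<y} q * source f q - indicator {..<a} q * source f q = indicator {a..y} q *\<^sub>R source f q"
        using AE_lborel_singleton[of y] by eventually_elim (use that a in \<open>auto simp: indicator_def\<close>)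
    qed measurable
    finally show ?thesis using int by simp
  qed
  have "((\<lambda>y. integral {a..y} (source f)) has_real_derivative source f x) (at x within {a..T})"
    by (intro integral_has_real_derivative continuous_on_subset[OF continuous_source[OF f(1)]]) (use a x in auto)
  then have "((\<lambda>y. ?J a + integral {a..y} (source f)) has_real_derivative source f x) (at x within {a..T})"
    by (auto intro!: derivative_eq_intros)
  then have "(?J has_real_derivative source f x) (at x within {a..T})"
    by (rule has_field_derivative_transform_within[OF _ zero_less_one]) (use a x in \<open>auto intro: J[symmetric]\<close>)
  moreover have "at x within {a..T} = at x within {0<..T}"
    by (rule at_within_nhd[of _ "{a<..}"]) (use a in auto)
  ultimately show ?thesis by simp
qed

lemma has_derivative_frac_int_I_op:
  assumes f: "f \<in> C_inf T" and x: "x \<in> {0<..T}"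
  shows "(frac_int T (1 - \<beta>) (I_op T \<beta> f) has_real_derivative source f x) (at x within {0<..T})"
proof -
  obtain g h where gh: "g \<in> C_inf T" "h \<in> C_inf T" "\<And>x. 0 \<le> g x" "\<And>x. 0 \<le> h x" "f = (\<lambda>x. g x - h x)"
    using C_inf_split[OF f] by metis
  have I: "I_op T \<beta> f = (\<lambda>x. I_op T \<beta> g x - I_op T \<beta> h x)" unfolding gh(5) by (rule I_op_diff[OF gh(1,2)])
  have J: "frac_int T (1 - \<beta>) (I_op T \<beta> f) = (\<lambda>x. frac_int T (1 - \<beta>) (I_op T \<beta> g) x - frac_int T (1 - \<beta>) (I_op T \<beta> h) x)"
    unfolding I using frac_int_lincomb[of "1 - \<beta>" "I_op T \<beta> g" T "I_op T \<beta> h" 1 "- 1"] \<beta> I_op_C_inf gh by simp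
  have "source f x = source g x - source h x" unfolding source_def I by (simp add: gh(5) right_diff_distrib)
  then show ?thesis unfolding J
    using DERIV_diff[OF has_derivative_frac_int_I_op_nonneg[OF gh(1,3) x] has_derivative_frac_int_I_op_nonneg[OF gh(2,4) x]] by simp
qed

lemma censored_differentiable_I_op:
  assumes f: "f \<in> C_inf T"
  shows "censored_differentiable T \<beta> (I_op T \<beta> f)"
  unfolding censored_differentiable_def C1_on_def
proof (intro conjI exI ballI)
  have c: "continuous_on {0..T} (I_op T \<beta> f)" by (rule C_infD(1)[OF I_op_C_inf[OF f]])
  then show "continuous_on {0<..T} (I_op T \<beta> f)" by (rule continuous_on_subset) auto
  have "set_integrable lborel {0..T} (I_op T \<beta> f)" using c by (rule borel_integrable_atLeastAtMost')
  then show "set_integrable lborel {0<..T} (I_op T \<beta> f)" by (rule set_integrable_subset) auto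
  show "continuous_on {0<..T} (source f)" by (rule continuous_source[OF f])
qed (rule has_derivative_frac_int_I_op[OF f])

lemma censored_deriv_I_op:
  assumes f: "f \<in> C_inf T"
  shows "censored_deriv T \<beta> (I_op T \<beta> f) = f"
proof
  fix x
  show "censored_deriv T \<beta> (I_op T \<beta> f) x = f x"
  proof (cases "0 < x \<and> x \<le> T")
    case True
    have "(frac_int T (1 - \<beta>) (I_op T \<beta> f) has_vector_derivative source f x) (at x within {0<..T})"
      using has_derivative_frac_int_I_op[OF f, of x] True by (simp add: has_real_derivative_iff_has_vector_derivative)
    moreover have "at x within {0<..T} \<noteq> bot"
    proof -
      have "x islimpt {0<..T}"
      proof -
        have "x islimpt {x / 2<..<x}" using True by (simp add: islimpt_greaterThanLessThan2)
        then show ?thesis by (rule islimpt_subset) (use True in auto)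
      qed
      then show ?thesis by (simp add: trivial_limit_within)
    qed
    ultimately have "vector_derivative (frac_int T (1 - \<beta>) (I_op T \<beta> f)) (at x within {0<..T}) = source f x"
      by (intro vector_derivative_within)
    then show ?thesis using True by (simp add: censored_deriv_def source_def)
  next
    case False
    then show ?thesis using C_infD(3)[OF f, of x] C_infD(4)[OF f, of x] by (auto simp: censored_deriv_def)
  qed
qed

end

section \<open>The generator\<close>

context censored_interval
begin

abbreviation I :: "(real \<Rightarrow> real) \<Rightarrow> real \<Rightarrow> real" where
  "I \<equiv> I_op T \<beta>"

abbreviation cut :: "(real \<Rightarrow> real) \<Rightarrow> real \<Rightarrow> ennreal" where
  "cut f \<equiv> (\<lambda>y. ennreal (cut_above T f y))"

lemmas I_facts = I_op_C_inf[OF \<beta> T] I_op_nonneg[OF \<beta> T] I_op_diff[OF \<beta> T] I_op_lincomb[OF \<beta> T]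

lemma cut_le: "y \<le> T \<Longrightarrow> cut f y = ennreal (f y)"
  by (simp add: cut_above_def min_absorb1)

lemma cut_measurable: "f \<in> C_inf T \<Longrightarrow> (\<And>x. 0 \<le> f x) \<Longrightarrow> cut f \<in> borel_measurable borel"
  by (rule test_funD(7)[OF test_fun_cut_above[OF T]])

text \<open>Here probability meets analysis: the time-integrated contributions of n restarts obey
  the recursion that defines \<open>psi\<close>. Replacing f by its cut is harmless because the
  kernel only looks below x.\<close>

lemma green_eq_psi:
  assumes f: "f \<in> C_inf T" "\<And>x. 0 \<le> f x" and x: "x \<in> {0..T}"
  shows "green (cut f) n x = ennreal (psi \<beta> T n f x)"
  using x
proof (induction n arbitrary: x)
  case 0
  have "green (cut f) 0 x = (\<integral>\<^sup>+r. pw \<beta> (x - r) * ennreal (f r) \<partial>lborel)"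
    unfolding green_0[OF cut_measurable[OF f]]
  proof (rule nn_integral_cong)
    fix r
    show "pw \<beta> (x - r) * cut f r = pw \<beta> (x - r) * ennreal (f r)"
      using 0 cut_le[of r f] by (cases "r < x") auto
  qed
  also have "\<dots> = ennreal (psi \<beta> T 0 f x)"
    unfolding psi_simps[OF \<beta> T] by (rule ennreal_frac_int[OF \<beta>(1) f 0, symmetric])
  finally show ?case .
next
  case (Suc n)
  have "green (cut f) (Suc n) x = (\<integral>\<^sup>+r. pw \<beta> (x - r) * (pw (1 - \<beta>) r * ennreal (psi \<beta> T n f r)) \<partial>lborel)"
    unfolding green_Suc[OF cut_measurable[OF f]]
  proof (rule nn_integral_cong)
    fix r
    show "pw \<beta> (x - r) * (pw (1 - \<beta>) r * green (cut f) n r) = pw \<beta> (x - r) * (pw (1 - \<beta>) r * ennreal (psi \<beta> T n f r))"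
      using Suc.prems Suc.IH[of r] by (cases "0 < r \<and> r < x") auto
  qed
  also have "\<dots> = ennreal (psi \<beta> T (Suc n) f x)"
    unfolding psi_simps[OF \<beta> T]
    by (intro ennreal_K_op[OF \<beta>, symmetric] psi_C_inf[OF \<beta> T] psi_nonneg[OF \<beta> T] f Suc.prems)
  finally show ?case .
qed

lemma I_eq_potential:
  assumes f: "f \<in> C_inf T" "\<And>x. 0 \<le> f x" and x: "x \<in> {0..T}"
  shows "ennreal (I f x) = (\<integral>\<^sup>+t. (if 0 \<le> t then P0 f t x else 0) \<partial>lborel)"
  unfolding ennreal_I_op[OF \<beta> T f] green_eq_psi[OF f x, symmetric] by (rule suminf_green[OF cut_measurable[OF f]])

lemma P0_I:
  assumes f: "f \<in> C_inf T" "\<And>x. 0 \<le> f x" and h: "0 \<le> h" and x: "x \<in> {0..T}"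
  shows "P0 (I f) h x = (\<integral>\<^sup>+t. (if 0 \<le> t then cens (P0 f h) t x else 0) \<partial>lborel)"
proof -
  have "P0 (I f) h x = cens (\<lambda>y. \<integral>\<^sup>+t. (if 0 \<le> t then P0 f t y else 0) \<partial>lborel) h x"
  proof (rule cens_cong)
    fix y assume "y \<le> x"
    then have y: "y \<le> T" using x by simp
    show "cut (I f) y = (\<integral>\<^sup>+t. (if 0 \<le> t then P0 f t y else 0) \<partial>lborel)"
    proof (cases "0 \<le> y")
      case True
      then show ?thesis using y I_eq_potential[OF f, of y] by (simp add: cut_le)
    next
      case False
      have "P0 f t y = 0" for t
        using False test_funD(4)[OF test_fun_cut_above[OF T f]] by (intro cens_nonpos) auto
      then show ?thesis using False y C_infD(4)[OF I_facts(1)[OF f(1)], of y]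
        by (simp add: cut_le cong: if_cong)
    qed
  qed
  then show ?thesis by (simp only: cens_potential(1)[OF cut_measurable[OF f] h])
qed

lemma P_I_nonneg:
  assumes f: "f \<in> C_inf T" "\<And>x. 0 \<le> f x" and h: "0 \<le> h"
  shows "P h (I f) = I (P h f)"
proof (rule C_inf_eqI[of _ T])
  have Pf: "P h f \<in> C_inf T" "\<And>x. 0 \<le> P h f x" using f h by (auto intro: P_C_inf P_nonneg)
  have If: "I f \<in> C_inf T" "\<And>x. 0 \<le> I f x" using f by (auto intro: I_facts)
  show "P h (I f) \<in> C_inf T" by (rule P_C_inf[OF If(1) h])
  show "I (P h f) \<in> C_inf T" by (rule I_facts(1)[OF Pf(1)])
  fix x assume x: "x \<in> {0..T}"
  have "ennreal (P h (I f) x) = (\<integral>\<^sup>+t. (if 0 \<le> t then cens (P0 f h) t x else 0) \<partial>lborel)"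
    unfolding P_nonneg_aux(2)[OF If h x] by (rule P0_I[OF f h x])
  also have "\<dots> = ennreal (I (P h f) x)"
    unfolding I_eq_potential[OF Pf x] P0_P[OF f h x] ..
  finally show "P h (I f) x = I (P h f) x"
    using P_nonneg[of "I f" h x] If I_facts(2)[OF Pf, of x] by simp
qed

lemma P_I:
  assumes f: "f \<in> C_inf T" and h: "0 \<le> h"
  shows "P h (I f) = I (P h f)"
proof -
  obtain g k where gk: "g \<in> C_inf T" "k \<in> C_inf T" "\<And>x. 0 \<le> g x" "\<And>x. 0 \<le> k x" "f = (\<lambda>x. g x - k x)"
    using C_inf_split[OF f] by metis
  have "P h (I f) = (\<lambda>x. P h (I g) x - P h (I k) x)"
    unfolding gk(5) I_facts(3)[OF gk(1,2)] by (rule P_diff[OF I_facts(1)[OF gk(1)] I_facts(1)[OF gk(2)] h])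
  also have "\<dots> = (\<lambda>x. I (P h g) x - I (P h k) x)"
    unfolding P_I_nonneg[OF gk(1,3) h] P_I_nonneg[OF gk(2,4) h] ..
  also have "\<dots> = I (P h f)"
    unfolding gk(5) P_diff[OF gk(1,2) h] by (rule I_facts(3)[OF P_C_inf[OF gk(1) h] P_C_inf[OF gk(2) h], symmetric])
  finally show ?thesis .
qed

text \<open>P_h I f plus the integral of P_t f over [0, h] equals I f. If P_t f x stays within e of
  f x on that interval, the integral is within e h of h f x, which is the claim after division by
  h.\<close>

lemma P_I_increment:
  assumes f: "f \<in> C_inf T" "\<And>x. 0 \<le> f x" and h: "0 < h" and x: "x \<in> {0..T}"
    and e: "\<And>s. 0 < s \<Longrightarrow> s < h \<Longrightarrow> \<bar>P s f x - f x\<bar> \<le> e"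
  shows "\<bar>(P h (I f) x - I f x) / h + f x\<bar> \<le> e"
proof -
  have h0: "0 \<le> h" using h by simp
  have If: "I f \<in> C_inf T" "\<And>x. 0 \<le> I f x" using f by (auto intro: I_facts)
  have e0: "0 \<le> e" using e[of "h / 2"] h by simp
  let ?J = "\<integral>\<^sup>+t. (if 0 \<le> t \<and> t < h then P0 f t x else 0) \<partial>lborel"
  have split: "ennreal (P h (I f) x) + ?J = ennreal (I f x)"
    unfolding P_nonneg_aux(2)[OF If h0 x] P0_I[OF f h0 x] I_eq_potential[OF f x]
    by (rule cens_potential(2)[OF cut_measurable[OF f] h0])
  have J: "?J = (\<integral>\<^sup>+t\<in>{0<..<h}. P0 f t x \<partial>lborel)"
  proof (rule nn_integral_cong_AE)
    show "AE t in lborel. (if 0 \<le> t \<and> t < h then P0 f t x else 0) = P0 f t x * indicator {0<..<h} t"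
      using AE_lborel_singleton[of 0] by eventually_elim auto
  qed
  have int: "(\<integral>\<^sup>+t\<in>{0<..<h}. ennreal c \<partial>lborel) = ennreal (c * h)" if "0 \<le> c" for c
    using that h by (simp add: nn_integral_cmult_indicator ennreal_mult)
  have "?J \<le> (\<integral>\<^sup>+t\<in>{0<..<h}. ennreal (f x + e) \<partial>lborel)"
    unfolding J
  proof (intro nn_integral_mono)
    fix t
    show "P0 f t x * indicator {0<..<h} t \<le> ennreal (f x + e) * indicator {0<..<h} t"
      using e[of t] P_nonneg_aux(2)[OF f _ x, of t, symmetric] by (auto simp: indicator_def intro!: ennreal_leI)
  qed
  then have up: "?J \<le> ennreal ((f x + e) * h)" using int[of "f x + e"] f(2)[of x] e0 by (simp del: ennreal_plus)
  have "(\<integral>\<^sup>+t\<in>{0<..<h}. ennreal (max 0 (f x - e)) \<partial>lborel) \<le> ?J"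
    unfolding J
  proof (intro nn_integral_mono)
    fix t
    \<comment> \<open>Truncation at 0 keeps the lower bound meaningful as an extended nonnegative
      number.\<close>
    have "max 0 (f x - e) \<le> P t f x" if "0 < t" "t < h"
      using e[OF that] P_nonneg[of f t x] f by auto
    then show "ennreal (max 0 (f x - e)) * indicator {0<..<h} t \<le> P0 f t x * indicator {0<..<h} t"
      using P_nonneg_aux(2)[OF f _ x, of t, symmetric] by (auto simp: indicator_def intro!: ennreal_leI simp del: max_less_iff_conj)
  qed
  then have lo: "ennreal (max 0 (f x - e) * h) \<le> ?J" using int[of "max 0 (f x - e)"] by simp
  obtain j where j: "0 \<le> j" "?J = ennreal j" using up by (cases ?J) (auto simp: top_unique)
  have P0: "0 \<le> P h (I f) x" using If by (intro P_nonneg) auto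
  have "ennreal (P h (I f) x + j) = ennreal (I f x)" using split j P0 by (simp add: ennreal_plus)
  then have "P h (I f) x + j = I f x" using P0 j If(2)[of x] by (subst (asm) ennreal_inj) auto
  moreover have "j \<le> (f x + e) * h" using up j f(2)[of x] e0 h by (simp add: ennreal_le_iff)
  moreover have "(f x - e) * h \<le> j"
  proof -
    have "max 0 (f x - e) * h \<le> j" using lo j by (simp add: ennreal_le_iff)
    moreover have "(f x - e) * h \<le> max 0 (f x - e) * h" using h by (intro mult_right_mono) auto
    ultimately show ?thesis by simp
  qed
  ultimately have "\<bar>(P h (I f) x - I f x) + f x * h\<bar> \<le> e * h" by (simp add: abs_le_iff algebra_simps)
  moreover have "(P h (I f) x - I f x) / h + f x = ((P h (I f) x - I f x) + f x * h) / h"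
    using h by (simp add: field_simps)
  ultimately show ?thesis using h by (simp add: pos_divide_le_eq)
qed

lemma has_gen_value_I_nonneg:
  assumes f: "f \<in> C_inf T" "\<And>x. 0 \<le> f x"
  shows "uniform_limit {0..T} (\<lambda>s x. (P s (I f) x - I f x) / s) (\<lambda>x. - f x) (at_right 0)"
proof (rule uniform_limitI)
  fix e :: real assume e: "0 < e"
  then have "\<forall>\<^sub>F s in at_right 0. \<forall>x\<in>{0..T}. dist (P s f x) (f x) < e / 2"
    using uniform_limitD[OF P_strongly_continuous[OF f(1)], of "e / 2"] by simp
  then obtain d where d: "0 < d" "\<And>s x. 0 < s \<Longrightarrow> s < d \<Longrightarrow> x \<in> {0..T} \<Longrightarrow> dist (P s f x) (f x) < e / 2"
    unfolding eventually_at_right[OF zero_less_one] by blast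
  have "dist ((P h (I f) x - I f x) / h) (- f x) < e" if "0 < h" "h < d" "x \<in> {0..T}" for h x
  proof -
    have "\<bar>(P h (I f) x - I f x) / h + f x\<bar> \<le> e / 2"
      using that d(2)[of _ x] by (intro P_I_increment[OF f]) (auto simp: dist_real_def intro!: less_imp_le)
    then show ?thesis using e by (simp add: dist_real_def)
  qed
  then show "\<forall>\<^sub>F s in at_right 0. \<forall>x\<in>{0..T}. dist ((P s (I f) x - I f x) / s) (- f x) < e"
    unfolding eventually_at_right[OF zero_less_one] using d(1) by blast
qed

lemma uniform_limit_quotient_I:
  assumes f: "f \<in> C_inf T"
  shows "uniform_limit {0..T} (\<lambda>s x. (P s (I f) x - I f x) / s) (\<lambda>x. - f x) (at_right 0)"
proof -
  obtain g k where gk: "g \<in> C_inf T" "k \<in> C_inf T" "\<And>x. 0 \<le> g x" "\<And>x. 0 \<le> k x" "f = (\<lambda>x. g x - k x)"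
    using C_inf_split[OF f] by metis
  have "uniform_limit {0..T} (\<lambda>s x. (P s (I g) x - I g x) / s - (P s (I k) x - I k x) / s) (\<lambda>x. - g x - - k x) (at_right 0)"
    by (intro uniform_limit_minus has_gen_value_I_nonneg gk)
  moreover have "\<forall>\<^sub>F s in at_right (0::real). \<forall>x\<in>{0..T}. (P s (I g) x - I g x) / s - (P s (I k) x - I k x) / s = (P s (I f) x - I f x) / s"
    using eventually_at_right_less[of 0]
  proof eventually_elim
    case (elim s)
    then show ?case
      unfolding gk(5) I_facts(3)[OF gk(1,2)] P_diff[OF I_facts(1)[OF gk(1)] I_facts(1)[OF gk(2)] less_imp_le[OF elim]]
      by (simp add: diff_divide_distrib)
  qed
  moreover have "- g x - - k x = - f x" for x by (simp add: gk(5))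
  ultimately show ?thesis by (subst (asm) uniform_limit_cong)
qed

section \<open>Uniqueness of generator values and identification of the domain\<close>

lemma C_inf_uminus: "f \<in> C_inf T \<Longrightarrow> (\<lambda>x. - f x) \<in> C_inf T"
  using C_inf_lincomb[of f T f "- 1" 0] by simp

lemma has_gen_value_I: "f \<in> C_inf T \<Longrightarrow> has_gen_value T P (I f) (\<lambda>x. - f x)"
  unfolding has_gen_value_def by (intro conjI C_inf_uminus uniform_limit_quotient_I)

lemma uniform_limit_unique:
  fixes F :: "'b \<Rightarrow> real \<Rightarrow> real"
  assumes "uniform_limit A F g L" "uniform_limit A F g' L" "L \<noteq> bot" "x \<in> A"
  shows "g x = g' x"
  using tendsto_uniform_limitI[OF assms(1,4)] tendsto_uniform_limitI[OF assms(2,4)] assms(3) by (rule tendsto_unique[rotated])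

lemma has_gen_value_unique:
  assumes "has_gen_value T P u g" "has_gen_value T P u g'"
  shows "g = g'"
  using assms unfolding has_gen_value_def
  by (intro C_inf_eqI[of g T g']) (auto elim: uniform_limit_unique)

lemma gen_op_eq: "has_gen_value T P u g \<Longrightarrow> gen_op T P u = g"
  unfolding gen_op_def by (rule the_equality) (auto elim: has_gen_value_unique)

lemma uniform_limit_I:
  assumes F: "\<forall>\<^sub>F s in L. F s \<in> C_inf T" and g: "g \<in> C_inf T" and lim: "uniform_limit {0..T} F g L"
  shows "uniform_limit {0..T} (\<lambda>s. I (F s)) (I g) L"
proof (rule uniform_limitI)
  fix e :: real assume e: "0 < e"
  \<comment> \<open>The operator bound from \<open>I_op_abs_le\<close>; dividing by c + 1 rather
    than c avoids a zero denominator and makes the final inequality strict.\<close>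
  define c where "c = 2 * bd \<beta> T / (1 - mix \<beta>)"
  have c: "0 \<le> c" unfolding c_def using mix[OF \<beta> T] bd_nonneg[OF \<beta> T] by (intro divide_nonneg_nonneg) auto
  have "\<forall>\<^sub>F s in L. \<forall>x\<in>{0..T}. dist (F s x) (g x) < e / (c + 1)"
    using uniform_limitD[OF lim, of "e / (c + 1)"] e c by simp
  then show "\<forall>\<^sub>F s in L. \<forall>x\<in>{0..T}. dist (I (F s) x) (I g x) < e"
    using F
  proof eventually_elim
    case (elim s)
    show ?case
    proof
      fix x assume x: "x \<in> {0..T}"
      have "\<bar>F s y - g y\<bar> \<le> e / (c + 1)" for y
        using elim(1) C_infD(3)[OF elim(2), of y] C_infD(3)[OF g, of y] e c
        by (cases "y \<in> {0..T}") (auto simp: dist_real_def intro: less_imp_le)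
      then have "\<bar>I (\<lambda>x. F s x - g x) x\<bar> \<le> e / (c + 1) * c"
        unfolding c_def by (intro I_op_abs_le[OF \<beta> T] C_inf_diff elim g x)
      also have "\<dots> < e" using e c by (simp add: field_simps)
      finally show "dist (I (F s) x) (I g x) < e"
        by (simp add: I_facts(3)[OF elim(2) g] dist_real_def)
    qed
  qed
qed

text \<open>Applying the bounded operator \<open>I\<close>, which commutes with \<open>P\<close>, to the difference quotients of \<open>u\<close>
  gives the difference quotients of \<open>I u\<close>, whose limit is \<open>- u\<close>.\<close>

lemma gen_value_imp_I:
  assumes u: "u \<in> C_inf T" and g: "has_gen_value T P u g"
  shows "u = I (\<lambda>x. - g x)"
proof (rule C_inf_eqI[OF u])
  have gC: "g \<in> C_inf T" and lim: "uniform_limit {0..T} (\<lambda>s x. (P s u x - u x) / s) g (at_right 0)"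
    using g by (auto simp: has_gen_value_def)
  show "I (\<lambda>x. - g x) \<in> C_inf T" by (intro I_facts(1) C_inf_uminus gC)
  have eq: "(\<lambda>x. (P s u x - u x) / s) = (\<lambda>x. 1 / s * P s u x + (- 1 / s) * u x)" for s
    by (simp add: diff_divide_distrib)
  have Q: "(\<lambda>x. (P s u x - u x) / s) \<in> C_inf T"
    "I (\<lambda>x. (P s u x - u x) / s) = (\<lambda>x. (P s (I u) x - I u x) / s)" if "0 < s" for s
  proof -
    have Pu: "P s u \<in> C_inf T" using u that by (intro P_C_inf) auto
    show "(\<lambda>x. (P s u x - u x) / s) \<in> C_inf T" unfolding eq by (rule C_inf_lincomb[OF Pu u])
    show "I (\<lambda>x. (P s u x - u x) / s) = (\<lambda>x. (P s (I u) x - I u x) / s)"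
      unfolding eq I_facts(4)[OF Pu u] P_I[OF u less_imp_le[OF that]] by (simp add: diff_divide_distrib)
  qed
  have "uniform_limit {0..T} (\<lambda>s. I (\<lambda>x. (P s u x - u x) / s)) (I g) (at_right 0)"
    using eventually_at_right_less[of 0] by (intro uniform_limit_I[OF _ gC lim]) (auto elim!: eventually_mono intro: Q)
  moreover have "\<forall>\<^sub>F s in at_right (0::real). \<forall>x\<in>{0..T}. I (\<lambda>x. (P s u x - u x) / s) x = (P s (I u) x - I u x) / s"
    using eventually_at_right_less[of 0] by eventually_elim (simp add: Q(2))
  ultimately have "uniform_limit {0..T} (\<lambda>s x. (P s (I u) x - I u x) / s) (I g) (at_right 0)"
    by (subst (asm) uniform_limit_cong) auto
  fix x assume x: "x \<in> {0..T}"
  have "I g x = - u x"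
    by (rule uniform_limit_unique[OF \<open>uniform_limit {0..T} (\<lambda>s x. (P s (I u) x - I u x) / s) (I g) (at_right 0)\<close> uniform_limit_quotient_I[OF u] _ x]) simp
  then show "u x = I (\<lambda>x. - g x) x"
    using I_facts(4)[OF gC gC, of "- 1" 0] by (simp add: fun_eq_iff)
qed

lemma gen_domain_P: "gen_domain T P = I ` C_inf T"
proof (intro set_eqI iffI)
  fix u assume "u \<in> gen_domain T P"
  then obtain g where g: "u \<in> C_inf T" "has_gen_value T P u g" by (auto simp: gen_domain_def)
  then have "(\<lambda>x. - g x) \<in> C_inf T" by (intro C_inf_uminus) (simp add: has_gen_value_def)
  then show "u \<in> I ` C_inf T" using gen_value_imp_I[OF g] by blast
next
  fix u assume "u \<in> I ` C_inf T"
  then show "u \<in> gen_domain T P" unfolding gen_domain_def using has_gen_value_I I_facts(1) by blast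
qed

end

text \<open>The integrability clause ensures that the expectations defining the semigroup are
  genuine and not the default value 0 of a non-integrable function; likewise differentiability
  precedes the formula for the generator.\<close>

theorem proposition4p10:
  fixes M :: "'a measure" and S :: "nat \<Rightarrow> real \<Rightarrow> 'a \<Rightarrow> real" and \<beta> T :: real
  assumes "0 < \<beta>" and "\<beta> < 1" and "0 < T"
    and "prob_space M"
    and "iid_neg_stable_subordinators M \<beta> S"
  shows "(\<forall>t\<ge>0. \<forall>f\<in>C_inf T. \<forall>x\<in>{0..T}.
            integrable (completion M) (\<lambda>\<omega>. extend_cemetery f (censored_process S x t \<omega>))) \<and>
         feller_semigroup T (censored_semigroup M S T) \<and>
         gen_domain T (censored_semigroup M S T) = I_op T \<beta> ` C_inf T \<and>
         (\<forall>u \<in> I_op T \<beta> ` C_inf T.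
            censored_differentiable T \<beta> u \<and>
            gen_op T (censored_semigroup M S T) u = (\<lambda>x. - censored_deriv T \<beta> u x))"
proof -
  interpret prob_space M by fact
  interpret censored_interval M S \<beta> T by unfold_locales (use assms in auto)
  have "censored_differentiable T \<beta> (I_op T \<beta> f) \<and>
      gen_op T (censored_semigroup M S T) (I_op T \<beta> f) = (\<lambda>x. - censored_deriv T \<beta> (I_op T \<beta> f) x)" if "f \<in> C_inf T" for f
    using censored_differentiable_I_op[OF assms(1-3) that] censored_deriv_I_op[OF assms(1-3) that]
      gen_op_eq[OF has_gen_value_I[OF that]] by simp
  then show ?thesis using integrable_process feller_P gen_domain_P by blast
qed

end
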